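(* Let $d\ge 1$ and $T\ge 1$ be integers and let $x_1,\dots,x_T\in\mathbb{R}^d_+\setminus\{0\}$ be arbitrary. Let $\lambda,\mu>0$ and $S\in\mathbb{N}$ satisfy $\lambda\ge 2e$, $$\frac1\lambda\Big(1+\frac{2\mu}{\lambda}\Big)^2\le\min\Big\{\frac1{556},\ \frac{5\mu}{8(1+\lambda)}\Big\},\qquad S\ge 9\log\Big(2\max\big\{(T+d+1)^2,\ 10^4\sqrt{1+3\mu}\big\}\Big).$$ Then the algorithm VB-FTRL-qN with parameters $(\lambda,\mu,S)$ (described in the context) produces a sequence $\widetilde w_{1:T}$ such that $$\mathscr{R}_T(\widetilde w_{1:T}|x_{1:T})\le(\lambda+2\mu)\,\big[(d-1)\log(T+\lambda d)+1\big].$$ In particular, choosing $\lambda=560$, $\mu=2$ and $S=18\lceil\log(T+d+164)\rceil+7$ guarantees that $$\mathscr{R}_T(\widetilde w_{1:T}|x_{1:T})\le 564\,d\log(T+560d).$$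
   Context: $\Delta_d=\{w\in\mathbb{R}^d_+:\sum_i w[i]=1\}$ is the standard simplex; $e_i$ is the $i$-th canonical basis vector of $\mathbb{R}^d$, $\mathbf 1_d$ is the all-ones vector, and $[t]=\{1,\dots,t\}$, $[0]=\emptyset$. The regret of a sequence $w_{1:T}\in\Delta_d^T$ is $$\mathscr{R}_T(w_{1:T}|x_{1:T})=\sum_{t\in[T]}-\log(x_t^\top w_t)-\min_{w\in\Delta_d}\sum_{t\in[T]}-\log(x_t^\top w).$$ Algorithm VB-FTRL-qN (for $d\ge 2$; for $d=1$ it plays $\widetilde w_t=1$). Let $A\in\mathbb{R}^{d\times(d-1)}$ be the matrix whose first $d-1$ rows form $I_{d-1}$ and whose last row is $-(1,\dots,1)$, and let $A^+=(A^\top A)^{-1}A^\top$. Put $x_{-j}=e_j$ for $j\in[d]$, $[t]^+=[t]\cup\{-1,\dots,-d\}$, and $\lambda_\tau=\lambda$ if $\tau<0$, $\lambda_\tau=1$ if $\tau>0$. Initialize $\widetilde w_0=\frac1d\mathbf 1_d$. In each round $t=1,\dots,T$ set $v_t^{(0)}=A^+(\widetilde w_{t-1}-e_d)$, and for $s=0,\dots,S-1$ compute $$g_\tau=-\frac{A^\top x_\tau}{x_\tau^\top(Av_t^{(s)}+e_d)}\quad(\tau\in[t-1]^+),\qquad H=\sum_{\tau\in[t-1]^+}\lambda_\tau g_\tau g_\tau^\top,\qquad \pi_\tau=\lambda_\tau\,g_\tau^\top H^{-1}g_\tau,$$ $$G=\sum_{\tau\in[t-1]^+}(\lambda_\tau+\mu\pi_\tau)g_\tau,\qquad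 M=H+3\mu\sum_{\tau\in[t-1]^+}\pi_\tau g_\tau g_\tau^\top,\qquad v_t^{(s+1)}=v_t^{(s)}-M^{-1}G.$$ Then play $\widetilde w_t=Av_t^{(S)}+e_d$ and receive $x_t$. *)

theory Defs
  imports
    Complex_Main
    "HOL-Library.Extended_Real"
    "Jordan_Normal_Form.Gauss_Jordan_Elimination"
begin

definition std_simplex :: "nat \<Rightarrow> real vec set" where
  "std_simplex d = {w \<in> carrier_vec d. (\<forall>i<d. 0 \<le> w $ i) \<and> (\<Sum>i<d. w $ i) = 1}"

text \<open>
  The loss takes the value \<open>\<infinity>\<close> at \<open>0\<close>, so that a finite bound on the regret forces every
  inner product \<open>x\<^sub>t \<bullet> w\<^sub>t\<close> to be positive; the real-valued \<open>- ln 0 = 0\<close> would not.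
  Inner products of simplex points with nonnegative vectors are never negative, so the value
  below \<open>0\<close> is immaterial.
\<close>
definition neg_log :: "real \<Rightarrow> ereal" where
  "neg_log y = (if y > 0 then ereal (- ln y) else \<infinity>)"

definition cum_loss :: "nat \<Rightarrow> (nat \<Rightarrow> real vec) \<Rightarrow> (nat \<Rightarrow> real vec) \<Rightarrow> ereal" where
  "cum_loss T x w = (\<Sum>t\<in>{1..T}. neg_log (x t \<bullet> w t))"

text \<open>
  For nonzero nonnegative \<open>x\<^sub>t\<close> the infimum below is finite, and it is a minimum, since the
  simplex is compact and the cumulative loss is lower semicontinuous.
\<close>
definition regret :: "nat \<Rightarrow> nat \<Rightarrow> (nat \<Rightarrow> real vec) \<Rightarrow> (nat \<Rightarrow> real vec) \<Rightarrow> ereal" where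
  "regret d T x w = cum_loss T x w - (INF u\<in>std_simplex d. cum_loss T x (\<lambda>t. u))"

text \<open>
  Indices of vectors start at \<open>0\<close>, so the basis vector \<open>e\<^sub>j\<close> is \<open>unit_vec d (j - 1)\<close>.
\<close>
definition last_basis :: "nat \<Rightarrow> real vec" where
  "last_basis d = unit_vec d (d - 1)"

definition A_mat :: "nat \<Rightarrow> real mat" where
  "A_mat d = mat d (d - 1) (\<lambda>(i, j). if i = d - 1 then - 1 else if i = j then 1 else 0)"

text \<open>
  Meaningful only for invertible arguments; see \<open>well_defined_run\<close>.
\<close>
definition inv_mat :: "real mat \<Rightarrow> real mat" where
  "inv_mat B = the (mat_inverse B)"

definition A_pinv :: "nat \<Rightarrow> real mat" where
  "A_pinv d = inv_mat (transpose_mat (A_mat d) * A_mat d) * transpose_mat (A_mat d)"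

text \<open>
  The parameter \<open>n\<close> is the number of vectors already observed, so round \<open>t\<close> uses \<open>n = t - 1\<close>.
\<close>
definition idx_plus :: "nat \<Rightarrow> nat \<Rightarrow> int set" where
  "idx_plus d n = {1..int n} \<union> {- int d..- 1}"

definition ext_x :: "nat \<Rightarrow> (nat \<Rightarrow> real vec) \<Rightarrow> int \<Rightarrow> real vec" where
  "ext_x d x \<tau> = (if \<tau> < 0 then unit_vec d (nat (- \<tau>) - 1) else x (nat \<tau>))"

definition wt :: "real \<Rightarrow> int \<Rightarrow> real" where
  "wt lam \<tau> = (if \<tau> < 0 then lam else 1)"

definition qn_point :: "nat \<Rightarrow> real vec \<Rightarrow> real vec" where
  "qn_point d v = A_mat d *\<^sub>v v + last_basis d"

definition qn_g :: "nat \<Rightarrow> (nat \<Rightarrow> real vec) \<Rightarrow> real vec \<Rightarrow> int \<Rightarrow> real vec" where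
  "qn_g d x v \<tau> =
     (- (1 / (ext_x d x \<tau> \<bullet> qn_point d v))) \<cdot>\<^sub>v (transpose_mat (A_mat d) *\<^sub>v ext_x d x \<tau>)"

definition qn_H :: "nat \<Rightarrow> real \<Rightarrow> (nat \<Rightarrow> real vec) \<Rightarrow> nat \<Rightarrow> real vec \<Rightarrow> real mat" where
  "qn_H d lam x n v = mat (d - 1) (d - 1)
     (\<lambda>(i, j). \<Sum>\<tau>\<in>idx_plus d n. wt lam \<tau> * (qn_g d x v \<tau> $ i * qn_g d x v \<tau> $ j))"

definition qn_pi :: "nat \<Rightarrow> real \<Rightarrow> (nat \<Rightarrow> real vec) \<Rightarrow> nat \<Rightarrow> real vec \<Rightarrow> int \<Rightarrow> real" where
  "qn_pi d lam x n v \<tau> =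
     wt lam \<tau> * (qn_g d x v \<tau> \<bullet> (inv_mat (qn_H d lam x n v) *\<^sub>v qn_g d x v \<tau>))"

definition qn_G :: "nat \<Rightarrow> real \<Rightarrow> real \<Rightarrow> (nat \<Rightarrow> real vec) \<Rightarrow> nat \<Rightarrow> real vec \<Rightarrow> real vec" where
  "qn_G d lam mu x n v = vec (d - 1)
     (\<lambda>i. \<Sum>\<tau>\<in>idx_plus d n. (wt lam \<tau> + mu * qn_pi d lam x n v \<tau>) * qn_g d x v \<tau> $ i)"

definition qn_M :: "nat \<Rightarrow> real \<Rightarrow> real \<Rightarrow> (nat \<Rightarrow> real vec) \<Rightarrow> nat \<Rightarrow> real vec \<Rightarrow> real mat" where
  "qn_M d lam mu x n v = qn_H d lam x n v + (3 * mu) \<cdot>\<^sub>m mat (d - 1) (d - 1)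
     (\<lambda>(i, j). \<Sum>\<tau>\<in>idx_plus d n. qn_pi d lam x n v \<tau> * (qn_g d x v \<tau> $ i * qn_g d x v \<tau> $ j))"

definition qn_step :: "nat \<Rightarrow> real \<Rightarrow> real \<Rightarrow> (nat \<Rightarrow> real vec) \<Rightarrow> nat \<Rightarrow> real vec \<Rightarrow> real vec" where
  "qn_step d lam mu x n v = v - inv_mat (qn_M d lam mu x n v) *\<^sub>v qn_G d lam mu x n v"

text \<open>
  \<open>qn_iter d lam mu x n w s\<close> is the iterate \<open>v\<^sup>(\<^sup>s\<^sup>)\<close> of round \<open>n + 1\<close>, where \<open>w\<close> is the point
  played in round \<open>n\<close>.
\<close>
definition qn_iter ::
    "nat \<Rightarrow> real \<Rightarrow> real \<Rightarrow> (nat \<Rightarrow> real vec) \<Rightarrow> nat \<Rightarrow> real vec \<Rightarrow> nat \<Rightarrow> real vec" where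
  "qn_iter d lam mu x n w s = (qn_step d lam mu x n ^^ s) (A_pinv d *\<^sub>v (w - last_basis d))"

primrec vb_ftrl_qn ::
    "nat \<Rightarrow> real \<Rightarrow> real \<Rightarrow> nat \<Rightarrow> (nat \<Rightarrow> real vec) \<Rightarrow> nat \<Rightarrow> real vec" where
  "vb_ftrl_qn d lam mu S x 0 = vec d (\<lambda>_. 1 / real d)"
| "vb_ftrl_qn d lam mu S x (Suc n) =
     (if d = 1 then vec 1 (\<lambda>_. 1)
      else qn_point d (qn_iter d lam mu x n (vb_ftrl_qn d lam mu S x n) S))"

text \<open>
  The algorithm performs only legitimate operations: no division by zero, and every matrix that
  is inverted is invertible. Without this the totalised operations could hide an undefined run.
  For \<open>d = 1\<close> nothing is computed.
\<close>
definition well_defined_run ::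
    "nat \<Rightarrow> real \<Rightarrow> real \<Rightarrow> nat \<Rightarrow> (nat \<Rightarrow> real vec) \<Rightarrow> nat \<Rightarrow> bool" where
  "well_defined_run d lam mu S x T \<longleftrightarrow>
     (d \<ge> 2 \<longrightarrow>
       invertible_mat (transpose_mat (A_mat d) * A_mat d) \<and>
       (\<forall>n<T. \<forall>s<S.
         (let v = qn_iter d lam mu x n (vb_ftrl_qn d lam mu S x n) s in
           (\<forall>\<tau>\<in>idx_plus d n. ext_x d x \<tau> \<bullet> qn_point d v \<noteq> 0) \<and>
           invertible_mat (qn_H d lam x n v) \<and>
           invertible_mat (qn_M d lam mu x n v))))"

end

theory Submission
  imports Defs "Jordan_Normal_Form.Determinant" "HOL-Library.FuncSet" "HOL-Analysis.L2_Norm"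
begin

text \<open>
Write \<open>F\<^sub>n\<close> for the weighted logarithmic loss of the basis vectors and of the first \<open>n\<close> observations
plus \<open>\<mu> V\<^sub>n\<close>, where \<open>V\<^sub>n = \<onehalf> ln det H\<^sub>n\<close> is the volumetric barrier.  The vector \<open>G\<close> of the
algorithm is the gradient of \<open>F\<^sub>n\<close>, and \<open>M\<close> majorises its Hessian.  The proof compares values of
\<open>F\<^sub>n\<close> only; it differentiates \<open>F\<^sub>n\<close> nowhere and never speaks of its minimiser.

Moving from \<open>v\<close> to \<open>u\<close> multiplies the inner product with \<open>x\<^sub>\<tau>\<close> by \<open>1 - y\<^sub>\<tau>\<close>, where
\<open>y\<^sub>\<tau> = g\<^sub>\<tau> \<bullet> (u - v)\<close>.  So \<open>H\<close> stays a weighted Gram matrix of the same vectors, with weights divided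
by \<open>(1 - y\<^sub>\<tau>)\<^sup>2\<close>.  The logarithm of the determinant of such a matrix is convex in the logarithms of
the weights (Cauchy-Binet and Jensen, \<open>ln_det_gram_ge\<close>) and concave in the weights
(\<open>ln_det_gram_le\<close>), and in both cases the tangent is given by the leverage scores.  This gives the
global bounds \<open>\<Sum> \<pi>\<^sub>\<tau> (- ln (1 - y\<^sub>\<tau>)) \<le> V u - V v \<le> \<onehalf> \<Sum> \<pi>\<^sub>\<tau> ((1 - y\<^sub>\<tau>)\<^sup>-\<^sup>2 - 1)\<close>, whose
quadratic parts are \<open>\<onehalf> \<Sum> \<pi>\<^sub>\<tau> y\<^sub>\<tau>\<^sup>2\<close> and three times that.  The curvature of \<open>F\<^sub>n\<close> therefore lies
between \<open>M / 3\<close> and \<open>M\<close>, and a step with \<open>M\<close> shrinks a small optimality gap at least by the factor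
\<open>3/4\<close> (\<open>newton_step_contracts\<close>).  All expansions are accurate because every \<open>x\<^sub>\<tau>\<close> is a nonnegative
combination of basis vectors, which carry the weight \<open>\<lambda>\<close>: hence \<open>\<bar>y\<^sub>\<tau>\<bar>\<close> is at most
\<open>\<lambda>\<^sup>-\<^sup>1\<^sup>/\<^sup>2\<close> times the length of \<open>u - v\<close> in the norm of \<open>H\<close> (\<open>rel_bound\<close>), and \<open>\<lambda> \<ge> 550\<close>.

When an observation with leverage \<open>\<pi>\<close> arrives, the gradient at the point just played changes by a
vector of dual norm at most \<open>(1 + 2\<mu>/\<lambda>) \<surd>\<pi>\<close> (\<open>grad_Suc_dual\<close>).  The new gap is about half the
square of this norm, which the hypotheses bound by \<open>\<mu>\<pi>/2\<close>; and the volumetric barrier of the new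
potential exceeds the old one by at least \<open>\<pi>/2\<close> at that point (\<open>volume_increment\<close>).  So the barrier
pays for the instability, the losses telescope to a difference \<open>F\<^sub>T v - F\<^sub>0 c\<close> with \<open>c\<close> the uniform
portfolio (\<open>cumulative_loss_bound\<close>), and the small gap is a valid start for the next round.  Choosing
for \<open>v\<close> a mixture of the comparator with the uniform portfolio finishes the proof
(\<open>comparator_bound\<close>).

For \<open>\<lambda> = 560\<close> and \<open>\<mu> = 2\<close> the quantity \<open>(1 + 2\<mu>/\<lambda>)\<^sup>2/\<lambda>\<close> is about \<open>1/552\<close>, more than \<open>1/556\<close>, so
the second claim is no instance of the first.  Both are instances of \<open>vb_ftrl_qn_guarantee\<close>, which
allows \<open>1/550\<close>.
\<close>

section \<open>Determinants of weighted Gram matrices\<close>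

definition gram :: "nat \<Rightarrow> 'i set \<Rightarrow> ('i \<Rightarrow> real) \<Rightarrow> ('i \<Rightarrow> real vec) \<Rightarrow> real mat" where
  "gram n I c a = mat n n (\<lambda>(i, j). \<Sum>\<tau>\<in>I. c \<tau> * (a \<tau> $ i * a \<tau> $ j))"

definition rows_at :: "nat \<Rightarrow> ('i \<Rightarrow> real vec) \<Rightarrow> (nat \<Rightarrow> 'i) \<Rightarrow> real mat" where
  "rows_at n a f = mat n n (\<lambda>(i, j). a (f i) $ j)"

lemma gram_carrier [simp]: "gram n I c a \<in> carrier_mat n n"
  by (simp add: gram_def)

lemma rows_at_carrier [simp]: "rows_at n a f \<in> carrier_mat n n"
  by (simp add: rows_at_def)

text \<open>
Expanding every row by multilinearity.  The weights may depend on the row, so that the expansion also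
covers a matrix in which a single row has been replaced.
\<close>
lemma det_row_weighted:
  assumes "finite I"
  shows "det (mat n n (\<lambda>(i, j). \<Sum>\<tau>\<in>I. c i \<tau> * (a \<tau> $ i * a \<tau> $ j))) =
    (\<Sum>f\<in>PiE {..<n} (\<lambda>_. I). (\<Prod>i<n. c i (f i)) * ((\<Prod>i<n. a (f i) $ i) * det (rows_at n a f)))"
    (is "det ?B = _")
proof -
  let ?F = "PiE {..<n} (\<lambda>_. I)"
  have "det ?B = (\<Sum>p\<in>{p. p permutes {0..<n}}. signof p * (\<Prod>i=0..<n. ?B $$ (i, p i)))"
    by (rule det_def') simp
  also have "\<dots> = (\<Sum>p\<in>{p. p permutes {0..<n}}. \<Sum>f\<in>?F.
      signof p * (\<Prod>i<n. c i (f i) * (a (f i) $ i * a (f i) $ p i)))"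
  proof (rule sum.cong[OF refl])
    fix p :: "nat \<Rightarrow> nat" assume "p \<in> {p. p permutes {0..<n}}"
    then have p: "\<And>i. i < n \<Longrightarrow> p i < n" by (auto simp: permutes_in_image[of p "{0..<n}", simplified])
    have "(\<Prod>i=0..<n. ?B $$ (i, p i)) = (\<Prod>i<n. \<Sum>\<tau>\<in>I. c i \<tau> * (a \<tau> $ i * a \<tau> $ p i))"
      using p by (intro prod.cong) auto
    also have "\<dots> = (\<Sum>f\<in>?F. \<Prod>i<n. c i (f i) * (a (f i) $ i * a (f i) $ p i))"
      using assms by (simp add: prod_sum_PiE)
    finally show "signof p * (\<Prod>i=0..<n. ?B $$ (i, p i)) =
       (\<Sum>f\<in>?F. signof p * (\<Prod>i<n. c i (f i) * (a (f i) $ i * a (f i) $ p i)))"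
      by (simp add: sum_distrib_left)
  qed
  also have "\<dots> = (\<Sum>f\<in>?F. \<Sum>p\<in>{p. p permutes {0..<n}}.
      signof p * (\<Prod>i<n. c i (f i) * (a (f i) $ i * a (f i) $ p i)))"
    by (rule sum.swap)
  also have "\<dots> = (\<Sum>f\<in>?F. (\<Prod>i<n. c i (f i)) * ((\<Prod>i<n. a (f i) $ i) * det (rows_at n a f)))"
  proof (rule sum.cong[OF refl])
    fix f assume "f \<in> ?F"
    have "det (rows_at n a f) = (\<Sum>p\<in>{p. p permutes {0..<n}}. signof p * (\<Prod>i<n. a (f i) $ p i))"
      by (subst det_def'[of _ n])
        (auto intro!: sum.cong prod.cong simp: rows_at_def lessThan_atLeast0
          permutes_in_image[of _ "{0..<n}", simplified])
    then show "(\<Sum>p\<in>{p. p permutes {0..<n}}. signof p * (\<Prod>i<n. c i (f i) * (a (f i) $ i * a (f i) $ p i)))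
      = (\<Prod>i<n. c i (f i)) * ((\<Prod>i<n. a (f i) $ i) * det (rows_at n a f))"
      by (simp add: prod.distrib sum_distrib_left algebra_simps)
  qed
  finally show ?thesis .
qed

text \<open>
Averaging over the permutations of the rows: a permutation changes the determinant by its sign only,
and the signed average of the products of diagonal entries is once more the determinant, up to
\<open>fact n\<close>.  This produces the squares that make all coefficients nonnegative.
\<close>
lemma symmetrized_row_expansion:
  assumes W: "\<And>f p. f \<in> PiE {..<n} (\<lambda>_. I) \<Longrightarrow> p permutes {..<n} \<Longrightarrow> W (f \<circ> p) = (W f :: real)"
  shows "(\<Sum>f\<in>PiE {..<n} (\<lambda>_. I). W f * ((\<Prod>i<n. a (f i) $ i) * det (rows_at n a f))) =
    (\<Sum>f\<in>PiE {..<n} (\<lambda>_. I). W f * ((det (rows_at n a f))\<^sup>2 / fact n))"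
proof -
  let ?F = "PiE {..<n} (\<lambda>_. I)" and ?P = "{p. p permutes {..<n}}"
  let ?X = "\<lambda>f. W f * ((\<Prod>i<n. a (f i) $ i) * det (rows_at n a f))"
  have mem: "f \<circ> p \<in> ?F" if f: "f \<in> ?F" and p: "p permutes {..<n}" for f p
  proof (rule PiE_I)
    fix i assume "i \<in> {..<n}"
    then have "p i \<in> {..<n}" using permutes_in_image[OF p] by blast
    then show "(f \<circ> p) i \<in> I" using f by auto
  next
    fix i assume "i \<notin> {..<n}"
    then show "(f \<circ> p) i = undefined" using f permutes_not_in[OF p] PiE_arb[OF f] by auto
  qed
  have one: "(\<Sum>f\<in>?F. ?X f) = (\<Sum>f\<in>?F. W f * (det (rows_at n a f) * (signof p * (\<Prod>i<n. a (f (p i)) $ i))))"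
    if p: "p permutes {..<n}" for p
  proof -
    define q where "q = Hilbert_Choice.inv p"
    have q: "q permutes {..<n}" and inv: "q \<circ> p = id" "p \<circ> q = id"
      using permutes_inv[OF p] permutes_inv_o[OF p] by (auto simp: q_def)
    have "bij_betw (\<lambda>f. f \<circ> p) ?F ?F"
    proof (rule bij_betw_byWitness[where f' = "\<lambda>f. f \<circ> q"])
      show "\<forall>f\<in>?F. f \<circ> p \<circ> q = f" "\<forall>f\<in>?F. f \<circ> q \<circ> p = f"
        using inv by (simp_all only: comp_assoc comp_id) simp_all
      show "(\<lambda>f. f \<circ> p) ` ?F \<subseteq> ?F" "(\<lambda>f. f \<circ> q) ` ?F \<subseteq> ?F"
        using mem[OF _ p] mem[OF _ q] by blast+
    qed
    then have "(\<Sum>f\<in>?F. ?X f) = (\<Sum>f\<in>?F. ?X (f \<circ> p))"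
      by (rule sum.reindex_bij_betw[where g = ?X, symmetric])
    also have "\<dots> = (\<Sum>f\<in>?F. W f * (det (rows_at n a f) * (signof p * (\<Prod>i<n. a (f (p i)) $ i))))"
    proof (rule sum.cong[OF refl])
      fix f assume f: "f \<in> ?F"
      have "p i < n" if "i < n" for i
        using permutes_in_image[OF p, of i] that by simp
      then have "rows_at n a (f \<circ> p) = mat n n (\<lambda>(i, j). rows_at n a f $$ (p i, j))"
        by (auto simp: rows_at_def)
      then have "det (rows_at n a (f \<circ> p)) = signof p * det (rows_at n a f)"
        using det_permute_rows[OF rows_at_carrier p[unfolded lessThan_atLeast0]] by (simp only:)
      then show "?X (f \<circ> p) = W f * (det (rows_at n a f) * (signof p * (\<Prod>i<n. a (f (p i)) $ i)))"
        using W[OF f p] by simp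
    qed
    finally show ?thesis .
  qed
  have "fact n * (\<Sum>f\<in>?F. ?X f) = (\<Sum>p\<in>?P. \<Sum>f\<in>?F. ?X f)"
    by (simp add: card_permutations)
  also have "\<dots> = (\<Sum>p\<in>?P. \<Sum>f\<in>?F. W f * (det (rows_at n a f) * (signof p * (\<Prod>i<n. a (f (p i)) $ i))))"
    by (intro sum.cong refl one) simp
  also have "\<dots> = (\<Sum>f\<in>?F. \<Sum>p\<in>?P. W f * (det (rows_at n a f) * (signof p * (\<Prod>i<n. a (f (p i)) $ i))))"
    by (rule sum.swap)
  also have "\<dots> = (\<Sum>f\<in>?F. W f * (det (rows_at n a f))\<^sup>2)"
  proof (rule sum.cong[OF refl])
    fix f assume "f \<in> ?F"
    have "det (rows_at n a f) = det (transpose_mat (rows_at n a f))"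
      by (simp add: det_transpose[of _ n])
    also have "\<dots> = (\<Sum>p\<in>?P. signof p * (\<Prod>i<n. a (f (p i)) $ i))"
      by (subst det_def'[of _ n])
        (auto intro!: sum.cong prod.cong simp: rows_at_def lessThan_atLeast0
          permutes_in_image[of _ "{0..<n}", simplified])
    finally show "(\<Sum>p\<in>?P. W f * (det (rows_at n a f) * (signof p * (\<Prod>i<n. a (f (p i)) $ i))))
       = W f * (det (rows_at n a f))\<^sup>2"
      by (simp add: sum_distrib_left[symmetric] power2_eq_square)
  qed
  finally show ?thesis
    by (simp add: field_simps sum_divide_distrib[symmetric])
qed

text \<open>
The squared maximal minor at the rows \<open>f 0, \<dots>, f (n - 1)\<close>.  The expansions run over all index
functions, not over index sets: functions with a repeated value contribute \<open>0\<close>, and every index set is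
counted \<open>fact n\<close> times.
\<close>
definition minor_weight :: "nat \<Rightarrow> ('i \<Rightarrow> real vec) \<Rightarrow> (nat \<Rightarrow> 'i) \<Rightarrow> real" where
  "minor_weight n a f = (det (rows_at n a f))\<^sup>2 / fact n"

lemma minor_weight_nonneg: "0 \<le> minor_weight n a f"
  by (simp add: minor_weight_def)

lemma cauchy_binet_gram:
  assumes "finite I"
  shows "det (gram n I c a) = (\<Sum>f\<in>PiE {..<n} (\<lambda>_. I). (\<Prod>i<n. c (f i)) * minor_weight n a f)"
proof -
  have sym: "(\<Prod>i<n. c ((f \<circ> p) i)) = (\<Prod>i<n. c (f i))"
    if "p permutes {..<n}" for p and f :: "nat \<Rightarrow> 'a"
    using prod.permute[OF that, of "\<lambda>i. c (f i)"] by (simp add: o_def)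
  have "det (gram n I c a) = (\<Sum>f\<in>PiE {..<n} (\<lambda>_. I).
      (\<Prod>i<n. c (f i)) * ((\<Prod>i<n. a (f i) $ i) * det (rows_at n a f)))"
    unfolding gram_def by (rule det_row_weighted[OF assms, where c = "\<lambda>_. c"])
  also have "\<dots> = (\<Sum>f\<in>PiE {..<n} (\<lambda>_. I).
      (\<Prod>i<n. c (f i)) * ((det (rows_at n a f))\<^sup>2 / fact n))"
    by (rule symmetrized_row_expansion[where W = "\<lambda>f. \<Prod>i<n. c (f i)"]) (rule sym)
  finally show ?thesis by (simp only: minor_weight_def)
qed

text \<open>
The derivative of the Cauchy-Binet expansion in the direction \<open>e\<close>, evaluated by cofactors.  The double
sum on the right is \<open>a\<^sub>\<tau> \<bullet> R a\<^sub>\<tau>\<close>.  Read probabilistically: if \<open>f\<close> is drawn with probability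
proportional to its summand in \<open>cauchy_binet_gram\<close>, then \<open>\<tau>\<close> occurs in \<open>f\<close> with expected
multiplicity equal to its leverage score.
\<close>
lemma gram_marginals:
  assumes fin: "finite I" and R: "R \<in> carrier_mat n n" and inv: "gram n I c a * R = 1\<^sub>m n"
  shows "(\<Sum>f\<in>PiE {..<n} (\<lambda>_. I). (\<Sum>k<n. e (f k) * (\<Prod>i\<in>{..<n} - {k}. c (f i))) * minor_weight n a f)
    = det (gram n I c a) * (\<Sum>\<tau>\<in>I. e \<tau> * (\<Sum>i<n. \<Sum>j<n. a \<tau> $ i * a \<tau> $ j * R $$ (j, i)))"
proof -
  let ?F = "PiE {..<n} (\<lambda>_. I)" and ?H = "gram n I c a"
  let ?W = "\<lambda>f. \<Sum>k<n. e (f k) * (\<Prod>i\<in>{..<n} - {k}. c (f i))"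
  have sym: "?W (f \<circ> p) = ?W f" if p: "p permutes {..<n}" for p f
  proof -
    have "(\<Prod>i\<in>{..<n} - {k}. c (f (p i))) = (\<Prod>i\<in>{..<n} - {p k}. c (f i))" if "k < n" for k
    proof -
      have "inj p" using p by (rule permutes_inj)
      then have im: "p ` ({..<n} - {k}) = {..<n} - {p k}"
        using permutes_image[OF p] by (simp add: image_set_diff)
      show ?thesis
        unfolding im[symmetric] by (subst prod.reindex) (auto intro: inj_on_subset[OF \<open>inj p\<close>])
    qed
    then have "?W (f \<circ> p) = (\<Sum>k<n. (\<lambda>k. e (f k) * (\<Prod>i\<in>{..<n} - {k}. c (f i))) (p k))"
      by simp
    also have "\<dots> = ?W f"
      using sum.permute[OF p, of "\<lambda>k. e (f k) * (\<Prod>i\<in>{..<n} - {k}. c (f i))"] by (simp add: o_def)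
    finally show ?thesis .
  qed
  have adj: "adj_mat ?H = det ?H \<cdot>\<^sub>m R"
  proof -
    have "adj_mat ?H = adj_mat ?H * (?H * R)" using adj_mat(1)[of ?H n] by (simp add: inv)
    also have "\<dots> = (adj_mat ?H * ?H) * R"
      using adj_mat(1)[of ?H n] R by (intro assoc_mult_mat[symmetric]) auto
    also have "\<dots> = det ?H \<cdot>\<^sub>m R" using adj_mat(3)[of ?H n] R
      by (simp add: mult_smult_assoc_mat[of _ n n])
    finally show ?thesis .
  qed
  have cof: "cofactor ?H k j = det ?H * R $$ (j, k)" if "k < n" "j < n" for k j
  proof -
    have "adj_mat ?H $$ (j, k) = cofactor ?H k j"
      unfolding adj_mat_def using that by (simp add: gram_def)
    then show ?thesis using adj that R by simp
  qed
  have row: "(\<Sum>f\<in>?F. (e (f k) * (\<Prod>i\<in>{..<n} - {k}. c (f i))) * ((\<Prod>i<n. a (f i) $ i) * det (rows_at n a f)))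
     = det ?H * (\<Sum>\<tau>\<in>I. e \<tau> * (\<Sum>j<n. a \<tau> $ k * a \<tau> $ j * R $$ (j, k)))" if k: "k < n" for k
  proof -
    let ?c = "\<lambda>i. if i = k then e else c"
    let ?B = "mat n n (\<lambda>(i, j). \<Sum>\<tau>\<in>I. ?c i \<tau> * (a \<tau> $ i * a \<tau> $ j))"
    have w: "(\<Prod>i<n. ?c i (f i)) = e (f k) * (\<Prod>i\<in>{..<n} - {k}. c (f i))" for f
    proof -
      have "(\<Prod>i<n. ?c i (f i)) = ?c k (f k) * (\<Prod>i\<in>{..<n} - {k}. ?c i (f i))"
        using k by (intro prod.remove) auto
      also have "(\<Prod>i\<in>{..<n} - {k}. ?c i (f i)) = (\<Prod>i\<in>{..<n} - {k}. c (f i))"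
        by (intro prod.cong) auto
      finally show ?thesis by simp
    qed
    have del: "mat_delete ?B k j = mat_delete ?H k j" if "j < n" for j
      using k that by (auto simp: mat_delete_def gram_def)
    have "(\<Sum>f\<in>?F. (e (f k) * (\<Prod>i\<in>{..<n} - {k}. c (f i))) * ((\<Prod>i<n. a (f i) $ i) * det (rows_at n a f)))
      = det ?B"
      by (simp only: det_row_weighted[OF fin, of n ?c] w)
    also have "\<dots> = (\<Sum>j<n. ?B $$ (k, j) * cofactor ?B k j)"
      by (rule laplace_expansion_row) (use k in auto)
    also have "\<dots> = (\<Sum>j<n. (\<Sum>\<tau>\<in>I. e \<tau> * (a \<tau> $ k * a \<tau> $ j)) * (det ?H * R $$ (j, k)))"
    proof (rule sum.cong[OF refl])
      fix j assume "j \<in> {..<n}"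
      then have j: "j < n" by simp
      have "cofactor ?B k j = cofactor ?H k j" by (simp add: cofactor_def del[OF j])
      then show "?B $$ (k, j) * cofactor ?B k j =
        (\<Sum>\<tau>\<in>I. e \<tau> * (a \<tau> $ k * a \<tau> $ j)) * (det ?H * R $$ (j, k))"
        using cof[OF k j] k j by simp
    qed
    also have "\<dots> = (\<Sum>j<n. \<Sum>\<tau>\<in>I. det ?H * (e \<tau> * (a \<tau> $ k * a \<tau> $ j * R $$ (j, k))))"
      unfolding sum_distrib_right by (intro sum.cong refl) (simp add: mult_ac)
    also have "\<dots> = (\<Sum>\<tau>\<in>I. \<Sum>j<n. det ?H * (e \<tau> * (a \<tau> $ k * a \<tau> $ j * R $$ (j, k))))"
      by (rule sum.swap)
    finally show ?thesis by (simp add: sum_distrib_left)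
  qed
  have "(\<Sum>f\<in>?F. ?W f * minor_weight n a f)
     = (\<Sum>f\<in>?F. ?W f * ((\<Prod>i<n. a (f i) $ i) * det (rows_at n a f)))"
    unfolding minor_weight_def
    by (rule symmetrized_row_expansion[where W = ?W, symmetric]) (rule sym)
  also have "\<dots> = (\<Sum>k<n. \<Sum>f\<in>?F. (e (f k) * (\<Prod>i\<in>{..<n} - {k}. c (f i))) *
      ((\<Prod>i<n. a (f i) $ i) * det (rows_at n a f)))"
    unfolding sum_distrib_right by (rule sum.swap)
  also have "\<dots> = (\<Sum>k<n. det ?H * (\<Sum>\<tau>\<in>I. e \<tau> * (\<Sum>j<n. a \<tau> $ k * a \<tau> $ j * R $$ (j, k))))"
    by (intro sum.cong refl row) simp
  also have "\<dots> = det ?H * (\<Sum>k<n. \<Sum>\<tau>\<in>I. e \<tau> * (\<Sum>j<n. a \<tau> $ k * a \<tau> $ j * R $$ (j, k)))"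
    by (simp add: sum_distrib_left)
  also have "(\<Sum>k<n. \<Sum>\<tau>\<in>I. e \<tau> * (\<Sum>j<n. a \<tau> $ k * a \<tau> $ j * R $$ (j, k)))
     = (\<Sum>\<tau>\<in>I. e \<tau> * (\<Sum>k<n. \<Sum>j<n. a \<tau> $ k * a \<tau> $ j * R $$ (j, k)))"
    unfolding sum_distrib_left by (rule sum.swap)
  finally show ?thesis .
qed

lemma gram_cong: "(\<And>\<tau>. \<tau> \<in> I \<Longrightarrow> c \<tau> = c' \<tau>) \<Longrightarrow> gram n I c a = gram n I c' a"
  unfolding gram_def by (intro cong_mat refl) (auto intro!: sum.cong)

lemma gram_scaled: "gram n I (\<lambda>\<tau>. k * c \<tau>) a = k \<cdot>\<^sub>m gram n I c a"
  unfolding gram_def by (intro eq_matI) (auto simp: sum_distrib_left mult_ac)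

section \<open>Log-determinants as functions of the weights\<close>

lemma inverse_of_det_nonzero:
  assumes B: "B \<in> carrier_mat n n" and det: "det B \<noteq> 0"
  shows "inv_mat B \<in> carrier_mat n n" "B * inv_mat B = 1\<^sub>m n" "inv_mat B * B = 1\<^sub>m n"
    "invertible_mat B"
proof -
  have "mat_inverse B \<noteq> None"
  proof
    assume "mat_inverse B = None"
    then have "B \<notin> Units (ring_mat TYPE(real) n (undefined :: unit))"
      by (rule mat_inverse(1)[OF B])
    then show False using det_non_zero_imp_unit[OF B det, of "undefined :: unit"] by blast
  qed
  then obtain C where C: "mat_inverse B = Some C" by blast
  then have *: "B * C = 1\<^sub>m n \<and> C * B = 1\<^sub>m n \<and> C \<in> carrier_mat n n"
    by (rule mat_inverse(2)[OF B])
  have "inv_mat B = C" by (simp add: inv_mat_def C)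
  with * show "inv_mat B \<in> carrier_mat n n" "B * inv_mat B = 1\<^sub>m n" "inv_mat B * B = 1\<^sub>m n" by auto
  have "square_mat B" "inverts_mat B C" "inverts_mat C B" using B * by (auto simp: inverts_mat_def)
  then show "invertible_mat B" by (auto simp: invertible_mat_def)
qed

locale vec_family =
  fixes n :: nat and I :: "'i set" and a :: "'i \<Rightarrow> real vec"
  assumes finI: "finite I" and a_carrier: "\<tau> \<in> I \<Longrightarrow> a \<tau> \<in> carrier_vec n"
begin

definition quad :: "('i \<Rightarrow> real) \<Rightarrow> real vec \<Rightarrow> real" where
  "quad c h = (\<Sum>\<tau>\<in>I. c \<tau> * (a \<tau> \<bullet> h)\<^sup>2)"

definition pos_def :: "('i \<Rightarrow> real) \<Rightarrow> bool" where
  "pos_def c \<longleftrightarrow> (\<forall>\<tau>\<in>I. 0 \<le> c \<tau>) \<and> (\<forall>h\<in>carrier_vec n. h \<noteq> 0\<^sub>v n \<longrightarrow> 0 < quad c h)"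

definition sol :: "('i \<Rightarrow> real) \<Rightarrow> real vec \<Rightarrow> real vec" where
  "sol c b = inv_mat (gram n I c a) *\<^sub>v b"

text \<open>
The leverage score of \<open>\<tau>\<close> is \<open>c \<tau> * lev c \<tau>\<close>.
\<close>
definition lev :: "('i \<Rightarrow> real) \<Rightarrow> 'i \<Rightarrow> real" where
  "lev c \<tau> = a \<tau> \<bullet> sol c (a \<tau>)"

lemma pos_defD: "pos_def c \<Longrightarrow> \<tau> \<in> I \<Longrightarrow> 0 \<le> c \<tau>"
  by (simp add: pos_def_def)

lemma pos_def_cong:
  assumes "\<And>\<tau>. \<tau> \<in> I \<Longrightarrow> c \<tau> = c' \<tau>"
  shows "pos_def c \<longleftrightarrow> pos_def c'"
proof -
  have "quad c h = quad c' h" for h unfolding quad_def by (intro sum.cong refl) (simp add: assms)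
  then show ?thesis by (simp add: pos_def_def assms)
qed

lemma quad_nonneg: "\<forall>\<tau>\<in>I. 0 \<le> c \<tau> \<Longrightarrow> 0 \<le> quad c h"
  by (auto simp: quad_def intro!: sum_nonneg)

lemma gram_mult_vec_scalar:
  assumes y: "y \<in> carrier_vec n" and h: "h \<in> carrier_vec n"
  shows "y \<bullet> (gram n I c a *\<^sub>v h) = (\<Sum>\<tau>\<in>I. c \<tau> * (a \<tau> \<bullet> y) * (a \<tau> \<bullet> h))"
proof -
  have sp: "a \<tau> \<bullet> z = (\<Sum>i<n. a \<tau> $ i * z $ i)" if "z \<in> carrier_vec n" for \<tau> z
    using that by (simp add: scalar_prod_def lessThan_atLeast0)
  have "y \<bullet> (gram n I c a *\<^sub>v h) =
     (\<Sum>i<n. y $ i * (\<Sum>j<n. (\<Sum>\<tau>\<in>I. c \<tau> * (a \<tau> $ i * a \<tau> $ j)) * h $ j))"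
    using y h by (auto simp: scalar_prod_def gram_def lessThan_atLeast0 intro!: sum.cong)
  also have "\<dots> = (\<Sum>i<n. \<Sum>j<n. \<Sum>\<tau>\<in>I. c \<tau> * (a \<tau> $ i * y $ i) * (a \<tau> $ j * h $ j))"
    by (simp add: sum_distrib_left sum_distrib_right mult_ac)
  also have "\<dots> = (\<Sum>i<n. \<Sum>\<tau>\<in>I. \<Sum>j<n. c \<tau> * (a \<tau> $ i * y $ i) * (a \<tau> $ j * h $ j))"
    by (intro sum.cong refl sum.swap)
  also have "\<dots> = (\<Sum>\<tau>\<in>I. \<Sum>i<n. \<Sum>j<n. c \<tau> * (a \<tau> $ i * y $ i) * (a \<tau> $ j * h $ j))"
    by (rule sum.swap)
  also have "\<dots> = (\<Sum>\<tau>\<in>I. c \<tau> * (a \<tau> \<bullet> y) * (a \<tau> \<bullet> h))"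
    unfolding sp[OF y] sp[OF h]
    by (simp add: sum_distrib_left sum_distrib_right mult_ac)
  finally show ?thesis .
qed

lemma det_gram_nonneg: "\<forall>\<tau>\<in>I. 0 \<le> c \<tau> \<Longrightarrow> 0 \<le> det (gram n I c a)"
  unfolding cauchy_binet_gram[OF finI]
  by (auto intro!: sum_nonneg mult_nonneg_nonneg prod_nonneg minor_weight_nonneg)

lemma det_gram_pos:
  assumes "pos_def c"
  shows "0 < det (gram n I c a)"
proof -
  have "det (gram n I c a) \<noteq> 0"
  proof
    assume "det (gram n I c a) = 0"
    then obtain h where h: "h \<in> carrier_vec n" "h \<noteq> 0\<^sub>v n" "gram n I c a *\<^sub>v h = 0\<^sub>v n"
      using det_0_iff_vec_prod_zero[of "gram n I c a" n] by auto
    have "quad c h = h \<bullet> (gram n I c a *\<^sub>v h)"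
      unfolding gram_mult_vec_scalar[OF h(1) h(1)] by (simp add: quad_def power2_eq_square mult_ac)
    also have "\<dots> = 0" using h by simp
    finally show False using assms h by (auto simp: pos_def_def)
  qed
  then show ?thesis using det_gram_nonneg[of c] assms by (auto simp: pos_def_def)
qed

lemma gram_inverse:
  assumes "pos_def c"
  shows "inv_mat (gram n I c a) \<in> carrier_mat n n" "gram n I c a * inv_mat (gram n I c a) = 1\<^sub>m n"
    "invertible_mat (gram n I c a)"
  using inverse_of_det_nonzero[of "gram n I c a" n] det_gram_pos[OF assms] by auto

lemma sol_carrier: "pos_def c \<Longrightarrow> b \<in> carrier_vec n \<Longrightarrow> sol c b \<in> carrier_vec n"
  using gram_inverse(1) unfolding sol_def by (metis mult_mat_vec_carrier)

lemma gram_sol: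
  assumes "pos_def c" "b \<in> carrier_vec n"
  shows "gram n I c a *\<^sub>v sol c b = b"
  unfolding sol_def
  by (subst assoc_mult_mat_vec[symmetric, of _ n n _ n]) (use gram_inverse[OF assms(1)] assms(2) in auto)

text \<open>
Every inner product becomes a weighted sum over the family.  Two inverses of Gram
matrices are compared below by applying it to the same scalar with two different weights.
\<close>
lemma scalar_sol:
  assumes "pos_def c" "b \<in> carrier_vec n" "h \<in> carrier_vec n"
  shows "b \<bullet> h = (\<Sum>\<tau>\<in>I. c \<tau> * (a \<tau> \<bullet> sol c b) * (a \<tau> \<bullet> h))"
proof -
  have "b \<bullet> h = h \<bullet> b" using assms by (intro comm_scalar_prod) auto
  also have "\<dots> = h \<bullet> (gram n I c a *\<^sub>v sol c b)" using gram_sol[OF assms(1,2)] by simp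
  finally show ?thesis
    unfolding gram_mult_vec_scalar[OF assms(3) sol_carrier[OF assms(1,2)]] by (simp add: mult_ac)
qed

lemma quad_sol:
  assumes "pos_def c" "b \<in> carrier_vec n"
  shows "quad c (sol c b) = b \<bullet> sol c b"
  unfolding scalar_sol[OF assms sol_carrier[OF assms]] quad_def by (simp add: power2_eq_square mult_ac)

text \<open>
The number \<open>b \<bullet> sol c b\<close> is the square of the dual norm of \<open>b\<close>.
\<close>
lemma dual_norm_bound:
  assumes c: "pos_def c" and b: "b \<in> carrier_vec n" and h: "h \<in> carrier_vec n"
  shows "\<bar>b \<bullet> h\<bar> \<le> sqrt (b \<bullet> sol c b) * sqrt (quad c h)"
proof -
  let ?x = "\<lambda>\<tau>. sqrt (c \<tau>) * (a \<tau> \<bullet> sol c b)" and ?y = "\<lambda>\<tau>. sqrt (c \<tau>) * (a \<tau> \<bullet> h)"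
  have "\<bar>b \<bullet> h\<bar> = \<bar>\<Sum>\<tau>\<in>I. ?x \<tau> * ?y \<tau>\<bar>"
    unfolding scalar_sol[OF c b h]
    by (intro arg_cong[where f = abs] sum.cong refl)
      (use pos_defD[OF c] in \<open>simp add: abs_of_nonneg mult.left_commute\<close>)
  also have "\<dots> \<le> (\<Sum>\<tau>\<in>I. \<bar>?x \<tau>\<bar> * \<bar>?y \<tau>\<bar>)"
    unfolding abs_mult[symmetric] by (rule sum_abs)
  also have "\<dots> \<le> L2_set ?x I * L2_set ?y I" by (rule L2_set_mult_ineq)
  also have "L2_set ?x I = sqrt (quad c (sol c b))"
    unfolding L2_set_def quad_def using pos_defD[OF c] by (simp add: power_mult_distrib)
  also have "L2_set ?y I = sqrt (quad c h)"
    unfolding L2_set_def quad_def using pos_defD[OF c] by (simp add: power_mult_distrib)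
  finally show ?thesis by (simp add: quad_sol[OF c b])
qed

text \<open>
Both sides are the inner product of \<open>b\<close> and \<open>b'\<close> in the dual norm.
\<close>
lemma sol_symmetric:
  assumes "pos_def c" "b \<in> carrier_vec n" "b' \<in> carrier_vec n"
  shows "b \<bullet> sol c b' = b' \<bullet> sol c b"
  unfolding scalar_sol[OF assms(1,2) sol_carrier[OF assms(1,3)]]
    scalar_sol[OF assms(1,3) sol_carrier[OF assms(1,2)]] by (simp add: mult_ac)

lemma scalar_sol_nonneg: "pos_def c \<Longrightarrow> b \<in> carrier_vec n \<Longrightarrow> 0 \<le> b \<bullet> sol c b"
  using quad_nonneg[of c "sol c b"] quad_sol by (simp add: pos_def_def)

lemma lev_nonneg: "pos_def c \<Longrightarrow> \<tau> \<in> I \<Longrightarrow> 0 \<le> lev c \<tau>"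
  unfolding lev_def by (rule scalar_sol_nonneg) (auto intro: a_carrier)

lemma det_gram_variation:
  assumes "pos_def c"
  shows "(\<Sum>f\<in>PiE {..<n} (\<lambda>_. I). (\<Sum>k<n. e (f k) * (\<Prod>i\<in>{..<n} - {k}. c (f i))) * minor_weight n a f)
    = det (gram n I c a) * (\<Sum>\<tau>\<in>I. e \<tau> * lev c \<tau>)"
proof -
  let ?R = "inv_mat (gram n I c a)"
  have "(\<Sum>i<n. \<Sum>j<n. a \<tau> $ i * a \<tau> $ j * ?R $$ (j, i)) = lev c \<tau>" if "\<tau> \<in> I" for \<tau>
  proof -
    have "lev c \<tau> = (\<Sum>j<n. \<Sum>i<n. a \<tau> $ i * a \<tau> $ j * ?R $$ (j, i))"
      using a_carrier[OF that] gram_inverse(1)[OF assms]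
      by (auto simp: lev_def sol_def scalar_prod_def lessThan_atLeast0 sum_distrib_left mult_ac intro!: sum.cong)
    then show ?thesis by (subst sum.swap) simp
  qed
  then show ?thesis
    unfolding gram_marginals[OF finI gram_inverse(1,2)[OF assms], of e] by simp
qed

text \<open>
By Cauchy-Binet the quotient of the two determinants is an average of the products
\<open>\<Prod>i<n. \<rho> (f i)\<close>, so Jensen's inequality for \<open>ln\<close> bounds it below by the average of
\<open>\<Sum>i<n. ln (\<rho> (f i))\<close>, which the leverage scores compute.
\<close>
lemma ln_det_gram_ge:
  assumes c: "pos_def c" and pd': "pos_def (\<lambda>\<tau>. c \<tau> * \<rho> \<tau>)" and \<rho>: "\<And>\<tau>. \<tau> \<in> I \<Longrightarrow> 0 < \<rho> \<tau>"
  shows "(\<Sum>\<tau>\<in>I. c \<tau> * lev c \<tau> * ln (\<rho> \<tau>)) \<le>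
    ln (det (gram n I (\<lambda>\<tau>. c \<tau> * \<rho> \<tau>) a)) - ln (det (gram n I c a))"
proof -
  let ?F = "PiE {..<n} (\<lambda>_. I)" and ?D = "det (gram n I c a)" and ?D' = "det (gram n I (\<lambda>\<tau>. c \<tau> * \<rho> \<tau>) a)"
  define w where "w f = (\<Prod>i<n. c (f i)) * minor_weight n a f" for f
  define z where "z f = (\<Sum>k<n. ln (\<rho> (f k)))" for f
  define m where "m = (\<Sum>\<tau>\<in>I. c \<tau> * lev c \<tau> * ln (\<rho> \<tau>))"
  have D: "0 < ?D" "0 < ?D'" using det_gram_pos c pd' by auto
  have w: "0 \<le> w f" if "f \<in> ?F" for f
    unfolding w_def using that pos_defD[OF c]
    by (intro mult_nonneg_nonneg prod_nonneg minor_weight_nonneg) auto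
  have total: "?D = (\<Sum>f\<in>?F. w f)"
    unfolding w_def by (rule cauchy_binet_gram[OF finI])
  have mean: "(\<Sum>f\<in>?F. w f * z f) = ?D * m"
  proof -
    have "(\<Sum>k<n. c (f k) * ln (\<rho> (f k)) * (\<Prod>i\<in>{..<n} - {k}. c (f i))) = (\<Prod>i<n. c (f i)) * z f" for f
      unfolding z_def sum_distrib_left
      by (intro sum.cong refl, subst prod.remove[of "{..<n}"]) auto
    then show ?thesis
      using det_gram_variation[OF c, of "\<lambda>\<tau>. c \<tau> * ln (\<rho> \<tau>)"] unfolding m_def w_def by (simp add: mult_ac)
  qed
  \<comment> \<open>Jensen's inequality for \<open>exp\<close>, by its tangent at the mean \<open>m\<close>\<close>
  have "?D * exp m = (\<Sum>f\<in>?F. w f * (exp m * (1 + z f - m)))"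
  proof -
    have "(\<Sum>f\<in>?F. w f * (exp m * (1 + z f - m))) =
        exp m * ((1 - m) * (\<Sum>f\<in>?F. w f) + (\<Sum>f\<in>?F. w f * z f))"
      by (simp add: sum_distrib_left sum.distrib[symmetric] algebra_simps)
    also have "\<dots> = ?D * exp m" unfolding mean total[symmetric] by (simp add: algebra_simps)
    finally show ?thesis ..
  qed
  also have "\<dots> \<le> (\<Sum>f\<in>?F. w f * exp (z f))"
  proof (intro sum_mono mult_left_mono w)
    fix f
    have "1 + (z f - m) \<le> exp (z f - m)" by (rule exp_ge_add_one_self)
    then have "exp m * (1 + (z f - m)) \<le> exp m * exp (z f - m)" by simp
    then show "exp m * (1 + z f - m) \<le> exp (z f)" by (simp add: exp_add[symmetric] add_diff_eq)
  qed
  also have "\<dots> = ?D'"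
  proof -
    have "w f * exp (z f) = (\<Prod>i<n. c (f i) * \<rho> (f i)) * minor_weight n a f" if f: "f \<in> ?F" for f
    proof -
      have "\<rho> (f i) > 0" if "i < n" for i using \<rho> PiE_mem[OF f] that by simp
      then have "exp (z f) = (\<Prod>i<n. \<rho> (f i))" by (simp add: z_def exp_sum)
      then show ?thesis by (simp add: w_def prod.distrib)
    qed
    then show ?thesis
      unfolding cauchy_binet_gram[OF finI] by (intro sum.cong refl)
  qed
  finally have "ln (?D * exp m) \<le> ln ?D'" using D by (subst ln_le_cancel_iff) auto
  then show ?thesis using D by (simp add: ln_mult m_def[symmetric])
qed

text \<open>
The right side minus the left side is \<open>s\<close> times the sum of
\<open>e\<^sub>\<tau> e\<^sub>\<sigma> (a\<^sub>\<tau> \<bullet> sol c a\<^sub>\<sigma>) (a\<^sub>\<tau> \<bullet> sol d a\<^sub>\<sigma>)\<close>, with \<open>d\<close> the perturbed weights.  It is nonnegative, since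
the entrywise product of two positive semidefinite matrices is positive semidefinite; expanding both
factors exhibits the sum as a combination of squares.
\<close>
lemma lev_segment:
  assumes c: "pos_def c" and d: "pos_def (\<lambda>\<tau>. c \<tau> + s * e \<tau>)" and s: "0 \<le> s"
  shows "(\<Sum>\<tau>\<in>I. e \<tau> * lev (\<lambda>\<tau>. c \<tau> + s * e \<tau>) \<tau>) \<le> (\<Sum>\<tau>\<in>I. e \<tau> * lev c \<tau>)"
proof -
  let ?d = "\<lambda>\<tau>. c \<tau> + s * e \<tau>"
  define k where "k \<rho> \<tau> = a \<rho> \<bullet> sol c (a \<tau>)" for \<rho> \<tau>
  define l where "l \<rho> \<tau> = a \<rho> \<bullet> sol ?d (a \<tau>)" for \<rho> \<tau>
  have k: "k \<tau> \<sigma> = (\<Sum>\<rho>\<in>I. c \<rho> * k \<rho> \<tau> * k \<rho> \<sigma>)" if "\<tau> \<in> I" "\<sigma> \<in> I" for \<tau> \<sigma>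
    unfolding k_def using that by (intro scalar_sol c sol_carrier a_carrier)
  have l: "l \<tau> \<sigma> = (\<Sum>\<rho>\<in>I. ?d \<rho> * l \<rho> \<tau> * l \<rho> \<sigma>)" if "\<tau> \<in> I" "\<sigma> \<in> I" for \<tau> \<sigma>
    unfolding l_def using that by (intro scalar_sol d sol_carrier a_carrier)
  have kl: "k \<tau> \<sigma> = (\<Sum>\<rho>\<in>I. ?d \<rho> * l \<rho> \<tau> * k \<rho> \<sigma>)" if "\<tau> \<in> I" "\<sigma> \<in> I" for \<tau> \<sigma>
    unfolding k_def l_def using that by (intro scalar_sol c d sol_carrier a_carrier)
  have lk: "l \<tau> \<sigma> = (\<Sum>\<rho>\<in>I. c \<rho> * k \<rho> \<tau> * l \<rho> \<sigma>)" if "\<tau> \<in> I" "\<sigma> \<in> I" for \<tau> \<sigma>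
    unfolding k_def l_def using that by (intro scalar_sol c d sol_carrier a_carrier)
  have diff: "lev c \<tau> - lev ?d \<tau> = s * (\<Sum>\<sigma>\<in>I. e \<sigma> * k \<sigma> \<tau> * l \<sigma> \<tau>)" if t: "\<tau> \<in> I" for \<tau>
  proof -
    have "lev c \<tau> - lev ?d \<tau> = k \<tau> \<tau> - l \<tau> \<tau>" by (simp add: lev_def k_def l_def)
    also have "\<dots> = (\<Sum>\<rho>\<in>I. ?d \<rho> * l \<rho> \<tau> * k \<rho> \<tau>) - (\<Sum>\<rho>\<in>I. c \<rho> * k \<rho> \<tau> * l \<rho> \<tau>)"
      using kl[OF t t] lk[OF t t] by simp
    also have "\<dots> = s * (\<Sum>\<sigma>\<in>I. e \<sigma> * k \<sigma> \<tau> * l \<sigma> \<tau>)"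
      by (simp add: sum_subtractf[symmetric] sum_distrib_left algebra_simps)
    finally show ?thesis .
  qed
  have "(\<Sum>\<tau>\<in>I. e \<tau> * lev c \<tau>) - (\<Sum>\<tau>\<in>I. e \<tau> * lev ?d \<tau>) = (\<Sum>\<tau>\<in>I. e \<tau> * (lev c \<tau> - lev ?d \<tau>))"
    by (simp add: sum_subtractf algebra_simps)
  also have "\<dots> = s * (\<Sum>\<tau>\<in>I. \<Sum>\<sigma>\<in>I. e \<tau> * e \<sigma> * (k \<tau> \<sigma> * l \<tau> \<sigma>))"
  proof -
    have sym: "k \<sigma> \<tau> = k \<tau> \<sigma>" "l \<sigma> \<tau> = l \<tau> \<sigma>" if "\<tau> \<in> I" "\<sigma> \<in> I" for \<tau> \<sigma>
      using k[OF that] k[OF that(2,1)] l[OF that] l[OF that(2,1)] by (simp_all add: mult_ac)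
    show ?thesis
      unfolding sum_distrib_left
      by (intro sum.cong refl) (simp add: diff sum_distrib_left sym mult_ac)
  qed
  also have "(\<Sum>\<tau>\<in>I. \<Sum>\<sigma>\<in>I. e \<tau> * e \<sigma> * (k \<tau> \<sigma> * l \<tau> \<sigma>)) =
      (\<Sum>\<rho>\<in>I. \<Sum>\<kappa>\<in>I. c \<rho> * ?d \<kappa> * (\<Sum>\<tau>\<in>I. e \<tau> * k \<rho> \<tau> * l \<kappa> \<tau>)\<^sup>2)" (is "?L = ?R")
  proof -
    have "?L = (\<Sum>\<tau>\<in>I. \<Sum>\<sigma>\<in>I. \<Sum>\<rho>\<in>I. \<Sum>\<kappa>\<in>I. 
        c \<rho> * ?d \<kappa> * ((e \<tau> * k \<rho> \<tau> * l \<kappa> \<tau>) * (e \<sigma> * k \<rho> \<sigma> * l \<kappa> \<sigma>)))"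
    proof (intro sum.cong refl)
      fix \<tau> \<sigma> assume t: "\<tau> \<in> I" "\<sigma> \<in> I"
      have kl_eq: "k \<tau> \<sigma> * l \<tau> \<sigma> = (\<Sum>\<rho>\<in>I. \<Sum>\<kappa>\<in>I. (c \<rho> * k \<rho> \<tau> * k \<rho> \<sigma>) * (?d \<kappa> * l \<kappa> \<tau> * l \<kappa> \<sigma>))"
        unfolding k[OF t] l[OF t] by (rule sum_product)
      show "e \<tau> * e \<sigma> * (k \<tau> \<sigma> * l \<tau> \<sigma>) = (\<Sum>\<rho>\<in>I. \<Sum>\<kappa>\<in>I. 
        c \<rho> * ?d \<kappa> * ((e \<tau> * k \<rho> \<tau> * l \<kappa> \<tau>) * (e \<sigma> * k \<rho> \<sigma> * l \<kappa> \<sigma>)))"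
        unfolding kl_eq sum_distrib_left by (intro sum.cong refl) (simp only: mult_ac)
    qed
    also have "\<dots> = (\<Sum>\<tau>\<in>I. \<Sum>\<rho>\<in>I. \<Sum>\<sigma>\<in>I. \<Sum>\<kappa>\<in>I. 
        c \<rho> * ?d \<kappa> * ((e \<tau> * k \<rho> \<tau> * l \<kappa> \<tau>) * (e \<sigma> * k \<rho> \<sigma> * l \<kappa> \<sigma>)))"
      by (intro sum.cong refl sum.swap)
    also have "\<dots> = (\<Sum>\<rho>\<in>I. \<Sum>\<tau>\<in>I. \<Sum>\<sigma>\<in>I. \<Sum>\<kappa>\<in>I. 
        c \<rho> * ?d \<kappa> * ((e \<tau> * k \<rho> \<tau> * l \<kappa> \<tau>) * (e \<sigma> * k \<rho> \<sigma> * l \<kappa> \<sigma>)))"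
      by (rule sum.swap)
    also have "\<dots> = (\<Sum>\<rho>\<in>I. \<Sum>\<tau>\<in>I. \<Sum>\<kappa>\<in>I. \<Sum>\<sigma>\<in>I. 
        c \<rho> * ?d \<kappa> * ((e \<tau> * k \<rho> \<tau> * l \<kappa> \<tau>) * (e \<sigma> * k \<rho> \<sigma> * l \<kappa> \<sigma>)))"
      by (intro sum.cong refl sum.swap)
    also have "\<dots> = (\<Sum>\<rho>\<in>I. \<Sum>\<kappa>\<in>I. \<Sum>\<tau>\<in>I. \<Sum>\<sigma>\<in>I. 
        c \<rho> * ?d \<kappa> * ((e \<tau> * k \<rho> \<tau> * l \<kappa> \<tau>) * (e \<sigma> * k \<rho> \<sigma> * l \<kappa> \<sigma>)))"
      by (intro sum.cong refl sum.swap)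
    also have "\<dots> = ?R"
      unfolding power2_eq_square sum_product by (simp only: sum_distrib_left)
    finally show ?thesis .
  qed
  also have "0 \<le> s * \<dots>"
    using s pos_defD[OF c] pos_defD[OF d] by (intro mult_nonneg_nonneg sum_nonneg) auto
  finally show ?thesis by simp
qed

text \<open>
The logarithm of the determinant is concave in the weights: along the segment its derivative is the sum
in \<open>lev_segment\<close>, which is largest at the starting point.
\<close>
lemma ln_det_gram_le:
  assumes c: "pos_def c" and d: "pos_def d"
  shows "ln (det (gram n I d a)) - ln (det (gram n I c a)) \<le> (\<Sum>\<tau>\<in>I. (d \<tau> - c \<tau>) * lev c \<tau>)"
proof -
  let ?F = "PiE {..<n} (\<lambda>_. I)"
  define e where "e \<tau> = d \<tau> - c \<tau>" for \<tau>
  define cs where "cs s \<tau> = c \<tau> + s * e \<tau>" for s \<tau>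
  define \<psi> where "\<psi> s = det (gram n I (cs s) a)" for s
  have pd: "pos_def (cs s)" if "0 \<le> s" "s \<le> 1" for s
  proof -
    have eq: "cs s \<tau> = (1 - s) * c \<tau> + s * d \<tau>" for \<tau>
      by (simp add: cs_def e_def algebra_simps)
    have "quad (cs s) h = (1 - s) * quad c h + s * quad d h" for h
      unfolding quad_def eq by (simp add: sum_distrib_left sum.distrib[symmetric] algebra_simps)
    moreover have "0 < (1 - s) * x + s * y" if "0 < x" "0 < y" for x y :: real
      using that \<open>0 \<le> s\<close> \<open>s \<le> 1\<close> by (cases "s = 0") (auto intro: add_nonneg_pos)
    moreover have "0 \<le> cs s \<tau>" if "\<tau> \<in> I" for \<tau>
      unfolding eq using \<open>0 \<le> s\<close> \<open>s \<le> 1\<close> pos_defD[OF c that] pos_defD[OF d that] by simp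
    ultimately show ?thesis using c d by (simp add: pos_def_def)
  qed
  have der: "(\<psi> has_real_derivative \<psi> s * (\<Sum>\<tau>\<in>I. e \<tau> * lev (cs s) \<tau>)) (at s)" if "0 \<le> s" "s \<le> 1" for s
  proof -
    have "(\<psi> has_real_derivative (\<Sum>f\<in>?F. (\<Sum>k<n. e (f k) * (\<Prod>i\<in>{..<n} - {k}. cs s (f i))) * minor_weight n a f)) (at s)"
      unfolding \<psi>_def cauchy_binet_gram[OF finI]
    proof (rule DERIV_sum, rule DERIV_cmult_right)
      fix f :: "nat \<Rightarrow> 'i"
      have "((\<lambda>s. cs s (f k)) has_real_derivative e (f k)) (at s)" for k
        unfolding cs_def by (auto intro!: derivative_eq_intros)
      then show "((\<lambda>s. \<Prod>i<n. cs s (f i)) has_real_derivative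
          (\<Sum>k<n. e (f k) * (\<Prod>i\<in>{..<n} - {k}. cs s (f i)))) (at s)"
        by (intro has_field_derivative_prod)
    qed
    then show ?thesis
      by (simp only: \<psi>_def det_gram_variation[OF pd[OF that], of e])
  qed
  have pos: "0 < \<psi> s" if "0 \<le> s" "s \<le> 1" for s
    unfolding \<psi>_def by (rule det_gram_pos[OF pd[OF that]])
  have der_ln: "((\<lambda>s. ln (\<psi> s)) has_real_derivative (\<Sum>\<tau>\<in>I. e \<tau> * lev (cs s) \<tau>)) (at s)"
    if "0 \<le> s" "s \<le> 1" for s
  proof -
    have "inverse (\<psi> s) * (\<psi> s * x) = x" for x using pos[OF that] by simp
    then show ?thesis
      using DERIV_chain2[OF DERIV_ln[OF pos[OF that]] der[OF that]] by (simp only:)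
  qed
  have "\<exists>s>0. s < 1 \<and> ln (\<psi> 1) - ln (\<psi> 0) = (1 - 0) * (\<Sum>\<tau>\<in>I. e \<tau> * lev (cs s) \<tau>)"
    by (rule MVT2[where f = "\<lambda>s. ln (\<psi> s)" and f' = "\<lambda>s. \<Sum>\<tau>\<in>I. e \<tau> * lev (cs s) \<tau>"])
      (simp_all add: der_ln)
  then obtain s where s: "0 < s" "s < 1"
    "ln (\<psi> 1) - ln (\<psi> 0) = (\<Sum>\<tau>\<in>I. e \<tau> * lev (cs s) \<tau>)"
    by auto
  have "(\<Sum>\<tau>\<in>I. e \<tau> * lev (cs s) \<tau>) \<le> (\<Sum>\<tau>\<in>I. e \<tau> * lev c \<tau>)"
    using lev_segment[OF c, of s e] pd[of s] s by (simp add: cs_def[abs_def])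
  moreover have "\<psi> 1 = det (gram n I d a)" "\<psi> 0 = det (gram n I c a)"
    by (simp_all add: \<psi>_def cs_def[abs_def] e_def)
  ultimately show ?thesis using s by (simp add: e_def)
qed

text \<open>
The right side of \<open>ln_det_gram_le\<close> compares two traces, \<open>\<Sum>\<tau>\<in>I. e \<tau> * lev c \<tau>\<close> and the same with \<open>c\<close>
for \<open>e\<close>.  Each is a sum of values of the corresponding quadratic form at the vectors \<open>sol c (a \<sigma>)\<close>,
with the nonnegative coefficients \<open>c \<sigma>\<close>.
\<close>
lemma ln_det_gram_mono:
  assumes c: "pos_def c" and e: "pos_def e" and le: "\<And>h. h \<in> carrier_vec n \<Longrightarrow> quad e h \<le> quad c h"
  shows "ln (det (gram n I e a)) \<le> ln (det (gram n I c a))"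
proof -
  let ?y = "\<lambda>\<tau>. sol c (a \<tau>)"
  have y: "?y \<tau> \<in> carrier_vec n" if "\<tau> \<in> I" for \<tau> by (intro sol_carrier c a_carrier that)
  have trace: "(\<Sum>\<tau>\<in>I. f \<tau> * lev c \<tau>) = (\<Sum>\<sigma>\<in>I. c \<sigma> * quad f (?y \<sigma>))" for f
  proof -
    have "(\<Sum>\<tau>\<in>I. f \<tau> * lev c \<tau>) = (\<Sum>\<tau>\<in>I. \<Sum>\<sigma>\<in>I. c \<sigma> * (f \<tau> * (a \<tau> \<bullet> ?y \<sigma>)\<^sup>2))"
    proof (intro sum.cong refl)
      fix \<tau> assume t: "\<tau> \<in> I"
      have "lev c \<tau> = (\<Sum>\<sigma>\<in>I. c \<sigma> * (a \<sigma> \<bullet> ?y \<tau>)\<^sup>2)"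
        using quad_sol[OF c a_carrier[OF t]] by (simp add: lev_def quad_def)
      also have "\<dots> = (\<Sum>\<sigma>\<in>I. c \<sigma> * (a \<tau> \<bullet> ?y \<sigma>)\<^sup>2)"
        by (intro sum.cong refl) (simp add: sol_symmetric[OF c a_carrier a_carrier] t)
      finally show "f \<tau> * lev c \<tau> = (\<Sum>\<sigma>\<in>I. c \<sigma> * (f \<tau> * (a \<tau> \<bullet> ?y \<sigma>)\<^sup>2))"
        by (simp add: sum_distrib_left mult_ac)
    qed
    also have "\<dots> = (\<Sum>\<sigma>\<in>I. \<Sum>\<tau>\<in>I. c \<sigma> * (f \<tau> * (a \<tau> \<bullet> ?y \<sigma>)\<^sup>2))" by (rule sum.swap)
    finally show ?thesis by (simp add: quad_def sum_distrib_left)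
  qed
  have "(\<Sum>\<tau>\<in>I. (e \<tau> - c \<tau>) * lev c \<tau>) = (\<Sum>\<sigma>\<in>I. c \<sigma> * quad e (?y \<sigma>)) - (\<Sum>\<sigma>\<in>I. c \<sigma> * quad c (?y \<sigma>))"
    unfolding left_diff_distrib sum_subtractf trace ..
  also have "\<dots> \<le> 0"
    using sum_mono[of I "\<lambda>\<sigma>. c \<sigma> * quad e (?y \<sigma>)" "\<lambda>\<sigma>. c \<sigma> * quad c (?y \<sigma>)"] pos_defD[OF c] le[OF y]
    by (simp add: mult_left_mono)
  finally show ?thesis using ln_det_gram_le[OF c e] by linarith
qed

end

section \<open>Scalar inequalities\<close>

lemma ln_concave_combination:
  fixes a b t :: real
  assumes "0 < a" "0 < b" "0 \<le> t" "t \<le> 1"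
  shows "(1 - t) * ln a + t * ln b \<le> ln ((1 - t) * a + t * b)"
proof -
  define m where "m = (1 - t) * a + t * b"
  have m: "0 < m"
    unfolding m_def using assms by (cases "t = 0") (auto intro: add_nonneg_pos)
  have *: "ln z \<le> ln m + z / m - 1" if "0 < z" for z
    using ln_le_minus_one[of "z / m"] that m by (simp add: ln_div)
  have "(1 - t) * ln a + t * ln b \<le> (1 - t) * (ln m + a / m - 1) + t * (ln m + b / m - 1)"
    using assms * by (intro add_mono mult_left_mono) auto
  also have "\<dots> = ln m + ((1 - t) * a + t * b) / m - 1"
    using m by (simp add: field_simps)
  also have "\<dots> = ln m" using m unfolding m_def[symmetric] by simp
  finally show ?thesis by (simp add: m_def)
qed

lemma neg_ln_scale:
  fixes t y :: real
  assumes "y < 1" "0 \<le> t" "t \<le> 1"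
  shows "- ln (1 - t * y) \<le> t * (- ln (1 - y))"
  using ln_concave_combination[of 1 "1 - y" t] assms by (simp add: algebra_simps)

lemma neg_ln_ge: "(y::real) < 1 \<Longrightarrow> y \<le> - ln (1 - y)"
  using ln_le_minus_one[of "1 - y"] by simp

text \<open>
A derivative with the sign of its argument forces a minimum at \<open>0\<close>.
\<close>
lemma min_at_zero:
  fixes f \<psi> :: "real \<Rightarrow> real"
  assumes der: "\<And>y. \<bar>y\<bar> \<le> r \<Longrightarrow> (f has_real_derivative y * \<psi> y) (at y)"
    and nonneg: "\<And>y. \<bar>y\<bar> \<le> r \<Longrightarrow> 0 \<le> \<psi> y" and y: "\<bar>y\<bar> \<le> r"
  shows "f 0 \<le> f y"
proof (cases "0 \<le> y")
  case True
  show ?thesis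
  proof (rule DERIV_nonneg_imp_nondecreasing[OF True])
    fix z assume "0 \<le> z" "z \<le> y"
    then show "\<exists>D. (f has_real_derivative D) (at z) \<and> 0 \<le> D"
      using der[of z] nonneg[of z] y True by (intro exI[of _ "z * \<psi> z"]) auto
  qed
next
  case False
  show ?thesis
  proof (rule DERIV_nonpos_imp_nonincreasing[of y 0])
    fix z assume "y \<le> z" "z \<le> 0"
    then show "\<exists>D. (f has_real_derivative D) (at z) \<and> D \<le> 0"
      using der[of z] nonneg[of z] y False by (intro exI[of _ "z * \<psi> z"]) (auto intro: mult_nonpos_nonneg)
  qed (use False in simp)
qed

text \<open>
The exact coefficient is \<open>1/2\<close>; on \<open>[-1/50, 1/50]\<close> it is off by less than the factors \<open>1 \<plusminus> 1/30\<close>.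
\<close>
lemma neg_ln_quadratic:
  fixes y :: real
  assumes "\<bar>y\<bar> \<le> 1 / 50"
  shows "y + 29 / 60 * y\<^sup>2 \<le> - ln (1 - y)" "- ln (1 - y) \<le> y + 31 / 60 * y\<^sup>2"
proof -
  have "- ln (1 - 0) - 0 - 29 / 60 * 0\<^sup>2 \<le> - ln (1 - y) - y - 29 / 60 * y\<^sup>2"
  proof (rule min_at_zero[where r = "1 / 50" and \<psi> = "\<lambda>y. 1 / (1 - y) - 29 / 30"])
    fix z :: real assume z: "\<bar>z\<bar> \<le> 1 / 50"
    then have "z < 1" by linarith
    then show "((\<lambda>y. - ln (1 - y) - y - 29 / 60 * y\<^sup>2) has_real_derivative z * (1 / (1 - z) - 29 / 30)) (at z)"
      by (auto intro!: derivative_eq_intros simp: field_simps)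
    show "0 \<le> 1 / (1 - z) - 29 / 30" using z by (simp add: field_simps)
  qed (use assms in auto)
  then show "y + 29 / 60 * y\<^sup>2 \<le> - ln (1 - y)" by simp
  have "0 + 31 / 60 * 0\<^sup>2 + ln (1 - 0) \<le> y + 31 / 60 * y\<^sup>2 + ln (1 - y)"
  proof (rule min_at_zero[where r = "1 / 50" and \<psi> = "\<lambda>y. 31 / 30 - 1 / (1 - y)"])
    fix z :: real assume z: "\<bar>z\<bar> \<le> 1 / 50"
    then have "z < 1" by linarith
    then show "((\<lambda>y. y + 31 / 60 * y\<^sup>2 + ln (1 - y)) has_real_derivative z * (31 / 30 - 1 / (1 - z))) (at z)"
      by (auto intro!: derivative_eq_intros simp: field_simps)
    show "0 \<le> 31 / 30 - 1 / (1 - z)" using z by (simp add: field_simps)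
  qed (use assms in auto)
  then show "- ln (1 - y) \<le> y + 31 / 60 * y\<^sup>2" by simp
qed

text \<open>
The expression on the left bounds the growth of the volumetric barrier.  The exact coefficient
\<open>3/2\<close> is relaxed by the factor \<open>1 + 1/30\<close> as in \<open>neg_ln_quadratic\<close>; that it is three times the
coefficient \<open>1/2\<close> of \<open>- ln (1 - y)\<close> is the reason for the \<open>3\<close> in the matrix \<open>M\<close>.
\<close>
lemma inverse_square_quadratic:
  fixes y :: real
  assumes "\<bar>y\<bar> \<le> 1 / 50"
  shows "(1 / (1 - y)\<^sup>2 - 1) / 2 \<le> y + 31 / 20 * y\<^sup>2"
proof -
  have pos: "0 < (1 - y)\<^sup>2" using assms by (auto simp: abs_if split: if_splits)
  have "0 \<le> y\<^sup>2 * (1 / 10 - 42 / 10 * y + 31 / 10 * y\<^sup>2)"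
    using assms by (intro mult_nonneg_nonneg add_nonneg_nonneg) auto
  also have "\<dots> = (1 + 2 * (y + 31 / 20 * y\<^sup>2)) * (1 - y)\<^sup>2 - 1"
    by (simp add: power2_eq_square field_simps)
  finally have "1 / (1 - y)\<^sup>2 \<le> 1 + 2 * (y + 31 / 20 * y\<^sup>2)"
    using pos by (simp add: pos_divide_le_eq)
  then show ?thesis by simp
qed

text \<open>
Since \<open>ln (3/4) \<le> - 1/4\<close>, a factor \<open>9\<close> in the number of steps buys more than a square.
\<close>
lemma three_quarters_power_le:
  assumes "1 \<le> X" "9 * ln X \<le> real S"
  shows "(3 / 4 :: real) ^ S \<le> 1 / X\<^sup>2"
proof -
  have "ln (3 / 4 :: real) \<le> - 2 / 9" using ln_le_minus_one[of "3 / 4 :: real"] by simp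
  then have "real S * ln (3 / 4) \<le> real S * (- 2 / 9)" by (intro mult_left_mono) auto
  also have "\<dots> \<le> - (2 * ln X)" using assms by simp
  finally have "exp (real S * ln (3 / 4)) \<le> exp (- (2 * ln X))" by simp
  moreover have "exp (real S * ln (3 / 4)) = (3 / 4) ^ S" by (simp add: exp_of_nat_mult)
  moreover have "exp (- (2 * ln X)) = 1 / X\<^sup>2"
    using assms by (simp add: exp_minus exp_double inverse_eq_divide)
  ultimately show ?thesis by simp
qed

text \<open>
The mixing weight \<open>e\<close> balances the loss \<open>t * - ln (1 - e)\<close> of moving away from the comparator against
the barrier \<open>L * N * - ln e\<close>.  The first is at most \<open>L * N\<close>, which is compensated by the \<open>- 1\<close> in the
bound for \<open>- ln e\<close>; that \<open>- 1\<close> is available because \<open>L * N\<close> exceeds \<open>exp 1\<close>.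
\<close>
lemma comparator_constants:
  fixes L N t Y e :: real
  assumes L: "550 \<le> L" and N: "1 \<le> N" and t: "1 \<le> t" and Y: "Y = t + L * (N + 1)"
    and e: "e = L * N / (t + L * N)"
  shows "0 < e" "e < 1" "t * - ln (1 - e) \<le> L * N" "- ln e \<le> ln Y - 1"
    "ln ((t + L) / (L * e\<^sup>2)) \<le> 3 * ln Y" "0 \<le> ln Y"
proof -
  have LN: "550 \<le> L * N" using mult_mono[of 550 L 1 N] L N by simp
  have LN1: "L * (N + 1) = L * N + L" by (simp add: algebra_simps)
  have Y1: "1 \<le> Y" using L LN t by (simp add: Y LN1)
  show e0: "0 < e" and e1: "e < 1" using LN t by (auto simp: e)
  have "1 - e = t / (t + L * N)" using LN t by (simp add: e field_simps)
  then have "- ln (1 - e) = ln ((t + L * N) / t)" using LN t by (simp add: ln_div)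
  also have "(t + L * N) / t = 1 + L * N / t" using t by (simp add: field_simps)
  also have "ln (1 + L * N / t) \<le> L * N / t" using LN t by (intro ln_add_one_self_le_self) auto
  finally show "t * - ln (1 - e) \<le> L * N" using t by (simp add: field_simps)
  have "exp 1 \<le> (3 :: real)" by (rule exp_le)
  then have "(t + L * N) * exp 1 \<le> Y * (L * N)"
    using LN t L by (intro mult_mono) (auto simp: Y LN1)
  then have "1 / e \<le> Y / exp 1" using LN by (simp add: e field_simps)
  then have "ln (1 / e) \<le> ln (Y / exp 1)" using e0 by (intro ln_mono) auto
  then show 1: "- ln e \<le> ln Y - 1" using e0 Y1 by (simp add: ln_div)
  show 2: "0 \<le> ln Y" using Y1 by simp
  have "(t + L) / L \<le> t + L"
    using L t by (simp add: divide_le_eq)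
  also have "\<dots> \<le> Y" using LN by (simp add: Y LN1)
  finally have "ln ((t + L) / L) \<le> ln Y" using L t by (intro ln_mono) auto
  moreover have "ln ((t + L) / (L * e\<^sup>2)) = ln ((t + L) / L) + 2 * - ln e"
    using L t e0 by (simp add: ln_div ln_mult ln_realpow)
  ultimately show "ln ((t + L) / (L * e\<^sup>2)) \<le> 3 * ln Y" using 1 by linarith
qed

section \<open>The affine parametrisation of the simplex\<close>

\<comment> \<open>The dimension \<open>d - 1\<close> has to keep its shape for the carrier conditions to match.\<close>
declare One_nat_def [simp del]

lemma finite_idx_plus [simp]: "finite (idx_plus d m)"
  by (simp add: idx_plus_def)

lemma A_mat_carrier [simp]: "A_mat d \<in> carrier_mat d (d - 1)"
  by (simp add: A_mat_def)

lemma A_mult_index: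
  assumes h: "h \<in> carrier_vec (d - 1)" and j: "j < d - 1"
  shows "(A_mat d *\<^sub>v h) $ j = h $ j"
proof -
  have "row (A_mat d) j = unit_vec (d - 1) j"
    using j by (intro eq_vecI) (auto simp: A_mat_def)
  then show ?thesis using h j by (simp add: A_mat_def)
qed

lemma A_mult_last:
  assumes h: "h \<in> carrier_vec (d - 1)" and d: "0 < d"
  shows "(A_mat d *\<^sub>v h) $ (d - 1) = - (\<Sum>k<d - 1. h $ k)"
proof -
  have "row (A_mat d) (d - 1) = vec (d - 1) (\<lambda>_. - 1)"
    using d by (intro eq_vecI) (auto simp: A_mat_def)
  moreover have "(A_mat d *\<^sub>v h) $ (d - 1) = row (A_mat d) (d - 1) \<bullet> h"
    using d by (simp add: A_mat_def)
  ultimately show ?thesis using h by (simp add: scalar_prod_def lessThan_atLeast0 sum_negf)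
qed

lemma sum_A_mult:
  assumes h: "h \<in> carrier_vec (d - 1)" and d: "0 < d"
  shows "(\<Sum>j<d. (A_mat d *\<^sub>v h) $ j) = 0"
proof -
  have "{..<d} = insert (d - 1) {..<d - 1}" using d by auto
  then show ?thesis using A_mult_index[OF h] A_mult_last[OF h d] by simp
qed

lemma qn_point_index:
  assumes "v \<in> carrier_vec (d - 1)" "j < d"
  shows "qn_point d v $ j = (A_mat d *\<^sub>v v) $ j + (if j = d - 1 then 1 else 0)"
  using assms unfolding qn_point_def last_basis_def by (auto simp: A_mat_def unit_vec_def)

lemma sum_qn_point:
  assumes "v \<in> carrier_vec (d - 1)" "0 < d"
  shows "(\<Sum>j<d. qn_point d v $ j) = 1"
proof -
  have "(\<Sum>j<d. qn_point d v $ j) = (\<Sum>j<d. (A_mat d *\<^sub>v v) $ j + (if j = d - 1 then 1 else 0))"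
    by (intro sum.cong refl qn_point_index assms) simp
  then show ?thesis using sum_A_mult[OF assms] assms(2) by (simp add: sum.distrib)
qed

lemma qn_point_coordinates:
  assumes p: "p \<in> carrier_vec d" and sum: "(\<Sum>j<d. p $ j) = 1" and d: "0 < d"
  shows "qn_point d (vec (d - 1) (\<lambda>i. p $ i)) = p"
proof (rule eq_vecI)
  let ?v = "vec (d - 1) (\<lambda>i. p $ i)"
  have v: "?v \<in> carrier_vec (d - 1)" by simp
  have d_split: "{..<d} = insert (d - 1) {..<d - 1}" using d by auto
  show "qn_point d ?v $ j = p $ j" if "j < dim_vec p" for j
  proof (cases "j = d - 1")
    case True
    have "(\<Sum>k<d - 1. ?v $ k) = (\<Sum>k<d - 1. p $ k)" by simp
    then have "qn_point d ?v $ (d - 1) = - (\<Sum>k<d - 1. p $ k) + 1"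
      using qn_point_index[OF v, of "d - 1"] A_mult_last[OF v d] d by simp
    then show ?thesis using sum unfolding True d_split by simp
  next
    case False
    then have "j < d - 1" using that p by simp
    then show ?thesis
      using that p False by (simp add: qn_point_index[OF v] A_mult_index[OF v])
  qed
  show "dim_vec (qn_point d ?v) = dim_vec p" using p by (simp add: qn_point_def last_basis_def)
qed

text \<open>
The first \<open>d - 1\<close> rows of \<open>A\<close> form the identity, so \<open>A\<close> is injective.
\<close>
lemma A_gram_det_nonzero: "det (transpose_mat (A_mat d) * A_mat d) \<noteq> 0"
proof
  let ?A = "A_mat d"
  have At: "transpose_mat ?A \<in> carrier_mat (d - 1) d" by simp
  have AA: "transpose_mat ?A * ?A \<in> carrier_mat (d - 1) (d - 1)" by (rule mult_carrier_mat[OF At A_mat_carrier])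
  assume "det (transpose_mat ?A * ?A) = 0"
  then obtain h where h: "h \<in> carrier_vec (d - 1)" "h \<noteq> 0\<^sub>v (d - 1)" "(transpose_mat ?A * ?A) *\<^sub>v h = 0\<^sub>v (d - 1)"
    using det_0_iff_vec_prod_zero[OF AA] by auto
  have Ah: "?A *\<^sub>v h \<in> carrier_vec d" using A_mat_carrier h(1) by (rule mult_mat_vec_carrier)
  have "(?A *\<^sub>v h) \<bullet> (?A *\<^sub>v h) = (transpose_mat ?A *\<^sub>v (?A *\<^sub>v h)) \<bullet> h"
    by (rule transpose_vec_mult_scalar[OF A_mat_carrier h(1) Ah, symmetric])
  also have "transpose_mat ?A *\<^sub>v (?A *\<^sub>v h) = 0\<^sub>v (d - 1)"
    using h(3) unfolding assoc_mult_mat_vec[OF At A_mat_carrier h(1)] .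
  finally have "(?A *\<^sub>v h) \<bullet> (?A *\<^sub>v h) = 0" using h(1) by simp
  moreover have "w \<bullet> w = (\<Sum>j<d. (w $ j)\<^sup>2)" if "w \<in> carrier_vec d" for w :: "real vec"
    using that by (simp add: scalar_prod_def lessThan_atLeast0 power2_eq_square)
  ultimately have "(\<Sum>j<d. ((?A *\<^sub>v h) $ j)\<^sup>2) = 0" using Ah by simp
  then have "(?A *\<^sub>v h) $ j = 0" if "j < d" for j
    using that by (subst (asm) sum_nonneg_eq_0_iff) auto
  then have "h = 0\<^sub>v (d - 1)"
    using A_mult_index[OF h(1)] h(1) by (intro eq_vecI) auto
  with h(2) show False ..
qed

lemma A_pinv_inverts:
  assumes v: "v \<in> carrier_vec (d - 1)"
  shows "A_pinv d *\<^sub>v (qn_point d v - last_basis d) = v"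
proof -
  let ?A = "A_mat d" and ?G = "transpose_mat (A_mat d) * A_mat d"
  have At: "transpose_mat ?A \<in> carrier_mat (d - 1) d" by simp
  have AA: "?G \<in> carrier_mat (d - 1) (d - 1)" by (rule mult_carrier_mat[OF At A_mat_carrier])
  note inv = inverse_of_det_nonzero[OF AA A_gram_det_nonzero]
  have Av: "?A *\<^sub>v v \<in> carrier_vec d" using A_mat_carrier v by (rule mult_mat_vec_carrier)
  have "w + last_basis d - last_basis d = w" if "w \<in> carrier_vec d" for w
    using that by (intro eq_vecI) (auto simp: last_basis_def)
  from this[OF Av] have "qn_point d v - last_basis d = ?A *\<^sub>v v" unfolding qn_point_def .
  then have "A_pinv d *\<^sub>v (qn_point d v - last_basis d) = inv_mat ?G *\<^sub>v (transpose_mat ?A *\<^sub>v (?A *\<^sub>v v))"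
    unfolding A_pinv_def by (simp only: assoc_mult_mat_vec[OF inv(1) At Av])
  also have "\<dots> = (inv_mat ?G * ?G) *\<^sub>v v"
    by (simp only: assoc_mult_mat_vec[OF At A_mat_carrier v] assoc_mult_mat_vec[OF inv(1) AA v])
  finally show ?thesis using inv(3) v by simp
qed

lemma qn_iter_from_point:
  assumes "v \<in> carrier_vec (d - 1)"
  shows "qn_iter d lam mu x n (qn_point d v) s = (qn_step d lam mu x n ^^ s) v"
  unfolding qn_iter_def A_pinv_inverts[OF assms] ..

lemma idx_plus_Suc:
  "idx_plus d (Suc m) = insert (int (Suc m)) (idx_plus d m)" "int (Suc m) \<notin> idx_plus d m"
  by (auto simp: idx_plus_def)

lemma sum_idx_plus:
  fixes f :: "int \<Rightarrow> real"
  shows "(\<Sum>\<tau>\<in>idx_plus d m. f \<tau>) = (\<Sum>t\<in>{1..m}. f (int t)) + (\<Sum>j<d. f (- int (Suc j)))"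
proof (induction m)
  case 0
  have "(\<Sum>\<tau>\<in>idx_plus d 0. f \<tau>) = (\<Sum>j<d. f (- int (Suc j)))"
    by (rule sum.reindex_bij_witness[of _ "\<lambda>j. - int (Suc j)" "\<lambda>\<tau>. nat (- \<tau>) - 1"])
      (auto simp: idx_plus_def One_nat_def)
  then show ?case by simp
next
  case (Suc m)
  then show ?case unfolding idx_plus_Suc(1) using idx_plus_Suc(2)[of m d] by (simp del: of_nat_Suc)
qed

section \<open>The potential and its two-sided expansion\<close>

text \<open>
The two conditions on \<open>lam\<close> and \<open>mu\<close> keep the gradient jump of a round short enough for the expansions
to be accurate (\<open>cond\<close>) and let the volumetric barrier pay for the resulting gap (\<open>cond'\<close>).
\<close>
locale portfolio =
  fixes d T :: nat and x :: "nat \<Rightarrow> real vec" and lam mu :: real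
  assumes d2: "2 \<le> d"
    and x_carrier: "\<And>t. t \<in> {1..T} \<Longrightarrow> x t \<in> carrier_vec d"
    and x_nonneg: "\<And>t i. t \<in> {1..T} \<Longrightarrow> i < d \<Longrightarrow> 0 \<le> x t $ i"
    and x_nonzero: "\<And>t. t \<in> {1..T} \<Longrightarrow> x t \<noteq> 0\<^sub>v d"
    and lam_pos: "0 < lam" and mu_pos: "0 < mu"
    and cond: "(1 + 2 * mu / lam)\<^sup>2 / lam \<le> 1 / 550"
    and cond': "(1 + 2 * mu / lam)\<^sup>2 \<le> 5 / 8 * mu"
begin

text \<open>
The gradients of the algorithm are \<open>g\<^sub>\<tau> = - dir \<tau> / slack \<tau> v\<close>, with \<open>dir \<tau>\<close> independent of \<open>v\<close>.
\<close>
definition dir :: "int \<Rightarrow> real vec" where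
  "dir \<tau> = transpose_mat (A_mat d) *\<^sub>v ext_x d x \<tau>"

definition slack :: "int \<Rightarrow> real vec \<Rightarrow> real" where
  "slack \<tau> v = ext_x d x \<tau> \<bullet> qn_point d v"

text \<open>
This is \<open>g\<^sub>\<tau> \<bullet> h\<close>, the relative decrease of \<open>slack \<tau>\<close> on the way from \<open>v\<close> to \<open>v + h\<close> (\<open>slack_add\<close>).
\<close>
definition rel :: "real vec \<Rightarrow> int \<Rightarrow> real vec \<Rightarrow> real" where
  "rel v \<tau> h = - (dir \<tau> \<bullet> h) / slack \<tau> v"

text \<open>
The coordinates \<open>v\<close> of portfolios in the relative interior of the simplex.
\<close>
definition interior :: "real vec set" where
  "interior = {v \<in> carrier_vec (d - 1). \<forall>j<d. 0 < qn_point d v $ j}"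

text \<open>
The weights that make \<open>H\<close> a Gram matrix of the fixed vectors \<open>dir \<tau>\<close>.
\<close>
definition hw :: "real vec \<Rightarrow> int \<Rightarrow> real" where
  "hw v \<tau> = wt lam \<tau> / (slack \<tau> v)\<^sup>2"

text \<open>
The function \<open>F\<^sub>m\<close>, whose gradient is the vector \<open>G\<close> of the algorithm.
\<close>
definition potential :: "nat \<Rightarrow> real vec \<Rightarrow> real" where
  "potential m v = (\<Sum>\<tau>\<in>idx_plus d m. wt lam \<tau> * - ln (slack \<tau> v)) +
     mu / 2 * ln (det (gram (d - 1) (idx_plus d m) (hw v) dir))"

abbreviation pi_w :: "nat \<Rightarrow> real vec \<Rightarrow> int \<Rightarrow> real" where
  "pi_w m v \<equiv> qn_pi d lam x m v"

text \<open>
The squared length of \<open>h\<close> in the norm of \<open>\<Sum>\<tau>. W \<tau> g\<^sub>\<tau> g\<^sub>\<tau>\<^sup>T\<close>: for \<open>W = wt lam\<close> this is the norm of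
\<open>H\<close>, for \<open>W = mw m v\<close> that of \<open>M\<close>.
\<close>
definition qform :: "nat \<Rightarrow> (int \<Rightarrow> real) \<Rightarrow> real vec \<Rightarrow> real vec \<Rightarrow> real" where
  "qform m W v h = (\<Sum>\<tau>\<in>idx_plus d m. W \<tau> * (rel v \<tau> h)\<^sup>2)"

text \<open>
The scalar product of the vector \<open>G\<close> with \<open>h\<close> (\<open>qn_G_scalar\<close>).
\<close>
definition grad :: "nat \<Rightarrow> real vec \<Rightarrow> real vec \<Rightarrow> real" where
  "grad m v h = (\<Sum>\<tau>\<in>idx_plus d m. (wt lam \<tau> + mu * pi_w m v \<tau>) * rel v \<tau> h)"

lemma dir_carrier [simp]: "dir \<tau> \<in> carrier_vec (d - 1)"
  unfolding dir_def by (intro carrier_vecI) (simp add: A_mat_def)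

sublocale fam: vec_family "d - 1" "idx_plus d m" dir for m :: nat
  by unfold_locales auto

lemma wt_pos: "0 < wt lam \<tau>"
  using lam_pos by (simp add: wt_def)

lemma lam_ge: "550 \<le> lam"
proof -
  have "1 / lam \<le> (1 + 2 * mu / lam)\<^sup>2 / lam"
    using lam_pos mu_pos by (intro divide_right_mono) (auto simp: one_le_power)
  then have "1 / lam \<le> 1 / 550" using cond by linarith
  then show ?thesis using lam_pos by (simp add: field_simps)
qed

lemma observed_round: "m \<le> T \<Longrightarrow> \<tau> \<in> idx_plus d m \<Longrightarrow> \<not> \<tau> < 0 \<Longrightarrow> nat \<tau> \<in> {1..T}"
  by (auto simp: idx_plus_def nat_le_iff le_nat_iff)

lemma ext_x_basis: "ext_x d x (- int (Suc j)) = unit_vec d j"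
proof -
  have "nat (- (- int (Suc j))) - 1 = j" by (simp add: nat_diff_distrib One_nat_def)
  then show ?thesis by (simp only: ext_x_def) simp
qed

lemma ext_x_carrier: "m \<le> T \<Longrightarrow> \<tau> \<in> idx_plus d m \<Longrightarrow> ext_x d x \<tau> \<in> carrier_vec d"
  using x_carrier observed_round by (auto simp: ext_x_def)

lemma ext_x_nonneg: "m \<le> T \<Longrightarrow> \<tau> \<in> idx_plus d m \<Longrightarrow> i < d \<Longrightarrow> 0 \<le> ext_x d x \<tau> $ i"
  using x_nonneg observed_round by (auto simp: ext_x_def unit_vec_def)

lemma ext_x_nonzero: "m \<le> T \<Longrightarrow> \<tau> \<in> idx_plus d m \<Longrightarrow> \<exists>i<d. ext_x d x \<tau> $ i \<noteq> 0"
proof (cases "\<tau> < 0")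
  case True
  assume "m \<le> T" "\<tau> \<in> idx_plus d m"
  then have "nat (- \<tau>) - 1 < d" using True by (auto simp: idx_plus_def)
  then show ?thesis using True by (intro exI[of _ "nat (- \<tau>) - 1"]) (simp add: ext_x_def)
next
  case False
  assume "m \<le> T" "\<tau> \<in> idx_plus d m"
  then have "nat \<tau> \<in> {1..T}" using False by (auto simp: idx_plus_def)
  from x_nonzero[OF this] x_carrier[OF this] show ?thesis
    using False by (auto simp: ext_x_def vec_eq_iff)
qed

lemma basis_idx: "j < d \<Longrightarrow> - int (Suc j) \<in> idx_plus d m"
  by (auto simp: idx_plus_def)

lemma qn_point_carrier [simp]: "v \<in> carrier_vec (d - 1) \<Longrightarrow> qn_point d v \<in> carrier_vec d"
  by (intro carrier_vecI) (simp add: qn_point_def last_basis_def)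

lemma A_mult_carrier [simp]: "h \<in> carrier_vec (d - 1) \<Longrightarrow> A_mat d *\<^sub>v h \<in> carrier_vec d"
  by (intro carrier_vecI) (simp add: A_mat_def)

lemma slack_basis: "v \<in> carrier_vec (d - 1) \<Longrightarrow> j < d \<Longrightarrow> slack (- int (Suc j)) v = qn_point d v $ j"
  using qn_point_carrier[of v] by (simp add: slack_def ext_x_basis del: of_nat_Suc)

lemma dir_scalar:
  assumes "m \<le> T" "\<tau> \<in> idx_plus d m" "h \<in> carrier_vec (d - 1)"
  shows "dir \<tau> \<bullet> h = ext_x d x \<tau> \<bullet> (A_mat d *\<^sub>v h)"
  unfolding dir_def
  by (rule transpose_vec_mult_scalar[OF A_mat_carrier assms(3) ext_x_carrier[OF assms(1,2)]])

lemma slack_pos: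
  assumes v: "v \<in> interior" and m: "m \<le> T" and t: "\<tau> \<in> idx_plus d m"
  shows "0 < slack \<tau> v"
proof -
  have vc: "v \<in> carrier_vec (d - 1)" and pos: "\<And>j. j < d \<Longrightarrow> 0 < qn_point d v $ j"
    using v by (auto simp: interior_def)
  obtain i where i: "i < d" "ext_x d x \<tau> $ i \<noteq> 0" using ext_x_nonzero[OF m t] by blast
  have "slack \<tau> v = (\<Sum>j<d. ext_x d x \<tau> $ j * qn_point d v $ j)"
    using qn_point_carrier[OF vc] by (simp add: slack_def scalar_prod_def lessThan_atLeast0 carrier_vecD)
  moreover have "0 < \<dots>"
  proof (rule sum_pos2[of _ i])
    have "0 < ext_x d x \<tau> $ i" using ext_x_nonneg[OF m t i(1)] i(2) by simp
    then show "0 < ext_x d x \<tau> $ i * qn_point d v $ i" using pos[OF i(1)] by simp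
    show "0 \<le> ext_x d x \<tau> $ j * qn_point d v $ j" if "j \<in> {..<d}" for j
      using ext_x_nonneg[OF m t, of j] pos[of j] that by simp
  qed (use i in auto)
  ultimately show ?thesis by simp
qed

lemma qn_point_add:
  assumes "v \<in> carrier_vec (d - 1)" "h \<in> carrier_vec (d - 1)"
  shows "qn_point d (v + h) = qn_point d v + A_mat d *\<^sub>v h"
proof -
  have e: "last_basis d \<in> carrier_vec d" by (simp add: last_basis_def)
  show ?thesis
    unfolding qn_point_def mult_add_distrib_mat_vec[OF A_mat_carrier assms]
    using A_mult_carrier[OF assms(1)] A_mult_carrier[OF assms(2)] e
    by (simp add: assoc_add_vec[of _ d] comm_add_vec[of "last_basis d" d])
qed

lemma slack_add:
  assumes v: "v \<in> interior" and h: "h \<in> carrier_vec (d - 1)" and m: "m \<le> T" and t: "\<tau> \<in> idx_plus d m"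
  shows "slack \<tau> (v + h) = slack \<tau> v * (1 - rel v \<tau> h)"
proof -
  have vc: "v \<in> carrier_vec (d - 1)" using v by (simp add: interior_def)
  have "slack \<tau> (v + h) = slack \<tau> v + dir \<tau> \<bullet> h"
    unfolding slack_def qn_point_add[OF vc h] dir_scalar[OF m t h]
    by (rule scalar_prod_add_distrib[OF ext_x_carrier[OF m t] qn_point_carrier[OF vc] A_mult_carrier[OF h]])
  then show ?thesis using slack_pos[OF v m t] by (simp add: rel_def field_simps)
qed

lemma interior_addI:
  assumes v: "v \<in> interior" and h: "h \<in> carrier_vec (d - 1)"
    and lt: "\<And>\<tau>. \<tau> \<in> idx_plus d 0 \<Longrightarrow> rel v \<tau> h < 1"
  shows "v + h \<in> interior"
proof -
  have vc: "v \<in> carrier_vec (d - 1)" using v by (simp add: interior_def)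
  have "0 < qn_point d (v + h) $ j" if j: "j < d" for j
  proof -
    have b: "- int (Suc j) \<in> idx_plus d 0" by (rule basis_idx[OF j])
    have "0 < slack (- int (Suc j)) (v + h)"
      unfolding slack_add[OF v h le0 b] using slack_pos[OF v le0 b] lt[OF b] by simp
    then show ?thesis using slack_basis[of "v + h" j] vc h j by simp
  qed
  then show ?thesis using vc h by (simp add: interior_def)
qed

lemma rel_smult: "h \<in> carrier_vec (d - 1) \<Longrightarrow> rel v \<tau> (c \<cdot>\<^sub>v h) = c * rel v \<tau> h"
  using dir_carrier[of \<tau>] by (simp add: rel_def)

lemma qform_smult: "h \<in> carrier_vec (d - 1) \<Longrightarrow> qform m W v (c \<cdot>\<^sub>v h) = c\<^sup>2 * qform m W v h"
  by (simp add: qform_def rel_smult power_mult_distrib sum_distrib_left mult_ac)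

lemma quad_eq_qform: "fam.quad m (\<lambda>\<tau>. W \<tau> / (slack \<tau> v)\<^sup>2) h = qform m W v h"
  unfolding fam.quad_def qform_def rel_def by (simp add: power_divide)

lemma dir_basis:
  assumes "h \<in> carrier_vec (d - 1)" "j < d"
  shows "dir (- int (Suc j)) \<bullet> h = (A_mat d *\<^sub>v h) $ j"
  unfolding dir_scalar[OF le0 basis_idx[OF assms(2)] assms(1)]
  using assms(2) A_mult_carrier[OF assms(1)] by (simp add: ext_x_basis carrier_vecD del: of_nat_Suc)

text \<open>
Each observation is a nonnegative combination of basis vectors, so its relative change is a convex
combination of the relative changes of the coordinates.
\<close>
lemma rel_le_of_basis:
  assumes v: "v \<in> interior" and h: "h \<in> carrier_vec (d - 1)" and m: "m \<le> T" and t: "\<tau> \<in> idx_plus d m"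
    and b: "\<And>j. j < d \<Longrightarrow> \<bar>rel v (- int (Suc j)) h\<bar> \<le> b"
  shows "\<bar>rel v \<tau> h\<bar> \<le> b"
proof -
  have vc: "v \<in> carrier_vec (d - 1)" and pos: "\<And>j. j < d \<Longrightarrow> 0 < qn_point d v $ j"
    using v by (auto simp: interior_def)
  have basis: "\<bar>(A_mat d *\<^sub>v h) $ j\<bar> \<le> b * qn_point d v $ j" if j: "j < d" for j
    using b[OF j] pos[OF j] unfolding rel_def slack_basis[OF vc j] dir_basis[OF h j] by (simp add: field_simps)
  have sp: "ext_x d x \<tau> \<bullet> z = (\<Sum>j<d. ext_x d x \<tau> $ j * z $ j)" if "z \<in> carrier_vec d" for z
    using that by (simp add: scalar_prod_def lessThan_atLeast0 carrier_vecD)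
  have "\<bar>dir \<tau> \<bullet> h\<bar> \<le> (\<Sum>j<d. \<bar>ext_x d x \<tau> $ j * (A_mat d *\<^sub>v h) $ j\<bar>)"
    unfolding dir_scalar[OF m t h] sp[OF A_mult_carrier[OF h]] by (rule sum_abs)
  also have "\<dots> \<le> (\<Sum>j<d. ext_x d x \<tau> $ j * (b * qn_point d v $ j))"
    using ext_x_nonneg[OF m t] basis by (intro sum_mono) (auto simp: abs_mult intro!: mult_left_mono)
  also have "\<dots> = b * slack \<tau> v"
    unfolding slack_def sp[OF qn_point_carrier[OF vc]] by (simp add: sum_distrib_left mult_ac)
  finally show ?thesis
    unfolding rel_def using slack_pos[OF v m t] by (simp add: abs_div field_simps)
qed

text \<open>
The self-concordance of the problem: the basis vectors have weight \<open>lam\<close> in \<open>H\<close>, so a step of length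
\<open>q\<close> in the norm of \<open>H\<close> changes every coordinate, and with it every slack, by a relative amount of at
most \<open>q / sqrt lam\<close>.
\<close>
lemma rel_bound:
  assumes v: "v \<in> interior" and h: "h \<in> carrier_vec (d - 1)" and m: "m \<le> T" and t: "\<tau> \<in> idx_plus d m"
  shows "\<bar>rel v \<tau> h\<bar> \<le> sqrt (qform m (wt lam) v h / lam)"
proof (rule rel_le_of_basis[OF v h m t])
  fix j assume "j < d"
  then have i: "- int (Suc j) \<in> idx_plus d m" (is "?j \<in> _") by (rule basis_idx)
  have "lam * (rel v ?j h)\<^sup>2 = wt lam ?j * (rel v ?j h)\<^sup>2" by (simp add: wt_def)
  also have "\<dots> \<le> qform m (wt lam) v h"
    unfolding qform_def
    by (rule member_le_sum[OF i, where f = "\<lambda>\<tau>. wt lam \<tau> * (rel v \<tau> h)\<^sup>2"])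
      (auto intro: mult_nonneg_nonneg less_imp_le[OF wt_pos])
  finally have "(rel v ?j h)\<^sup>2 \<le> qform m (wt lam) v h / lam"
    using lam_pos by (simp add: field_simps)
  then show "\<bar>rel v ?j h\<bar> \<le> sqrt (qform m (wt lam) v h / lam)"
    by (rule real_le_rsqrt[of "\<bar>_\<bar>", simplified])
qed

lemma qform_nonneg: "(\<And>\<tau>. \<tau> \<in> idx_plus d m \<Longrightarrow> 0 \<le> W \<tau>) \<Longrightarrow> 0 \<le> qform m W v h"
  unfolding qform_def by (auto intro!: sum_nonneg)

lemma qform_mono: "(\<And>\<tau>. \<tau> \<in> idx_plus d m \<Longrightarrow> W \<tau> \<le> W' \<tau>) \<Longrightarrow> qform m W v h \<le> qform m W' v h"
  unfolding qform_def by (auto intro!: sum_mono mult_right_mono)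

text \<open>
The basis vectors alone determine a direction, since \<open>A\<close> contains the identity.
\<close>
lemma pos_def_weights:
  assumes v: "v \<in> interior" and m: "m \<le> T" and W: "\<And>\<tau>. \<tau> \<in> idx_plus d m \<Longrightarrow> wt lam \<tau> \<le> W \<tau>"
  shows "fam.pos_def m (\<lambda>\<tau>. W \<tau> / (slack \<tau> v)\<^sup>2)"
proof -
  have W0: "0 \<le> W \<tau>" if "\<tau> \<in> idx_plus d m" for \<tau>
    using W[OF that] wt_pos[of \<tau>] by linarith
  have "0 < qform m W v h" if h: "h \<in> carrier_vec (d - 1)" "h \<noteq> 0\<^sub>v (d - 1)" for h
  proof (rule ccontr)
    assume "\<not> 0 < qform m W v h"
    moreover have "qform m (wt lam) v h \<le> qform m W v h" by (rule qform_mono) (rule W)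
    ultimately have "qform m (wt lam) v h \<le> 0" by linarith
    then have "qform m (wt lam) v h = 0"
      by (intro order.antisym qform_nonneg less_imp_le[OF wt_pos])
    then have rel0: "rel v \<tau> h = 0" if "\<tau> \<in> idx_plus d m" for \<tau>
      using rel_bound[OF v h(1) m that] by simp
    have "h $ j = 0" if j: "j < d - 1" for j
    proof -
      have jd: "j < d" using j by simp
      let ?j = "- int (Suc j)"
      have i: "?j \<in> idx_plus d m" by (rule basis_idx[OF jd])
      have "dir ?j \<bullet> h = 0" using rel0[OF i] slack_pos[OF v m i] by (simp add: rel_def)
      then have "(A_mat d *\<^sub>v h) $ j = 0"
        unfolding dir_scalar[OF m i h(1)] using jd A_mult_carrier[OF h(1)] by (simp add: ext_x_basis carrier_vecD del: of_nat_Suc)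
      then show ?thesis using A_mult_index[OF h(1) j] by simp
    qed
    then have "h = 0\<^sub>v (d - 1)" using h(1) by (intro eq_vecI) auto
    with h(2) show False by simp
  qed
  then show ?thesis
    using W0 unfolding fam.pos_def_def quad_eq_qform by auto
qed

lemma pos_def_hw: "v \<in> interior \<Longrightarrow> m \<le> T \<Longrightarrow> fam.pos_def m (hw v)"
  unfolding hw_def[abs_def] by (rule pos_def_weights) auto

lemma qn_g_eq: "qn_g d x v \<tau> = (- (1 / slack \<tau> v)) \<cdot>\<^sub>v dir \<tau>"
  by (simp add: qn_g_def slack_def dir_def)

lemma dim_dir [simp]: "dim_vec (dir \<tau>) = d - 1"
  using dir_carrier by (rule carrier_vecD)

lemma qn_g_index: "i < d - 1 \<Longrightarrow> qn_g d x v \<tau> $ i = - (dir \<tau> $ i / slack \<tau> v)"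
  unfolding qn_g_eq by (subst index_smult_vec(1)) simp_all

lemma weighted_gram_qn_g:
  "mat (d - 1) (d - 1) (\<lambda>(i, j). \<Sum>\<tau>\<in>I. W \<tau> * (qn_g d x v \<tau> $ i * qn_g d x v \<tau> $ j)) =
   gram (d - 1) I (\<lambda>\<tau>. W \<tau> / (slack \<tau> v)\<^sup>2) dir"
  unfolding gram_def
  by (intro cong_mat refl) (auto intro!: sum.cong simp: qn_g_index power2_eq_square)

lemma qn_H_eq: "qn_H d lam x m v = gram (d - 1) (idx_plus d m) (hw v) dir"
  unfolding qn_H_def weighted_gram_qn_g hw_def[abs_def] ..

lemma qn_pi_eq:
  assumes v: "v \<in> interior" and m: "m \<le> T"
  shows "pi_w m v \<tau> = hw v \<tau> * fam.lev m (hw v) \<tau>"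
proof -
  let ?R = "inv_mat (qn_H d lam x m v)" and ?c = "- (1 / slack \<tau> v)"
  have R: "?R \<in> carrier_mat (d - 1) (d - 1)"
    unfolding qn_H_eq by (rule fam.gram_inverse(1)[OF pos_def_hw[OF v m]])
  have c: "?R *\<^sub>v dir \<tau> \<in> carrier_vec (d - 1)" using R dir_carrier by (rule mult_mat_vec_carrier)
  have "pi_w m v \<tau> = wt lam \<tau> * ((?c \<cdot>\<^sub>v dir \<tau>) \<bullet> (?c \<cdot>\<^sub>v (?R *\<^sub>v dir \<tau>)))"
    unfolding qn_pi_def qn_g_eq by (subst mult_mat_vec[OF R dir_carrier]) simp
  also have "\<dots> = wt lam \<tau> * (?c * ?c * (dir \<tau> \<bullet> (?R *\<^sub>v dir \<tau>)))"
    unfolding scalar_prod_smult_distrib[OF smult_carrier_vec[THEN iffD2, OF dir_carrier] c]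
      smult_scalar_prod_distrib[OF dir_carrier c] by (simp add: mult_ac)
  also have "\<dots> = hw v \<tau> * fam.lev m (hw v) \<tau>"
    unfolding fam.lev_def fam.sol_def qn_H_eq hw_def by (simp add: power2_eq_square)
  finally show ?thesis .
qed

text \<open>
The weights of \<open>g\<^sub>\<tau> g\<^sub>\<tau>\<^sup>T\<close> in the matrix \<open>M\<close>.
\<close>
definition mw :: "nat \<Rightarrow> real vec \<Rightarrow> int \<Rightarrow> real" where
  "mw m v \<tau> = wt lam \<tau> + 3 * mu * pi_w m v \<tau>"

lemma qn_M_eq: "qn_M d lam mu x m v = gram (d - 1) (idx_plus d m) (\<lambda>\<tau>. mw m v \<tau> / (slack \<tau> v)\<^sup>2) dir"
  unfolding qn_M_def weighted_gram_qn_g qn_H_eq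
  by (intro eq_matI)
    (auto simp: gram_def hw_def mw_def sum_distrib_left sum.distrib[symmetric] add_divide_distrib algebra_simps
      intro!: sum.cong)

lemma qn_G_carrier [simp]: "qn_G d lam mu x m v \<in> carrier_vec (d - 1)"
  by (simp add: qn_G_def)

lemma qn_G_scalar:
  assumes h: "h \<in> carrier_vec (d - 1)"
  shows "qn_G d lam mu x m v \<bullet> h = grad m v h"
proof -
  let ?w = "\<lambda>\<tau>. wt lam \<tau> + mu * pi_w m v \<tau>"
  have "qn_G d lam mu x m v \<bullet> h = (\<Sum>i<d - 1. (\<Sum>\<tau>\<in>idx_plus d m. ?w \<tau> * - (dir \<tau> $ i / slack \<tau> v)) * h $ i)"
    using h by (simp add: qn_G_def scalar_prod_def lessThan_atLeast0 qn_g_index)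
  also have "\<dots> = (\<Sum>\<tau>\<in>idx_plus d m. \<Sum>i<d - 1. ?w \<tau> * - (dir \<tau> $ i / slack \<tau> v) * h $ i)"
    unfolding sum_distrib_right by (rule sum.swap)
  also have "\<dots> = (\<Sum>\<tau>\<in>idx_plus d m. ?w \<tau> * rel v \<tau> h)"
  proof (intro sum.cong refl)
    fix \<tau>
    have "dir \<tau> \<bullet> h = (\<Sum>i<d - 1. dir \<tau> $ i * h $ i)"
      using h by (simp add: scalar_prod_def lessThan_atLeast0)
    then show "(\<Sum>i<d - 1. ?w \<tau> * - (dir \<tau> $ i / slack \<tau> v) * h $ i) = ?w \<tau> * rel v \<tau> h"
      by (simp add: rel_def sum_distrib_left sum_divide_distrib sum_negf[symmetric] mult_ac)
  qed
  finally show ?thesis by (simp add: grad_def)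
qed

lemma pi_nonneg:
  assumes "v \<in> interior" "m \<le> T" "\<tau> \<in> idx_plus d m"
  shows "0 \<le> pi_w m v \<tau>"
  unfolding qn_pi_eq[OF assms(1,2)]
  using fam.lev_nonneg[OF pos_def_hw[OF assms(1,2)] assms(3)] wt_pos[of \<tau>] by (simp add: hw_def)

text \<open>
Apply \<open>rel_bound\<close> to the direction \<open>H\<inverse> dir \<tau>\<close>: with \<open>l\<close> for \<open>lev\<close> and \<open>s\<close> for the slack it reads
\<open>l / s \<le> sqrt (l / lam)\<close>.
\<close>
lemma lev_le:
  assumes v: "v \<in> interior" and m: "m \<le> T" and t: "\<tau> \<in> idx_plus d m"
  shows "fam.lev m (hw v) \<tau> / (slack \<tau> v)\<^sup>2 \<le> 1 / lam"
proof -
  let ?y = "fam.sol m (hw v) (dir \<tau>)" and ?l = "fam.lev m (hw v) \<tau>"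
  have pd: "fam.pos_def m (hw v)" by (rule pos_def_hw[OF v m])
  have y: "?y \<in> carrier_vec (d - 1)" by (rule fam.sol_carrier[OF pd dir_carrier])
  have l: "0 \<le> ?l" by (rule fam.lev_nonneg[OF pd t])
  have q: "qform m (wt lam) v ?y = ?l"
    using fam.quad_sol[OF pd dir_carrier[of \<tau>]] unfolding hw_def[abs_def] quad_eq_qform fam.lev_def .
  have "\<bar>rel v \<tau> ?y\<bar>\<^sup>2 \<le> (sqrt (?l / lam))\<^sup>2"
    using rel_bound[OF v y m t] unfolding q by (rule power_mono) simp
  then have *: "?l * (?l / (slack \<tau> v)\<^sup>2) \<le> ?l * (1 / lam)"
    using l lam_pos by (simp add: rel_def fam.lev_def[symmetric] power_divide power2_eq_square)
  show ?thesis
  proof (cases "?l = 0")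
    case False
    with l have "0 < ?l" by simp
    with * show ?thesis by (rule mult_left_le_imp_le)
  qed (use lam_pos in simp)
qed

lemma pi_le:
  assumes v: "v \<in> interior" and m: "m \<le> T" and t: "\<tau> \<in> idx_plus d m"
  shows "pi_w m v \<tau> \<le> wt lam \<tau> / lam"
  using mult_left_mono[OF lev_le[OF assms] less_imp_le[OF wt_pos]]
  unfolding qn_pi_eq[OF v m] hw_def[of v \<tau>] by simp

lemma slack_ratio:
  assumes v: "v \<in> interior" and u: "u \<in> interior" and m: "m \<le> T" and t: "\<tau> \<in> idx_plus d m"
  shows "1 - rel v \<tau> (u - v) = slack \<tau> u / slack \<tau> v"
proof -
  have vc: "v \<in> carrier_vec (d - 1)" "u \<in> carrier_vec (d - 1)" using v u by (auto simp: interior_def)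
  then have h: "u - v \<in> carrier_vec (d - 1)" and "v + (u - v) = u" by auto
  then show ?thesis using slack_add[OF v h m t] slack_pos[OF v m t] by (simp add: field_simps)
qed

lemma rel_lt_1:
  assumes "v \<in> interior" "u \<in> interior" "m \<le> T" "\<tau> \<in> idx_plus d m"
  shows "rel v \<tau> (u - v) < 1"
proof -
  have "0 < slack \<tau> u / slack \<tau> v" using slack_pos[OF assms(1,3,4)] slack_pos[OF assms(2,3,4)] by simp
  then show ?thesis using slack_ratio[OF assms] by linarith
qed

lemma neg_ln_ratio:
  assumes "v \<in> interior" "u \<in> interior" "m \<le> T" "\<tau> \<in> idx_plus d m"
  shows "- ln (slack \<tau> u) - - ln (slack \<tau> v) = - ln (1 - rel v \<tau> (u - v))"
  unfolding slack_ratio[OF assms]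
  using slack_pos[OF assms(1,3,4)] slack_pos[OF assms(2,3,4)] by (simp add: ln_div)

lemma hw_ratio:
  assumes "v \<in> interior" "u \<in> interior" "m \<le> T" "\<tau> \<in> idx_plus d m"
  shows "hw u \<tau> = hw v \<tau> * (1 / (1 - rel v \<tau> (u - v))\<^sup>2)"
  unfolding slack_ratio[OF assms] hw_def
  using slack_pos[OF assms(1,3,4)] slack_pos[OF assms(2,3,4)] by (simp add: field_simps)

lemma potential_diff:
  assumes "v \<in> interior" "u \<in> interior" "m \<le> T"
  shows "potential m u - potential m v = (\<Sum>\<tau>\<in>idx_plus d m. wt lam \<tau> * - ln (1 - rel v \<tau> (u - v))) +
    mu / 2 * (ln (det (gram (d - 1) (idx_plus d m) (hw u) dir)) - ln (det (gram (d - 1) (idx_plus d m) (hw v) dir)))"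
proof -
  have "(\<Sum>\<tau>\<in>idx_plus d m. wt lam \<tau> * - ln (slack \<tau> u)) - (\<Sum>\<tau>\<in>idx_plus d m. wt lam \<tau> * - ln (slack \<tau> v))
     = (\<Sum>\<tau>\<in>idx_plus d m. wt lam \<tau> * - ln (1 - rel v \<tau> (u - v)))"
    unfolding sum_subtractf[symmetric] right_diff_distrib[symmetric]
    by (intro sum.cong refl) (simp only: neg_ln_ratio[OF assms])
  then show ?thesis unfolding potential_def by (simp add: algebra_simps)
qed

text \<open>
The convexity of the potential, with a curvature term left in.  Rescaling the slacks by \<open>1 - rel\<close>
multiplies the weights by \<open>1 / (1 - rel)\<^sup>2\<close>, whose logarithm is twice \<open>- ln (1 - rel)\<close>; the \<open>2\<close> cancels
the \<open>1/2\<close> in front of the logarithm of the determinant.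
\<close>
lemma potential_ge:
  assumes v: "v \<in> interior" and u: "u \<in> interior" and m: "m \<le> T"
  shows "(\<Sum>\<tau>\<in>idx_plus d m. (wt lam \<tau> + mu * pi_w m v \<tau>) * - ln (1 - rel v \<tau> (u - v)))
    \<le> potential m u - potential m v"
proof -
  define \<rho> where "\<rho> \<tau> = 1 / (1 - rel v \<tau> (u - v))\<^sup>2" for \<tau>
  have hw: "hw u \<tau> = hw v \<tau> * \<rho> \<tau>" if "\<tau> \<in> idx_plus d m" for \<tau>
    unfolding \<rho>_def by (rule hw_ratio[OF v u m that])
  have \<rho>: "0 < \<rho> \<tau>" "ln (\<rho> \<tau>) = 2 * - ln (1 - rel v \<tau> (u - v))" if "\<tau> \<in> idx_plus d m" for \<tau>
    using rel_lt_1[OF v u m that] by (simp_all add: \<rho>_def ln_div ln_realpow)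
  have "fam.pos_def m (\<lambda>\<tau>. hw v \<tau> * \<rho> \<tau>)"
    using pos_def_hw[OF u m] fam.pos_def_cong[of m "hw u" "\<lambda>\<tau>. hw v \<tau> * \<rho> \<tau>"] hw by simp
  then have "(\<Sum>\<tau>\<in>idx_plus d m. hw v \<tau> * fam.lev m (hw v) \<tau> * ln (\<rho> \<tau>)) \<le>
    ln (det (gram (d - 1) (idx_plus d m) (\<lambda>\<tau>. hw v \<tau> * \<rho> \<tau>) dir)) -
    ln (det (gram (d - 1) (idx_plus d m) (hw v) dir))"
    by (rule fam.ln_det_gram_ge[OF pos_def_hw[OF v m]]) (rule \<rho>(1))
  also have "gram (d - 1) (idx_plus d m) (\<lambda>\<tau>. hw v \<tau> * \<rho> \<tau>) dir = gram (d - 1) (idx_plus d m) (hw u) dir"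
    by (rule gram_cong) (simp add: hw)
  finally have *: "(\<Sum>\<tau>\<in>idx_plus d m. hw v \<tau> * fam.lev m (hw v) \<tau> * ln (\<rho> \<tau>)) \<le>
    ln (det (gram (d - 1) (idx_plus d m) (hw u) dir)) - ln (det (gram (d - 1) (idx_plus d m) (hw v) dir))" .
  have "mu / 2 * (\<Sum>\<tau>\<in>idx_plus d m. hw v \<tau> * fam.lev m (hw v) \<tau> * ln (\<rho> \<tau>))
      = (\<Sum>\<tau>\<in>idx_plus d m. mu * pi_w m v \<tau> * - ln (1 - rel v \<tau> (u - v)))"
    unfolding sum_distrib_left qn_pi_eq[OF v m] by (intro sum.cong refl) (simp add: \<rho>(2))
  moreover have "mu / 2 * (\<Sum>\<tau>\<in>idx_plus d m. hw v \<tau> * fam.lev m (hw v) \<tau> * ln (\<rho> \<tau>)) \<le>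
    mu / 2 * (ln (det (gram (d - 1) (idx_plus d m) (hw u) dir)) - ln (det (gram (d - 1) (idx_plus d m) (hw v) dir)))"
    using mu_pos by (intro mult_left_mono *) simp
  ultimately show ?thesis
    unfolding potential_diff[OF v u m] distrib_right sum.distrib by linarith
qed

text \<open>
The same change of weights, now with the concavity bound.  To second order the volumetric part is
\<open>mu * pi * (rel + 3/2 rel\<^sup>2)\<close>, which is where \<open>M\<close> comes from.
\<close>
lemma potential_le:
  assumes v: "v \<in> interior" and u: "u \<in> interior" and m: "m \<le> T"
  shows "potential m u - potential m v \<le> (\<Sum>\<tau>\<in>idx_plus d m. wt lam \<tau> * - ln (1 - rel v \<tau> (u - v)) +
      mu * pi_w m v \<tau> * ((1 / (1 - rel v \<tau> (u - v))\<^sup>2 - 1) / 2))"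
proof -
  have "mu / 2 * (ln (det (gram (d - 1) (idx_plus d m) (hw u) dir)) - ln (det (gram (d - 1) (idx_plus d m) (hw v) dir)))
    \<le> mu / 2 * (\<Sum>\<tau>\<in>idx_plus d m. (hw u \<tau> - hw v \<tau>) * fam.lev m (hw v) \<tau>)"
    using mu_pos by (intro mult_left_mono fam.ln_det_gram_le pos_def_hw v u m) simp
  also have "\<dots> = (\<Sum>\<tau>\<in>idx_plus d m. mu * pi_w m v \<tau> * ((1 / (1 - rel v \<tau> (u - v))\<^sup>2 - 1) / 2))"
    unfolding sum_distrib_left qn_pi_eq[OF v m]
    by (intro sum.cong refl) (simp add: hw_ratio[OF v u m] algebra_simps)
  finally show ?thesis
    unfolding potential_diff[OF v u m] sum.distrib by linarith
qed

section \<open>Quasi-Newton steps\<close>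

text \<open>
An optimality gap of at most \<open>\<gamma>\<close>, stated without reference to a minimiser.
\<close>
definition near_min :: "nat \<Rightarrow> real vec \<Rightarrow> real \<Rightarrow> bool" where
  "near_min m v \<gamma> \<longleftrightarrow> v \<in> interior \<and> (\<forall>u\<in>interior. potential m v \<le> potential m u + \<gamma>)"

lemma sqrt_lam_ge: "23 \<le> sqrt lam"
  using lam_ge by (intro real_le_rsqrt) simp

text \<open>
A gradient that is small in some dual norm bounds the optimality gap.  If the way from \<open>v\<close> to \<open>u\<close> is
short in that norm, the quadratic lower bound applies and completing the square gives the claim.  If it
is long, convexity reduces to the point of the segment at distance \<open>sqrt lam / 50\<close>; there the quadratic
term already dominates the linear one, so the potential at \<open>u\<close> is not smaller than at \<open>v\<close>.  The weights
\<open>W\<close> leave a choice of norm: the step analysis uses the full curvature, the stability analysis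
\<open>wt lam\<close>.
\<close>
lemma potential_gap:
  assumes v: "v \<in> interior" and u: "u \<in> interior" and m: "m \<le> T"
    and W: "\<And>\<tau>. \<tau> \<in> idx_plus d m \<Longrightarrow> wt lam \<tau> \<le> W \<tau>"
      "\<And>\<tau>. \<tau> \<in> idx_plus d m \<Longrightarrow> W \<tau> \<le> wt lam \<tau> + mu * pi_w m v \<tau>"
    and D: "0 \<le> D" "D \<le> 29 / 60 * (sqrt lam / 50)"
    and dual: "\<And>h. h \<in> carrier_vec (d - 1) \<Longrightarrow> \<bar>grad m v h\<bar> \<le> D * sqrt (qform m W v h)"
  shows "potential m v - potential m u \<le> 15 / 29 * D\<^sup>2"
proof -
  define h where "h = u - v"
  define q where "q = sqrt (qform m W v h)"
  define w where "w \<tau> = wt lam \<tau> + mu * pi_w m v \<tau>" for \<tau>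
  define S where "S = (\<Sum>\<tau>\<in>idx_plus d m. w \<tau> * - ln (1 - rel v \<tau> h))"
  have h: "h \<in> carrier_vec (d - 1)" using u v by (auto simp: h_def interior_def)
  have W0: "0 \<le> W \<tau>" if "\<tau> \<in> idx_plus d m" for \<tau>
    using W(1)[OF that] wt_pos[of \<tau>] by linarith
  have w0: "0 \<le> w \<tau>" if "\<tau> \<in> idx_plus d m" for \<tau>
    using W(2)[OF that] W0[OF that] by (simp add: w_def)
  have q0: "0 \<le> q" "q\<^sup>2 = qform m W v h"
    using qform_nonneg[of m W v h] W0 by (auto simp: q_def)
  have S: "S \<le> potential m u - potential m v"
    unfolding S_def w_def h_def by (rule potential_ge[OF v u m])
  have rel_le: "\<bar>rel v \<tau> h\<bar> \<le> q / sqrt lam" if t: "\<tau> \<in> idx_plus d m" for \<tau>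
  proof -
    have "qform m (wt lam) v h \<le> qform m W v h" by (rule qform_mono) (rule W(1))
    then have "sqrt (qform m (wt lam) v h / lam) \<le> sqrt (qform m W v h / lam)"
      using lam_pos by (simp add: divide_right_mono)
    then show ?thesis
      using rel_bound[OF v h m t] by (simp add: q_def real_sqrt_divide)
  qed
  have scaled: "- D * (t * q) + 29 / 60 * (t * q)\<^sup>2 \<le> t * S"
    if t: "0 \<le> t" "t \<le> 1" "t * q \<le> sqrt lam / 50" for t
  proof -
    have "- D * (t * q) + 29 / 60 * (t * q)\<^sup>2 = t * (- (D * q)) + 29 / 60 * (t\<^sup>2 * qform m W v h)"
      using q0 by (simp add: power_mult_distrib)
    also have "\<dots> \<le> t * grad m v h + 29 / 60 * (t\<^sup>2 * qform m w v h)"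
    proof (intro add_mono mult_left_mono)
      show "- (D * q) \<le> grad m v h" using dual[OF h] by (simp add: q_def)
      show "qform m W v h \<le> qform m w v h" by (rule qform_mono) (simp add: w_def W(2))
    qed (use t in auto)
    also have "\<dots> = (\<Sum>\<tau>\<in>idx_plus d m. w \<tau> * (t * rel v \<tau> h + 29 / 60 * (t * rel v \<tau> h)\<^sup>2))"
      unfolding grad_def qform_def w_def[symmetric]
      by (simp add: sum_distrib_left sum.distrib[symmetric] power_mult_distrib algebra_simps)
    also have "\<dots> \<le> (\<Sum>\<tau>\<in>idx_plus d m. w \<tau> * (t * - ln (1 - rel v \<tau> h)))"
    proof (intro sum_mono mult_left_mono w0)
      fix \<tau> assume i: "\<tau> \<in> idx_plus d m"
      have "\<bar>t * rel v \<tau> h\<bar> \<le> t * (q / sqrt lam)"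
        using mult_left_mono[OF rel_le[OF i] t(1)] t(1) by (simp add: abs_mult)
      also have "\<dots> \<le> 1 / 50" using t(3) lam_pos by (simp add: field_simps)
      finally have "t * rel v \<tau> h + 29 / 60 * (t * rel v \<tau> h)\<^sup>2 \<le> - ln (1 - t * rel v \<tau> h)"
        by (rule neg_ln_quadratic(1))
      also have "\<dots> \<le> t * - ln (1 - rel v \<tau> h)"
        using rel_lt_1[OF v u m i] t by (intro neg_ln_scale) (simp_all add: h_def)
      finally show "t * rel v \<tau> h + 29 / 60 * (t * rel v \<tau> h)\<^sup>2 \<le> t * - ln (1 - rel v \<tau> h)" .
    qed
    also have "\<dots> = t * S" by (simp add: S_def sum_distrib_left mult_ac)
    finally show ?thesis .
  qed
  show ?thesis
  proof (cases "q \<le> sqrt lam / 50")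
    case True
    have "0 \<le> 29 / 60 * (q - 30 / 29 * D)\<^sup>2" by simp
    also have "\<dots> = - D * q + 29 / 60 * q\<^sup>2 + 15 / 29 * D\<^sup>2"
      by (simp add: power2_eq_square algebra_simps)
    finally show ?thesis using scaled[of 1] True S by simp
  next
    case False
    \<comment> \<open>the largest distance at which all relative changes stay below \<open>1/50\<close>\<close>
    define R where "R = sqrt lam / 50"
    have R: "0 < R" "R < q" using False lam_pos by (auto simp: R_def)
    have eq: "R / q * q = R" and t: "0 \<le> R / q" "R / q \<le> 1" using R by simp_all
    have "R / q * q \<le> sqrt lam / 50" unfolding eq by (simp add: R_def)
    from scaled[OF t this] have "- D * R + 29 / 60 * R\<^sup>2 \<le> R / q * S" unfolding eq .
    moreover have "0 \<le> R * (29 / 60 * R - D)" using R D by (simp add: R_def)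
    moreover have "- D * R + 29 / 60 * R\<^sup>2 = R * (29 / 60 * R - D)"
      by (simp add: power2_eq_square algebra_simps)
    ultimately have "0 \<le> R / q * S" by linarith
    then have "0 \<le> S" using R by (simp add: zero_le_divide_iff zero_le_mult_iff)
    moreover have "0 \<le> 15 / 29 * D\<^sup>2" by simp
    ultimately show ?thesis using S by linarith
  qed
qed

definition newton_dir :: "nat \<Rightarrow> real vec \<Rightarrow> real vec" where
  "newton_dir m v = inv_mat (qn_M d lam mu x m v) *\<^sub>v qn_G d lam mu x m v"

text \<open>
The squared length of the step in the norm of \<open>M\<close>, also the squared dual norm of the gradient.
\<close>
definition decrement :: "nat \<Rightarrow> real vec \<Rightarrow> real" where
  "decrement m v = grad m v (newton_dir m v)"

lemma mw_ge: "v \<in> interior \<Longrightarrow> m \<le> T \<Longrightarrow> \<tau> \<in> idx_plus d m \<Longrightarrow> wt lam \<tau> \<le> mw m v \<tau>"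
  using pi_nonneg mu_pos by (simp add: mw_def)

lemma pos_def_mw: "v \<in> interior \<Longrightarrow> m \<le> T \<Longrightarrow> fam.pos_def m (\<lambda>\<tau>. mw m v \<tau> / (slack \<tau> v)\<^sup>2)"
  by (rule pos_def_weights) (auto intro: mw_ge)

lemma newton_dir_eq: "newton_dir m v = fam.sol m (\<lambda>\<tau>. mw m v \<tau> / (slack \<tau> v)\<^sup>2) (qn_G d lam mu x m v)"
  unfolding newton_dir_def fam.sol_def qn_M_eq ..

lemma newton_dir_carrier: "v \<in> interior \<Longrightarrow> m \<le> T \<Longrightarrow> newton_dir m v \<in> carrier_vec (d - 1)"
  unfolding newton_dir_eq by (intro fam.sol_carrier pos_def_mw qn_G_carrier)

lemma decrement_eq:
  assumes "v \<in> interior" "m \<le> T"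
  shows "decrement m v = qform m (mw m v) v (newton_dir m v)"
  using fam.quad_sol[OF pos_def_mw[OF assms] qn_G_carrier[of m v]] newton_dir_carrier[OF assms]
  unfolding decrement_def newton_dir_eq[symmetric] quad_eq_qform by (simp add: qn_G_scalar)

lemma decrement_nonneg: "v \<in> interior \<Longrightarrow> m \<le> T \<Longrightarrow> 0 \<le> decrement m v"
  unfolding decrement_eq using mw_ge wt_pos by (intro qform_nonneg) (meson less_le_trans less_imp_le)

lemma grad_dual_mw:
  assumes "v \<in> interior" "m \<le> T" "h \<in> carrier_vec (d - 1)"
  shows "\<bar>grad m v h\<bar> \<le> sqrt (decrement m v) * sqrt (qform m (mw m v) v h)"
  using fam.dual_norm_bound[OF pos_def_mw[OF assms(1,2)] qn_G_carrier[of m v] assms(3)] assms(3)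
    newton_dir_carrier[OF assms(1,2)]
  unfolding newton_dir_eq[symmetric] quad_eq_qform by (simp add: qn_G_scalar decrement_def)

lemma grad_dual_scaled:
  assumes v: "v \<in> interior" and m: "m \<le> T" and h: "h \<in> carrier_vec (d - 1)" and K: "0 \<le> K"
    and le: "\<And>\<tau>. \<tau> \<in> idx_plus d m \<Longrightarrow> mw m v \<tau> \<le> K * W \<tau>"
  shows "\<bar>grad m v h\<bar> \<le> sqrt (K * decrement m v) * sqrt (qform m W v h)"
proof -
  have "qform m (mw m v) v h \<le> qform m (\<lambda>\<tau>. K * W \<tau>) v h" by (rule qform_mono) (rule le)
  also have "\<dots> = K * qform m W v h" by (simp add: qform_def sum_distrib_left mult_ac)
  finally have "sqrt (decrement m v) * sqrt (qform m (mw m v) v h) \<le> sqrt (decrement m v) * sqrt (K * qform m W v h)"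
    using decrement_nonneg[OF v m] by (intro mult_left_mono) auto
  with grad_dual_mw[OF v m h] show ?thesis by (simp add: real_sqrt_mult mult_ac)
qed

text \<open>
The algorithm takes the step \<open>\<eta> = 1\<close>.  Smaller \<open>\<eta>\<close> serve to deduce in \<open>decrement_le_gap\<close> that this
step is short: from a point with a large decrement a damped step would gain more than the gap.
\<close>
lemma damped_step:
  assumes v: "v \<in> interior" and m: "m \<le> T" and \<eta>: "0 \<le> \<eta>" "\<eta> * sqrt (decrement m v) \<le> sqrt lam / 50"
  defines "u \<equiv> v + (- \<eta>) \<cdot>\<^sub>v newton_dir m v"
  shows "u \<in> interior" "potential m u \<le> potential m v - \<eta> * decrement m v + 31 / 60 * \<eta>\<^sup>2 * decrement m v"
proof -
  let ?y = "newton_dir m v" and ?N = "decrement m v"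
  define h where "h = (- \<eta>) \<cdot>\<^sub>v ?y"
  have y: "?y \<in> carrier_vec (d - 1)" by (rule newton_dir_carrier[OF v m])
  then have h: "h \<in> carrier_vec (d - 1)" by (simp add: h_def)
  have rel_h: "rel v \<tau> h = - \<eta> * rel v \<tau> ?y" for \<tau> unfolding h_def by (rule rel_smult[OF y])
  have small: "\<bar>rel v \<tau> h\<bar> \<le> 1 / 50" if t: "\<tau> \<in> idx_plus d m" for \<tau>
  proof -
    have "qform m (wt lam) v ?y \<le> ?N"
      unfolding decrement_eq[OF v m] by (rule qform_mono) (rule mw_ge[OF v m])
    then have "sqrt (qform m (wt lam) v ?y / lam) \<le> sqrt (?N / lam)"
      using lam_pos by (simp add: divide_right_mono)
    then have y_le: "\<bar>rel v \<tau> ?y\<bar> \<le> sqrt ?N / sqrt lam"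
      using rel_bound[OF v y m t] by (simp add: real_sqrt_divide)
    have "\<bar>rel v \<tau> h\<bar> \<le> \<eta> * (sqrt ?N / sqrt lam)"
      unfolding rel_h using mult_left_mono[OF y_le \<eta>(1)] \<eta>(1) by (simp add: abs_mult)
    also have "\<dots> \<le> 1 / 50" using \<eta>(2) lam_pos by (simp add: field_simps)
    finally show ?thesis .
  qed
  have sub: "idx_plus d 0 \<subseteq> idx_plus d m" by (auto simp: idx_plus_def)
  have u: "u = v + h" by (simp add: u_def h_def)
  show ui: "u \<in> interior"
    unfolding u
  proof (rule interior_addI[OF v h])
    fix \<tau> assume "\<tau> \<in> idx_plus d 0"
    then show "rel v \<tau> h < 1" using small[of \<tau>] sub by auto
  qed
  have uv: "u - v = h" using v h unfolding u by (auto simp: interior_def)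
  have "potential m u - potential m v \<le> (\<Sum>\<tau>\<in>idx_plus d m. wt lam \<tau> * - ln (1 - rel v \<tau> h) +
      mu * pi_w m v \<tau> * ((1 / (1 - rel v \<tau> h)\<^sup>2 - 1) / 2))"
    using potential_le[OF v ui m] unfolding uv .
  also have "\<dots> \<le> (\<Sum>\<tau>\<in>idx_plus d m. wt lam \<tau> * (rel v \<tau> h + 31 / 60 * (rel v \<tau> h)\<^sup>2) +
      mu * pi_w m v \<tau> * (rel v \<tau> h + 31 / 20 * (rel v \<tau> h)\<^sup>2))"
    using wt_pos mu_pos pi_nonneg[OF v m]
    by (intro sum_mono add_mono mult_left_mono neg_ln_quadratic inverse_square_quadratic small)
      (auto intro: less_imp_le)
  also have "\<dots> = grad m v h + 31 / 60 * qform m (mw m v) v h"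
    unfolding grad_def qform_def mw_def sum_distrib_left sum.distrib[symmetric]
    by (intro sum.cong refl) (simp add: algebra_simps)
  also have "grad m v h = - \<eta> * ?N"
    unfolding decrement_def grad_def rel_h by (simp add: sum_distrib_left mult_ac)
  also have "qform m (mw m v) v h = \<eta>\<^sup>2 * ?N"
    unfolding h_def qform_smult[OF y] decrement_eq[OF v m] by simp
  finally show "potential m u \<le> potential m v - \<eta> * ?N + 31 / 60 * \<eta>\<^sup>2 * ?N" by simp
qed

lemma decrement_le_gap:
  assumes g: "near_min m v \<gamma>" and m: "m \<le> T" and \<gamma>: "\<gamma> \<le> 1 / 125"
  shows "decrement m v \<le> 60 / 29 * \<gamma>" "sqrt (decrement m v) \<le> sqrt lam / 50"
proof -
  let ?N = "decrement m v"
  have v: "v \<in> interior" and gap: "\<And>u. u \<in> interior \<Longrightarrow> potential m v \<le> potential m u + \<gamma>"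
    using g by (auto simp: near_min_def)
  have N: "0 \<le> ?N" by (rule decrement_nonneg[OF v m])
  show small: "sqrt ?N \<le> sqrt lam / 50"
  proof (rule ccontr)
    assume "\<not> sqrt ?N \<le> sqrt lam / 50"
    then have big: "sqrt lam / 50 < sqrt ?N" by simp
    moreover have "0 < sqrt lam / 50" using lam_pos by simp
    ultimately have sN: "0 < sqrt ?N" by linarith
    \<comment> \<open>the damping that makes the step as long as \<open>damped_step\<close> permits\<close>
    define \<eta> where "\<eta> = sqrt lam / 50 / sqrt ?N"
    have \<eta>: "0 < \<eta>" "\<eta> < 1" "\<eta> * sqrt ?N = sqrt lam / 50"
      using big sN lam_pos by (auto simp: \<eta>_def)
    have "potential m v \<le> potential m v - \<eta> * ?N + 31 / 60 * \<eta>\<^sup>2 * ?N + \<gamma>"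
      using damped_step[OF v m, of \<eta>] gap \<eta> by fastforce
    then have "\<eta> * ?N - 31 / 60 * \<eta>\<^sup>2 * ?N \<le> \<gamma>" by simp
    moreover have "\<eta>\<^sup>2 * ?N \<le> \<eta> * ?N"
      using \<eta> N by (intro mult_right_mono) (auto simp: power2_eq_square)
    moreover have "\<eta>\<^sup>2 * ?N = lam / 2500"
    proof -
      have "\<eta>\<^sup>2 * ?N = (\<eta> * sqrt ?N)\<^sup>2" using N by (simp add: power_mult_distrib)
      then show ?thesis using lam_pos unfolding \<eta>(3) by (simp add: power_divide)
    qed
    ultimately show False using \<gamma> lam_ge by simp
  qed
  have "potential m v \<le> potential m v - 1 * ?N + 31 / 60 * 1\<^sup>2 * ?N + \<gamma>"
    using damped_step[OF v m, of 1] gap small by fastforce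
  then show "?N \<le> 60 / 29 * \<gamma>" by simp
qed

text \<open>
The gap is at most \<open>15/29 \<cdot> 3\<close> times the decrement, as \<open>M\<close> is at most three times the curvature in
\<open>potential_ge\<close>, and the step gains at least \<open>29/60\<close> times the decrement.  The quotient of the two
exceeds \<open>1/4\<close>.
\<close>
lemma newton_step_contracts:
  assumes g: "near_min m v \<gamma>" and m: "m \<le> T" and \<gamma>: "0 \<le> \<gamma>" "\<gamma> \<le> 1 / 125"
  shows "near_min m (qn_step d lam mu x m v) (3 / 4 * \<gamma>)"
proof -
  let ?N = "decrement m v" and ?v = "qn_step d lam mu x m v"
  have v: "v \<in> interior" and gap: "\<And>u. u \<in> interior \<Longrightarrow> potential m v \<le> potential m u + \<gamma>"
    using g by (auto simp: near_min_def)
  have N: "0 \<le> ?N" by (rule decrement_nonneg[OF v m])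
  have step: "?v = v + (- 1) \<cdot>\<^sub>v newton_dir m v"
    using newton_dir_carrier[OF v m] v unfolding qn_step_def newton_dir_def[symmetric] interior_def
    by (intro eq_vecI) auto
  have new: "?v \<in> interior" "potential m ?v \<le> potential m v - 29 / 60 * ?N"
    using damped_step[OF v m, of 1] decrement_le_gap(2)[OF g m \<gamma>(2)] unfolding step by auto
  have "potential m ?v \<le> potential m u + 3 / 4 * \<gamma>" if u: "u \<in> interior" for u
  proof -
    have "potential m v - potential m u \<le> 15 / 29 * (sqrt (3 * ?N))\<^sup>2"
    proof (rule potential_gap[OF v u m, where W = "\<lambda>\<tau>. wt lam \<tau> + mu * pi_w m v \<tau>"])
      have "sqrt (3 * ?N) \<le> sqrt ((29 / 60 * (sqrt lam / 50))\<^sup>2)"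
      proof (intro real_sqrt_le_mono)
        have "3 * ?N \<le> 180 / 29 * (1 / 125)" using decrement_le_gap(1)[OF g m \<gamma>(2)] \<gamma> by simp
        also have "\<dots> \<le> (29 / 60 / 50)\<^sup>2 * lam" using lam_ge by (simp add: power_divide)
        also have "\<dots> = (29 / 60 * (sqrt lam / 50))\<^sup>2" using lam_pos by (simp add: power_divide power_mult_distrib)
        finally show "3 * ?N \<le> (29 / 60 * (sqrt lam / 50))\<^sup>2" .
      qed
      then show "sqrt (3 * ?N) \<le> 29 / 60 * (sqrt lam / 50)" using lam_pos by simp
      show "\<bar>grad m v h\<bar> \<le> sqrt (3 * ?N) * sqrt (qform m (\<lambda>\<tau>. wt lam \<tau> + mu * pi_w m v \<tau>) v h)"
        if "h \<in> carrier_vec (d - 1)" for h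
        by (rule grad_dual_scaled[OF v m that])
          (use wt_pos in \<open>auto simp: mw_def intro: less_imp_le\<close>)
    qed (use pi_nonneg[OF v m] mu_pos N in auto)
    then have "potential m v - potential m u \<le> 45 / 29 * ?N" using N by simp
    then show ?thesis using new(2) gap[OF u] \<gamma> N by simp
  qed
  then show ?thesis using new(1) by (simp add: near_min_def)
qed

lemma newton_iterates:
  assumes g: "near_min m v \<gamma>" and m: "m \<le> T" and \<gamma>: "0 \<le> \<gamma>" "\<gamma> \<le> 1 / 125"
  shows "near_min m ((qn_step d lam mu x m ^^ s) v) ((3 / 4) ^ s * \<gamma>)"
proof (induction s)
  case 0
  show ?case using g by simp
next
  case (Suc s)
  have "(3 / 4) ^ s * \<gamma> \<le> 1 * \<gamma>" using \<gamma> by (intro mult_right_mono power_le_one) auto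
  then have "near_min m (qn_step d lam mu x m ((qn_step d lam mu x m ^^ s) v)) (3 / 4 * ((3 / 4) ^ s * \<gamma>))"
    using \<gamma> by (intro newton_step_contracts Suc m) auto
  then show ?case by (simp add: mult.assoc)
qed

text \<open>
The conditions of \<open>well_defined_run\<close> on a single step.
\<close>
lemma legitimate_step:
  assumes v: "v \<in> interior" and m: "m \<le> T"
  shows "\<forall>\<tau>\<in>idx_plus d m. ext_x d x \<tau> \<bullet> qn_point d v \<noteq> 0"
    "invertible_mat (qn_H d lam x m v)" "invertible_mat (qn_M d lam mu x m v)"
proof -
  show "\<forall>\<tau>\<in>idx_plus d m. ext_x d x \<tau> \<bullet> qn_point d v \<noteq> 0"
    using slack_pos[OF v m] unfolding slack_def by (metis less_irrefl)
  show "invertible_mat (qn_H d lam x m v)"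
    unfolding qn_H_eq by (rule fam.gram_inverse(3)[OF pos_def_hw[OF v m]])
  show "invertible_mat (qn_M d lam mu x m v)"
    unfolding qn_M_eq by (rule fam.gram_inverse(3)[OF pos_def_mw[OF v m]])
qed

section \<open>Arrival of a new observation\<close>

lemma new_weight: "wt lam (int (Suc m)) = 1"
  by (simp add: wt_def)

definition new_pi :: "nat \<Rightarrow> real vec \<Rightarrow> real" where
  "new_pi m v = pi_w (Suc m) v (int (Suc m))"

text \<open>
A new observation lowers all other leverage scores, and in total by its own score: the scores always
add up to the dimension.  The proof is the rank-one update of the inverse in scalar form: the new
vector \<open>z\<close> (inverse before the arrival, applied to the new direction) is \<open>1 + p\<close> times \<open>y\<close> (inverse
after it).
\<close>
lemma leverage_drop:
  assumes v: "v \<in> interior" and m: "Suc m \<le> T"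
  shows "\<And>\<tau>. \<tau> \<in> idx_plus d m \<Longrightarrow> pi_w (Suc m) v \<tau> \<le> pi_w m v \<tau>"
    "(\<Sum>\<tau>\<in>idx_plus d m. pi_w m v \<tau> - pi_w (Suc m) v \<tau>) = new_pi m v"
proof -
  let ?c = "hw v" and ?I = "idx_plus d m" and ?e = "dir (int (Suc m))"
  define w where "w = hw v (int (Suc m))"
  define y where "y = fam.sol (Suc m) ?c ?e"
  define z where "z = fam.sol m ?c ?e"
  define p where "p = w * (?e \<bullet> z)"
  have m': "m \<le> T" using m by simp
  have pd: "fam.pos_def m ?c" and pd': "fam.pos_def (Suc m) ?c"
    using pos_def_hw[OF v m'] pos_def_hw[OF v m] by auto
  have w: "0 < w"
    using slack_pos[OF v m, of "int (Suc m)"] idx_plus_Suc(1)[of d m] new_weight[of m] by (simp add: w_def hw_def)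
  have c: "y \<in> carrier_vec (d - 1)" "z \<in> carrier_vec (d - 1)"
    unfolding y_def z_def by (auto intro!: fam.sol_carrier pd pd')
  have split: "(\<Sum>\<tau>\<in>idx_plus d (Suc m). f \<tau>) = f (int (Suc m)) + (\<Sum>\<tau>\<in>?I. f \<tau>)" for f :: "int \<Rightarrow> real"
    unfolding idx_plus_Suc(1) using idx_plus_Suc(2) by simp
  have p0: "0 \<le> p" unfolding p_def z_def using fam.scalar_sol_nonneg[OF pd dir_carrier] w by simp
  have zy: "dir \<tau> \<bullet> z = (1 + p) * (dir \<tau> \<bullet> y)" for \<tau>
  proof -
    let ?k' = "fam.sol (Suc m) ?c (dir \<tau>)"
    have k': "?k' \<in> carrier_vec (d - 1)" by (intro fam.sol_carrier pd' dir_carrier)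
    have "dir \<tau> \<bullet> z = w * (?e \<bullet> ?k') * (?e \<bullet> z) + (\<Sum>\<sigma>\<in>?I. ?c \<sigma> * (dir \<sigma> \<bullet> ?k') * (dir \<sigma> \<bullet> z))"
      unfolding fam.scalar_sol[OF pd' dir_carrier c(2), of \<tau>] split w_def ..
    also have "(\<Sum>\<sigma>\<in>?I. ?c \<sigma> * (dir \<sigma> \<bullet> ?k') * (dir \<sigma> \<bullet> z)) = ?e \<bullet> ?k'"
      unfolding fam.scalar_sol[OF pd dir_carrier k', of "int (Suc m)"] z_def by (simp add: mult_ac)
    also have "?e \<bullet> ?k' = dir \<tau> \<bullet> y"
      unfolding y_def by (rule fam.sol_symmetric[OF pd' dir_carrier dir_carrier])
    finally show ?thesis by (simp add: p_def algebra_simps)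
  qed
  have drop: "pi_w m v \<tau> - pi_w (Suc m) v \<tau> = w * (?c \<tau> * (dir \<tau> \<bullet> z) * (dir \<tau> \<bullet> y))" for \<tau>
  proof -
    let ?k = "fam.sol m ?c (dir \<tau>)" and ?k' = "fam.sol (Suc m) ?c (dir \<tau>)"
    have k: "?k \<in> carrier_vec (d - 1)" "?k' \<in> carrier_vec (d - 1)"
      by (intro fam.sol_carrier pd pd' dir_carrier)+
    have "dir \<tau> \<bullet> ?k = w * (?e \<bullet> ?k') * (?e \<bullet> ?k) + (\<Sum>\<sigma>\<in>?I. ?c \<sigma> * (dir \<sigma> \<bullet> ?k') * (dir \<sigma> \<bullet> ?k))"
      unfolding fam.scalar_sol[OF pd' dir_carrier k(1), of \<tau>] split w_def ..
    also have "(\<Sum>\<sigma>\<in>?I. ?c \<sigma> * (dir \<sigma> \<bullet> ?k') * (dir \<sigma> \<bullet> ?k)) = dir \<tau> \<bullet> ?k'"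
      unfolding fam.scalar_sol[OF pd dir_carrier k(2), of \<tau>] by (simp add: mult_ac)
    also have "?e \<bullet> ?k' = dir \<tau> \<bullet> y"
      unfolding y_def by (rule fam.sol_symmetric[OF pd' dir_carrier dir_carrier])
    also have "?e \<bullet> ?k = dir \<tau> \<bullet> z"
      unfolding z_def by (rule fam.sol_symmetric[OF pd dir_carrier dir_carrier])
    finally show ?thesis
      unfolding qn_pi_eq[OF v m'] qn_pi_eq[OF v m] fam.lev_def by (simp add: algebra_simps)
  qed
  show "pi_w (Suc m) v \<tau> \<le> pi_w m v \<tau>" if t: "\<tau> \<in> ?I" for \<tau>
  proof -
    have "0 \<le> ?c \<tau> * ((1 + p) * (dir \<tau> \<bullet> y)\<^sup>2)" using fam.pos_defD[OF pd t] p0 by simp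
    also have "\<dots> = ?c \<tau> * (dir \<tau> \<bullet> z) * (dir \<tau> \<bullet> y)" unfolding zy by (simp add: power2_eq_square mult_ac)
    finally show ?thesis using drop[of \<tau>] mult_nonneg_nonneg[OF less_imp_le[OF w]] by fastforce
  qed
  have "(\<Sum>\<tau>\<in>?I. pi_w m v \<tau> - pi_w (Suc m) v \<tau>) = w * (\<Sum>\<tau>\<in>?I. ?c \<tau> * (dir \<tau> \<bullet> z) * (dir \<tau> \<bullet> y))"
    unfolding drop sum_distrib_left ..
  also have "\<dots> = w * (?e \<bullet> y)"
    unfolding fam.scalar_sol[OF pd dir_carrier c(1), of "int (Suc m)"] z_def ..
  also have "\<dots> = new_pi m v" unfolding new_pi_def qn_pi_eq[OF v m] fam.lev_def y_def w_def ..
  finally show "(\<Sum>\<tau>\<in>idx_plus d m. pi_w m v \<tau> - pi_w (Suc m) v \<tau>) = new_pi m v" .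
qed

lemma new_pi_bounds:
  assumes v: "v \<in> interior" and m: "Suc m \<le> T"
  shows "0 \<le> new_pi m v" "new_pi m v \<le> 1 / lam"
  using pi_nonneg[OF v m, of "int (Suc m)"] pi_le[OF v m, of "int (Suc m)"] new_weight[of m]
  unfolding new_pi_def idx_plus_Suc(1) by auto

text \<open>
The gradient jumps by \<open>1 + \<mu>\<pi>\<close> times the gradient of the new loss, of dual norm \<open>\<surd>\<pi>\<close>, minus \<open>\<mu>\<close> times
the old loss gradients weighted with the drops of their leverage scores, which add up to \<open>\<pi>\<close> by
\<open>leverage_drop\<close>.  As \<open>\<pi> \<le> 1/\<lambda>\<close>, each of the two terms
with \<open>\<mu>\<close> is at most \<open>(\<mu>/\<lambda>) \<surd>\<pi>\<close>.
\<close>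
lemma grad_Suc_dual:
  assumes v: "v \<in> interior" and m: "Suc m \<le> T" and h: "h \<in> carrier_vec (d - 1)"
    and old: "\<bar>grad m v h\<bar> \<le> b * sqrt (qform m (wt lam) v h)" and b: "0 \<le> b"
  shows "\<bar>grad (Suc m) v h\<bar> \<le> ((1 + 2 * mu / lam) * sqrt (new_pi m v) + b) * sqrt (qform (Suc m) (wt lam) v h)"
proof -
  let ?I = "idx_plus d m" and ?n = "int (Suc m)"
  define q where "q = sqrt (qform (Suc m) (wt lam) v h)"
  define P where "P = new_pi m v"
  have m': "m \<le> T" using m by simp
  have mem: "?n \<in> idx_plus d (Suc m)" by (simp add: idx_plus_Suc(1))
  have sub: "\<tau> \<in> idx_plus d (Suc m)" if "\<tau> \<in> ?I" for \<tau> using that by (simp add: idx_plus_Suc(1))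
  have split: "(\<Sum>\<tau>\<in>idx_plus d (Suc m). f \<tau>) = f ?n + (\<Sum>\<tau>\<in>?I. f \<tau>)" for f :: "int \<Rightarrow> real"
    unfolding idx_plus_Suc(1) using idx_plus_Suc(2) by simp
  have P: "0 \<le> P" "P \<le> 1 / lam" unfolding P_def using new_pi_bounds[OF v m] by auto
  have q0: "0 \<le> q" unfolding q_def using wt_pos by (intro real_sqrt_ge_zero qform_nonneg) (auto intro: less_imp_le)
  have rel_le: "\<bar>rel v \<tau> h\<bar> \<le> q / sqrt lam" if "\<tau> \<in> ?I" for \<tau>
    using rel_bound[OF v h m sub[OF that]] by (simp add: q_def real_sqrt_divide)
  have "qform m (wt lam) v h \<le> qform (Suc m) (wt lam) v h"
    unfolding qform_def split using wt_pos by (simp add: less_imp_le)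
  then have "sqrt (qform m (wt lam) v h) \<le> q" unfolding q_def by simp
  then have "b * sqrt (qform m (wt lam) v h) \<le> b * q" using b by (rule mult_left_mono)
  then have old': "\<bar>grad m v h\<bar> \<le> b * q" using old by linarith
  have new: "\<bar>rel v ?n h\<bar> \<le> sqrt P * q"
  proof -
    have pd: "fam.pos_def (Suc m) (hw v)" by (rule pos_def_hw[OF v m])
    have "\<bar>dir ?n \<bullet> h\<bar> \<le> sqrt (fam.lev (Suc m) (hw v) ?n) * q"
      using fam.dual_norm_bound[OF pd dir_carrier h, of ?n]
      unfolding fam.lev_def[symmetric] hw_def[abs_def] quad_eq_qform q_def .
    moreover have "sqrt P = sqrt (fam.lev (Suc m) (hw v) ?n) / slack ?n v"
      unfolding P_def new_pi_def qn_pi_eq[OF v m] hw_def[of v ?n] new_weight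
      using slack_pos[OF v m mem] by (simp add: real_sqrt_mult real_sqrt_divide)
    ultimately show ?thesis using slack_pos[OF v m mem] by (simp add: rel_def abs_div divide_right_mono)
  qed
  have "grad (Suc m) v h = (1 + mu * P) * rel v ?n h + (grad m v h - mu * (\<Sum>\<tau>\<in>?I. (pi_w m v \<tau> - pi_w (Suc m) v \<tau>) * rel v \<tau> h))"
  proof -
    have "(\<Sum>\<tau>\<in>?I. (wt lam \<tau> + mu * pi_w (Suc m) v \<tau>) * rel v \<tau> h) =
        grad m v h - mu * (\<Sum>\<tau>\<in>?I. (pi_w m v \<tau> - pi_w (Suc m) v \<tau>) * rel v \<tau> h)"
      unfolding grad_def sum_distrib_left sum_subtractf[symmetric]
      by (intro sum.cong refl) (simp add: algebra_simps)
    then show ?thesis unfolding grad_def[of "Suc m"] split P_def new_pi_def new_weight by simp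
  qed
  moreover have "\<bar>mu * (\<Sum>\<tau>\<in>?I. (pi_w m v \<tau> - pi_w (Suc m) v \<tau>) * rel v \<tau> h)\<bar> \<le> mu * (P * (q / sqrt lam))"
  proof -
    have "\<bar>\<Sum>\<tau>\<in>?I. (pi_w m v \<tau> - pi_w (Suc m) v \<tau>) * rel v \<tau> h\<bar> \<le>
        (\<Sum>\<tau>\<in>?I. \<bar>(pi_w m v \<tau> - pi_w (Suc m) v \<tau>) * rel v \<tau> h\<bar>)" by (rule sum_abs)
    also have "\<dots> \<le> (\<Sum>\<tau>\<in>?I. (pi_w m v \<tau> - pi_w (Suc m) v \<tau>) * (q / sqrt lam))"
      using leverage_drop(1)[OF v m] rel_le by (intro sum_mono) (simp only: abs_mult, intro mult_mono, auto)
    finally have "\<bar>\<Sum>\<tau>\<in>?I. (pi_w m v \<tau> - pi_w (Suc m) v \<tau>) * rel v \<tau> h\<bar> \<le> P * (q / sqrt lam)"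
      unfolding sum_distrib_right[symmetric] leverage_drop(2)[OF v m] P_def .
    then show ?thesis using mu_pos by (simp only: abs_mult abs_of_pos mult_left_mono less_imp_le)
  qed
  moreover have "\<bar>(1 + mu * P) * rel v ?n h\<bar> \<le> (1 + mu * P) * (sqrt P * q)"
    using new P mu_pos by (simp add: abs_mult mult_left_mono)
  ultimately have "\<bar>grad (Suc m) v h\<bar> \<le> (1 + mu * P) * (sqrt P * q) + b * q + mu * (P * (q / sqrt lam))"
    using old' by linarith
  also have "\<dots> \<le> (1 + mu / lam) * (sqrt P * q) + b * q + mu / lam * (sqrt P * q)"
  proof -
    have sP: "sqrt P \<le> 1 / sqrt lam" using real_sqrt_le_mono[OF P(2)] by (simp add: real_sqrt_divide)
    have "1 + mu * P \<le> 1 + mu / lam" using mult_left_mono[OF P(2) less_imp_le[OF mu_pos]] by simp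
    then have "(1 + mu * P) * (sqrt P * q) \<le> (1 + mu / lam) * (sqrt P * q)"
      by (rule mult_right_mono) (use P q0 in simp)
    moreover have "P / sqrt lam = sqrt P * (sqrt P / sqrt lam)" using P by simp
    moreover have "\<dots> \<le> sqrt P * (1 / sqrt lam / sqrt lam)"
      using sP P lam_pos by (intro mult_left_mono divide_right_mono) auto
    moreover have "\<dots> = sqrt P / lam" using lam_pos by simp
    ultimately have *: "P / sqrt lam \<le> sqrt P / lam"
      and **: "(1 + mu * P) * (sqrt P * q) \<le> (1 + mu / lam) * (sqrt P * q)" by linarith+
    have "mu * q * (P / sqrt lam) \<le> mu * q * (sqrt P / lam)"
      using mu_pos q0 by (intro mult_left_mono *) auto
    then have "mu * (P * (q / sqrt lam)) \<le> mu / lam * (sqrt P * q)" by (simp add: mult_ac)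
    with ** show ?thesis by linarith
  qed
  also have "\<dots> = ((1 + 2 * mu / lam) * sqrt P + b) * q" by (simp add: algebra_simps)
  finally show ?thesis unfolding P_def q_def .
qed

text \<open>
Removing the new observation sets one weight to \<open>0\<close>, and by concavity this lowers the logarithm of the
determinant at least by its leverage score.
\<close>
lemma volume_increment:
  assumes v: "v \<in> interior" and m: "Suc m \<le> T"
  shows "- ln (slack (int (Suc m)) v) + mu / 2 * new_pi m v \<le> potential (Suc m) v - potential m v"
proof -
  let ?n = "int (Suc m)" and ?I = "idx_plus d m" and ?I' = "idx_plus d (Suc m)"
  define c where "c \<tau> = (if \<tau> = ?n then 0 else hw v \<tau>)" for \<tau>
  have m': "m \<le> T" using m by simp
  have split: "(\<Sum>\<tau>\<in>?I'. f \<tau>) = f ?n + (\<Sum>\<tau>\<in>?I. f \<tau>)" for f :: "int \<Rightarrow> real"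
    unfolding idx_plus_Suc(1) using idx_plus_Suc(2) by simp
  have c: "c \<tau> = hw v \<tau>" if "\<tau> \<in> ?I" for \<tau> using that idx_plus_Suc(2)[of m d] by (auto simp: c_def)
  have c_new: "c ?n = 0" by (simp add: c_def)
  have gram: "gram (d - 1) ?I' c dir = gram (d - 1) ?I (hw v) dir"
    unfolding gram_def
    by (intro cong_mat refl) (simp add: split c_new c del: of_nat_Suc)
  have quad: "fam.quad (Suc m) c h = fam.quad m (hw v) h" for h
    unfolding fam.quad_def split c_new by (simp add: c del: of_nat_Suc)
  have "fam.pos_def (Suc m) c"
    using pos_def_hw[OF v m'] c c_new unfolding fam.pos_def_def quad by (auto simp: idx_plus_Suc(1) simp del: of_nat_Suc)
  then have "ln (det (gram (d - 1) ?I (hw v) dir)) - ln (det (gram (d - 1) ?I' (hw v) dir))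
      \<le> (\<Sum>\<tau>\<in>?I'. (c \<tau> - hw v \<tau>) * fam.lev (Suc m) (hw v) \<tau>)"
    unfolding gram[symmetric] by (rule fam.ln_det_gram_le[OF pos_def_hw[OF v m]])
  also have "\<dots> = - new_pi m v"
    unfolding split c_new new_pi_def qn_pi_eq[OF v m] by (simp add: c)
  finally have "mu / 2 * new_pi m v \<le>
      mu / 2 * (ln (det (gram (d - 1) ?I' (hw v) dir)) - ln (det (gram (d - 1) ?I (hw v) dir)))"
    using mu_pos by (intro mult_left_mono) auto
  then show ?thesis unfolding potential_def split new_weight by (simp add: algebra_simps)
qed

text \<open>
After a round with final gap \<open>\<gamma>\<close>, the point played is still good for the next potential, and its loss
is paid by the increase of the potential.  The dual norm of the new gradient is at most \<open>a + B\<close>, with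
\<open>a\<close> the jump and \<open>B\<close> the remainder of the old gradient.  The split \<open>(a + B)\<^sup>2 \<le> 3/2 a\<^sup>2 + 3 B\<^sup>2\<close> is
affordable because \<open>15/29 \<cdot> 3/2 \<cdot> 5/8 < 1/2\<close>.
\<close>
lemma round_stability:
  assumes g: "near_min m v \<gamma>" and m: "Suc m \<le> T" and \<gamma>: "0 \<le> \<gamma>" and b: "60 / 29 * (1 + 3 * mu) * \<gamma> \<le> 1 / 10000"
  shows "near_min (Suc m) v (1 / 500)"
    "\<And>u. u \<in> interior \<Longrightarrow> - ln (slack (int (Suc m)) v) \<le>
       potential (Suc m) u - potential m v + 4 * (1 + 3 * mu) * \<gamma>"
proof -
  define B where "B = sqrt ((1 + 3 * mu) * decrement m v)"
  define a where "a = (1 + 2 * mu / lam) * sqrt (new_pi m v)"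
  have m': "m \<le> T" using m by simp
  have v: "v \<in> interior" using g by (simp add: near_min_def)
  have "\<gamma> \<le> (1 + 3 * mu) * \<gamma>" using \<gamma> mu_pos by (simp add: algebra_simps)
  then have "\<gamma> \<le> 1 / 125" using b by linarith
  then have N: "decrement m v \<le> 60 / 29 * \<gamma>" by (rule decrement_le_gap(1)[OF g m'])
  have N0: "0 \<le> decrement m v" by (rule decrement_nonneg[OF v m'])
  have B2: "B\<^sup>2 = (1 + 3 * mu) * decrement m v" unfolding B_def using N0 mu_pos by simp
  also have "\<dots> \<le> (1 + 3 * mu) * (60 / 29 * \<gamma>)" using N mu_pos by (intro mult_left_mono) auto
  finally have B_le: "B\<^sup>2 \<le> 60 / 29 * (1 + 3 * mu) * \<gamma>" by (simp add: mult_ac)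
  have B0: "0 \<le> B" using N0 mu_pos by (simp add: B_def)
  have B_small: "B \<le> 1 / 100"
    using B_le b by (intro power2_le_imp_le[of B "1 / 100"]) (simp_all add: power_divide)
  note P = new_pi_bounds[OF v m]
  have a0: "0 \<le> a" using P mu_pos lam_pos by (simp add: a_def)
  have a2: "a\<^sup>2 = (1 + 2 * mu / lam)\<^sup>2 * new_pi m v" using P by (simp add: a_def power_mult_distrib)
  have "a\<^sup>2 \<le> (1 + 2 * mu / lam)\<^sup>2 * (1 / lam)" unfolding a2 using P by (intro mult_left_mono) auto
  also have "\<dots> = (1 + 2 * mu / lam)\<^sup>2 / lam" by simp
  also have "\<dots> \<le> 1 / 550" by (rule cond)
  finally have a_sq: "a\<^sup>2 \<le> 1 / 550" .
  have a_mu: "a\<^sup>2 \<le> 5 / 8 * mu * new_pi m v" unfolding a2 using cond' P by (intro mult_right_mono) auto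
  have a_small: "a \<le> 1 / 20"
    using a_sq by (intro power2_le_imp_le[of a "1 / 20"]) (simp_all add: power_divide)
  have gap: "potential (Suc m) v - potential (Suc m) u \<le> 15 / 29 * (a + B)\<^sup>2" if u: "u \<in> interior" for u
  proof (rule potential_gap[OF v u m, where W = "wt lam"])
    show "a + B \<le> 29 / 60 * (sqrt lam / 50)" using a_small B_small sqrt_lam_ge by simp
    show "\<bar>grad (Suc m) v h\<bar> \<le> (a + B) * sqrt (qform (Suc m) (wt lam) v h)" if h: "h \<in> carrier_vec (d - 1)" for h
      unfolding a_def
    proof (rule grad_Suc_dual[OF v m h _ B0])
      show "\<bar>grad m v h\<bar> \<le> B * sqrt (qform m (wt lam) v h)"
        unfolding B_def
      proof (rule grad_dual_scaled[OF v m' h])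
        fix \<tau> assume t: "\<tau> \<in> idx_plus d m"
        have "pi_w m v \<tau> \<le> wt lam \<tau> * 1"
          using pi_le[OF v m' t] mult_left_mono[of "1 / lam" 1 "wt lam \<tau>"] wt_pos[of \<tau>] lam_ge by simp
        then show "mw m v \<tau> \<le> (1 + 3 * mu) * wt lam \<tau>"
          using mu_pos mult_left_mono[of "pi_w m v \<tau>" "wt lam \<tau>" "3 * mu"] by (simp add: mw_def algebra_simps)
      qed (use mu_pos in simp)
    qed
  qed (use a0 B0 pi_nonneg[OF v m] mu_pos in auto)
  have "0 \<le> (a - 2 * B)\<^sup>2" by simp
  then have ab: "(a + B)\<^sup>2 \<le> 3 / 2 * a\<^sup>2 + 3 * B\<^sup>2" by (simp add: power2_eq_square algebra_simps)
  show "near_min (Suc m) v (1 / 500)"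
    unfolding near_min_def
  proof (intro conjI ballI v)
    fix u assume "u \<in> interior"
    from gap[OF this] show "potential (Suc m) v \<le> potential (Suc m) u + 1 / 500"
      using ab a_sq B_le b by simp
  qed
  show "- ln (slack (int (Suc m)) v) \<le> potential (Suc m) u - potential m v + 4 * (1 + 3 * mu) * \<gamma>"
    if u: "u \<in> interior" for u
  proof -
    have "15 / 29 * (a + B)\<^sup>2 \<le> 15 / 29 * (3 / 2 * (5 / 8 * mu * new_pi m v) + 3 * (60 / 29 * (1 + 3 * mu) * \<gamma>))"
      using ab a_mu B_le by simp
    also have "\<dots> = 225 / 464 * (mu * new_pi m v) + 2700 / 841 * ((1 + 3 * mu) * \<gamma>)"
      by (simp add: algebra_simps)
    also have "\<dots> \<le> 1 / 2 * (mu * new_pi m v) + 4 * ((1 + 3 * mu) * \<gamma>)"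
      using P(1) \<gamma> mu_pos by (intro add_mono mult_right_mono) auto
    also have "\<dots> = mu / 2 * new_pi m v + 4 * (1 + 3 * mu) * \<gamma>" by (simp add: algebra_simps)
    finally have "15 / 29 * (a + B)\<^sup>2 \<le> mu / 2 * new_pi m v + 4 * (1 + 3 * mu) * \<gamma>" .
    then show ?thesis using gap[OF u] volume_increment[OF v m] by linarith
  qed
qed

section \<open>The uniform starting point\<close>

definition center :: "real vec" where
  "center = vec (d - 1) (\<lambda>_. 1 / real d)"

lemma d_pos: "0 < d"
  using d2 by simp

lemma center_carrier [simp]: "center \<in> carrier_vec (d - 1)"
  by (simp add: center_def)

lemma qn_point_center: "qn_point d center = vec d (\<lambda>_. 1 / real d)"
proof -
  have "center = vec (d - 1) (\<lambda>i. vec d (\<lambda>_. 1 / real d) $ i)"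
    by (intro eq_vecI) (auto simp: center_def)
  then show ?thesis using qn_point_coordinates[of "vec d (\<lambda>_. 1 / real d)" d] d_pos by simp
qed

lemma center_interior: "center \<in> interior"
  using d_pos by (simp add: interior_def qn_point_center)

lemma slack_center: "j < d \<Longrightarrow> slack (- int (Suc j)) center = 1 / real d"
  by (simp add: slack_basis qn_point_center del: of_nat_Suc)

lemma hw_center: "j < d \<Longrightarrow> hw center (- int (Suc j)) = lam * (real d)\<^sup>2"
  unfolding hw_def using slack_center d_pos by (simp add: wt_def power_divide)

text \<open>
By symmetry all coordinates have the same leverage.  The vector \<open>y\<close> solves the linear system of \<open>H\<close>
for the right side \<open>dir\<close> of the \<open>j\<close>-th coordinate: its image under \<open>A\<close> is a multiple of the
projection of the \<open>j\<close>-th basis vector to the vectors with coordinate sum \<open>0\<close>.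
\<close>
lemma lev_center:
  assumes j: "j < d"
  shows "fam.lev 0 (hw center) (- int (Suc j)) = (1 - 1 / real d) / (lam * (real d)\<^sup>2)"
proof -
  define \<kappa> where "\<kappa> = lam * (real d)\<^sup>2"
  define y where "y = vec (d - 1) (\<lambda>i. ((if i = j then 1 else 0) - 1 / real d) / \<kappa>)"
  define s where "s = fam.sol 0 (hw center) (dir (- int (Suc j)))"
  have pd: "fam.pos_def 0 (hw center)" by (rule pos_def_hw[OF center_interior le0])
  have \<kappa>: "0 < \<kappa>" using lam_pos d_pos by (simp add: \<kappa>_def)
  have y: "y \<in> carrier_vec (d - 1)" by (simp add: y_def)
  have s: "s \<in> carrier_vec (d - 1)" unfolding s_def by (intro fam.sol_carrier pd dir_carrier)
  have Ay: "(A_mat d *\<^sub>v y) $ i = ((if i = j then 1 else 0) - 1 / real d) / \<kappa>" if i: "i < d" for i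
  proof (cases "i = d - 1")
    case True
    have "(A_mat d *\<^sub>v y) $ i = - (\<Sum>k<d - 1. ((if k = j then 1 else 0) - 1 / real d) / \<kappa>)"
      unfolding True A_mult_last[OF y d_pos] by (simp add: y_def)
    also have "\<dots> = - (((if j < d - 1 then 1 else 0) - (real d - 1) / real d) / \<kappa>)"
      using d_pos by (simp add: sum_divide_distrib[symmetric] sum_subtractf of_nat_diff)
    also have "j < d - 1 \<longleftrightarrow> i \<noteq> j" using True j by auto
    finally show ?thesis using d_pos \<kappa> by (cases "i = j") (auto simp: field_simps)
  next
    case False
    then show ?thesis using A_mult_index[OF y] i by (simp add: y_def)
  qed
  have "dir (- int (Suc j)) \<bullet> y = (\<Sum>\<tau>\<in>idx_plus d 0. hw center \<tau> * (dir \<tau> \<bullet> s) * (dir \<tau> \<bullet> y))"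
    unfolding s_def by (rule fam.scalar_sol[OF pd dir_carrier y])
  also have "\<dots> = (\<Sum>i<d. \<kappa> * (A_mat d *\<^sub>v s) $ i * (((if i = j then 1 else 0) - 1 / real d) / \<kappa>))"
    unfolding sum_idx_plus by (simp add: hw_center dir_basis[OF s] dir_basis[OF y] Ay \<kappa>_def del: of_nat_Suc)
  also have "\<dots> = (\<Sum>i<d. (if i = j then (A_mat d *\<^sub>v s) $ i else 0) - (A_mat d *\<^sub>v s) $ i / real d)"
    using \<kappa> by (intro sum.cong refl) (simp add: field_simps)
  also have "\<dots> = (A_mat d *\<^sub>v s) $ j"
    using j sum_A_mult[OF s d_pos] by (simp add: sum_subtractf sum_divide_distrib[symmetric])
  also have "\<dots> = fam.lev 0 (hw center) (- int (Suc j))"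
    unfolding fam.lev_def s_def[symmetric] by (rule dir_basis[OF s j, symmetric])
  finally show ?thesis unfolding dir_basis[OF y j] Ay[OF j] \<kappa>_def by simp
qed

text \<open>
With equal leverages the gradient at the uniform portfolio is a multiple of the sum of the rows of \<open>A\<close>,
which is \<open>0\<close>.
\<close>
lemma near_min_center: "near_min 0 center 0"
  unfolding near_min_def
proof (intro conjI ballI center_interior)
  fix u assume u: "u \<in> interior"
  define h where "h = u - center"
  have h: "h \<in> carrier_vec (d - 1)" using u by (auto simp: h_def interior_def)
  define K where "K = lam + mu * (1 - 1 / real d)"
  have w: "wt lam (- int (Suc j)) + mu * pi_w 0 center (- int (Suc j)) = K" if j: "j < d" for j
    unfolding qn_pi_eq[OF center_interior le0] hw_center[OF j] lev_center[OF j]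
    using lam_pos d_pos by (simp add: K_def wt_def)
  have r: "rel center (- int (Suc j)) h = - real d * (A_mat d *\<^sub>v h) $ j" if j: "j < d" for j
    unfolding rel_def slack_center[OF j] dir_basis[OF h j] by simp
  have "(\<Sum>j<d. (wt lam (- int (Suc j)) + mu * pi_w 0 center (- int (Suc j))) * rel center (- int (Suc j)) h)
      = - (K * real d) * (\<Sum>j<d. (A_mat d *\<^sub>v h) $ j)"
    unfolding sum_distrib_left by (intro sum.cong refl) (simp add: w r del: of_nat_Suc)
  then have "0 = grad 0 center h"
    unfolding grad_def sum_idx_plus using sum_A_mult[OF h d_pos] by simp
  also have "\<dots> \<le> (\<Sum>\<tau>\<in>idx_plus d 0. (wt lam \<tau> + mu * pi_w 0 center \<tau>) * - ln (1 - rel center \<tau> h))"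
    unfolding grad_def
  proof (intro sum_mono mult_left_mono neg_ln_ge)
    fix \<tau> assume t: "\<tau> \<in> idx_plus d 0"
    show "rel center \<tau> h < 1" unfolding h_def by (rule rel_lt_1[OF center_interior u le0 t])
    show "0 \<le> wt lam \<tau> + mu * pi_w 0 center \<tau>"
      using wt_pos[of \<tau>] mu_pos pi_nonneg[OF center_interior le0 t] by simp
  qed
  also have "\<dots> \<le> potential 0 u - potential 0 center"
    unfolding h_def by (rule potential_ge[OF center_interior u le0])
  finally show "potential 0 center \<le> potential 0 u + 0" by simp
qed

section \<open>The comparator\<close>

lemma interior_std_simplex:
  assumes v: "v \<in> interior"
  shows "qn_point d v \<in> std_simplex d"
proof -
  have vc: "v \<in> carrier_vec (d - 1)" using v by (simp add: interior_def)
  then show ?thesis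
    using v sum_qn_point[OF vc d_pos] qn_point_carrier[OF vc]
    by (simp add: std_simplex_def interior_def less_imp_le)
qed

lemma slack_observed: "slack (int (Suc m)) v = x (Suc m) \<bullet> qn_point d v"
  by (simp add: slack_def ext_x_def del: of_nat_Suc)

text \<open>
The point \<open>v\<close> represents the mixture of the comparator \<open>u\<close> with the uniform portfolio, of weight \<open>e\<close>.
Each observed loss grows by at most \<open>- ln (1 - e)\<close>.  Concavity of \<open>ln\<close> puts the worst case for the
barrier at a vertex, where one coordinate is large and only the other \<open>d - 1\<close> have the value \<open>e / d\<close>.
The volumetric term is compared with a multiple of the initial Gram matrix.
\<close>
lemma comparator_bound:
  assumes u: "u \<in> std_simplex d" and T1: "1 \<le> T" and pos: "\<And>t. t \<in> {1..T} \<Longrightarrow> 0 < x t \<bullet> u"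
  shows "\<exists>v\<in>interior. potential T v - potential 0 center \<le>
    (\<Sum>t\<in>{1..T}. - ln (x t \<bullet> u)) + (lam + 2 * mu) * ((real d - 1) * ln (real T + lam * real d))"
proof -
  define N where "N = real d - 1"
  define Y where "Y = real T + lam * real d"
  define e where "e = lam * N / (real T + lam * N)"
  define K where "K = (real T + lam) / (lam * e\<^sup>2)"
  define p where "p = vec d (\<lambda>i. (1 - e) * u $ i + e / real d)"
  define v where "v = vec (d - 1) (\<lambda>i. p $ i)"
  have u_carrier: "u \<in> carrier_vec d" and u0: "\<And>i. i < d \<Longrightarrow> 0 \<le> u $ i" and u_sum: "(\<Sum>i<d. u $ i) = 1"
    using u by (auto simp: std_simplex_def)
  have N: "1 \<le> N" "real d = N + 1" using d2 by (auto simp: N_def)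
  have T1': "1 \<le> real T" using T1 by simp
  have Y: "Y = real T + lam * (N + 1)" by (simp add: Y_def N(2))
  note const = comparator_constants[OF lam_ge N(1) T1' Y e_def, folded K_def]
  have e: "0 < e" "e < 1" using const by auto
  have K: "0 < K" unfolding K_def using e lam_pos T1' by (intro divide_pos_pos) auto
  have p_carrier: "p \<in> carrier_vec d" by (simp add: p_def)
  have p_ge: "e / real d \<le> p $ j" if "j < d" for j
    using u0[OF that] e that by (simp add: p_def)
  then have p_pos: "0 < p $ j" if "j < d" for j
    using p_ge[OF that] e d_pos by (auto intro: less_le_trans[of 0 "e / real d"])
  have p_sum: "(\<Sum>j<d. p $ j) = 1"
    using u_sum d_pos by (simp add: p_def sum.distrib sum_distrib_left[symmetric])
  have v: "v \<in> carrier_vec (d - 1)" by (simp add: v_def)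
  have point: "qn_point d v = p" unfolding v_def by (rule qn_point_coordinates[OF p_carrier p_sum d_pos])
  have vi: "v \<in> interior" using v p_pos by (simp add: interior_def point)
  have slack_v: "slack (- int (Suc j)) v = p $ j" if "j < d" for j
    using slack_basis[OF v that] by (simp add: point)
  have observed: "- ln (slack (int t) v) \<le> - ln (x t \<bullet> u) + - ln (1 - e)" if t: "t \<in> {1..T}" for t
  proof -
    have xt: "x t \<in> carrier_vec d" by (rule x_carrier[OF t])
    have "(1 - e) * (x t \<bullet> u) = (\<Sum>j<d. x t $ j * ((1 - e) * u $ j))"
      using u_carrier by (simp add: scalar_prod_def lessThan_atLeast0 sum_distrib_left mult_ac)
    also have "\<dots> \<le> (\<Sum>j<d. x t $ j * p $ j)"
      using x_nonneg[OF t] e by (intro sum_mono mult_left_mono) (auto simp: p_def)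
    also have "\<dots> = slack (int t) v"
      using p_carrier t by (simp add: slack_def ext_x_def point scalar_prod_def lessThan_atLeast0)
    finally have le: "(1 - e) * (x t \<bullet> u) \<le> slack (int t) v" .
    have "0 < (1 - e) * (x t \<bullet> u)" using e pos[OF t] by simp
    then have "ln ((1 - e) * (x t \<bullet> u)) \<le> ln (slack (int t) v)" using le by simp
    then show ?thesis using e pos[OF t] by (simp add: ln_mult)
  qed
  have barrier: "(\<Sum>j<d. - ln (p $ j) - - ln (1 / real d)) \<le> N * - ln e"
  proof -
    have "- ln (p $ j) - - ln (1 / real d) \<le> (1 - u $ j) * - ln e" if j: "j < d" for j
    proof -
      have u1: "u $ j \<le> 1"
        using member_le_sum[of j "{..<d}" "\<lambda>i. u $ i"] u0 j u_sum by simp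
      have "(1 - e) * 1 \<le> (1 - e) * real d" using N e by (intro mult_left_mono) auto
      then have "1 \<le> e + (1 - e) * real d" by (simp only: mult_1_right diff_le_eq add.commute[of e])
      then have "0 \<le> u $ j * ln (e + (1 - e) * real d)" using u0[OF j] by (intro mult_nonneg_nonneg ln_ge_zero)
      then have "(1 - u $ j) * ln e \<le> (1 - u $ j) * ln e + u $ j * ln (e + (1 - e) * real d)" by simp
      also have "\<dots> \<le> ln ((1 - u $ j) * e + u $ j * (e + (1 - e) * real d))"
        using e d_pos u0[OF j] u1 by (intro ln_concave_combination add_pos_pos mult_pos_pos) auto
      also have "(1 - u $ j) * e + u $ j * (e + (1 - e) * real d) = real d * p $ j"
        using j d_pos by (simp add: p_def field_simps)
      also have "ln (real d * p $ j) = ln (p $ j) - ln (1 / real d)"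
        using p_pos[OF j] d_pos by (simp add: ln_mult ln_div)
      finally show ?thesis by simp
    qed
    then have "(\<Sum>j<d. - ln (p $ j) - - ln (1 / real d)) \<le> (\<Sum>j<d. (1 - u $ j) * - ln e)"
      by (intro sum_mono) auto
    also have "\<dots> = N * - ln e"
      unfolding sum_distrib_right[symmetric] by (simp add: sum_subtractf u_sum N_def)
    finally show ?thesis .
  qed
  have volume: "ln (det (gram (d - 1) (idx_plus d T) (hw v) dir)) \<le>
      N * ln K + ln (det (gram (d - 1) (idx_plus d 0) (hw center) dir))"
  proof -
    \<comment> \<open>\<open>K\<close> times the initial Gram matrix, written over the index set of round \<open>T\<close>\<close>
    define c where "c \<tau> = (if \<tau> < 0 then K * hw center \<tau> else 0)" for \<tau>
    have c_basis: "c (- int (Suc j)) = K * (lam * (real d)\<^sup>2)" if "j < d" for j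
      using that by (simp add: c_def hw_center del: of_nat_Suc)
    have c_observed: "c (int t) = 0" for t by (simp add: c_def)
    have quad_c: "fam.quad T c h = K * fam.quad 0 (hw center) h" for h
      unfolding fam.quad_def sum_idx_plus
      by (simp add: c_basis c_observed hw_center sum_distrib_left mult_ac del: of_nat_Suc)
    have pd: "fam.pos_def 0 (hw center)" by (rule pos_def_hw[OF center_interior le0])
    have "0 \<le> c \<tau>" for \<tau> using K lam_pos by (simp add: c_def hw_def wt_def)
    then have pd_c: "fam.pos_def T c"
      using pd K unfolding fam.pos_def_def quad_c by auto
    have "ln (det (gram (d - 1) (idx_plus d T) (hw v) dir)) \<le> ln (det (gram (d - 1) (idx_plus d T) c dir))"
    proof (rule fam.ln_det_gram_mono[OF pd_c pos_def_hw[OF vi order_refl]])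
      fix h :: "real vec" assume h: "h \<in> carrier_vec (d - 1)"
      define Z where "Z = (\<Sum>j<d. (rel v (- int (Suc j)) h)\<^sup>2)"
      define A2 where "A2 = (\<Sum>j<d. ((A_mat d *\<^sub>v h) $ j)\<^sup>2)"
      have Z0: "0 \<le> Z" unfolding Z_def by (simp add: sum_nonneg)
      have basis: "\<bar>rel v (- int (Suc j)) h\<bar> \<le> sqrt Z" if "j < d" for j
        unfolding Z_def
        using member_le_sum[of j "{..<d}" "\<lambda>j. (rel v (- int (Suc j)) h)\<^sup>2"] that
        by (intro real_le_rsqrt) simp
      have "(rel v (int t) h)\<^sup>2 \<le> Z" if t: "t \<in> {1..T}" for t
      proof -
        have "int t \<in> idx_plus d T" using t by (simp add: idx_plus_def)
        from power_mono[OF rel_le_of_basis[OF vi h order_refl this basis], of 2] Z0 show ?thesis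
          by simp
      qed
      then have "(\<Sum>t\<in>{1..T}. wt lam (int t) * (rel v (int t) h)\<^sup>2) \<le> (\<Sum>t\<in>{1..T}. Z)"
        by (intro sum_mono) (simp add: wt_def)
      moreover have "(\<Sum>j<d. wt lam (- int (Suc j)) * (rel v (- int (Suc j)) h)\<^sup>2) = lam * Z"
        unfolding Z_def sum_distrib_left by (intro sum.cong refl) (simp add: wt_def)
      ultimately have "fam.quad T (hw v) h \<le> (real T + lam) * Z"
        unfolding hw_def[abs_def] quad_eq_qform qform_def sum_idx_plus by (simp add: algebra_simps)
      also have "Z \<le> A2 * ((real d)\<^sup>2 / e\<^sup>2)"
        unfolding Z_def A2_def sum_distrib_right
      proof (intro sum_mono)
        fix j assume "j \<in> {..<d}"
        then have j: "j < d" by simp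
        have "1 / p $ j \<le> real d / e" using p_ge[OF j] p_pos[OF j] e d_pos by (simp add: field_simps)
        then have "(1 / p $ j)\<^sup>2 \<le> (real d / e)\<^sup>2" using p_pos[OF j] by (intro power_mono) auto
        then have "((A_mat d *\<^sub>v h) $ j)\<^sup>2 * (1 / p $ j)\<^sup>2 \<le> ((A_mat d *\<^sub>v h) $ j)\<^sup>2 * (real d / e)\<^sup>2"
          by (rule mult_left_mono) simp
        then show "(rel v (- int (Suc j)) h)\<^sup>2 \<le> ((A_mat d *\<^sub>v h) $ j)\<^sup>2 * ((real d)\<^sup>2 / e\<^sup>2)"
          unfolding rel_def slack_v[OF j] dir_basis[OF h j] by (simp add: power_divide)
      qed
      also have "(real T + lam) * (A2 * ((real d)\<^sup>2 / e\<^sup>2)) = fam.quad T c h"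
        unfolding fam.quad_def sum_idx_plus A2_def
        using lam_pos by (simp add: c_basis c_observed dir_basis[OF h] K_def sum_distrib_left sum_distrib_right mult_ac del: of_nat_Suc)
      finally show "fam.quad T (hw v) h \<le> fam.quad T c h" using lam_pos by simp
    qed
    also have "gram (d - 1) (idx_plus d T) c dir = gram (d - 1) (idx_plus d 0) (\<lambda>\<tau>. K * hw center \<tau>) dir"
      unfolding gram_def sum_idx_plus
      by (intro cong_mat refl) (simp add: c_basis c_observed hw_center del: of_nat_Suc)
    also have "ln (det \<dots>) = ln (K ^ (d - 1) * det (gram (d - 1) (idx_plus d 0) (hw center) dir))"
      unfolding gram_scaled det_smult by (simp add: gram_def)
    also have "\<dots> = N * ln K + ln (det (gram (d - 1) (idx_plus d 0) (hw center) dir))"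
      using K fam.det_gram_pos[OF pd] d_pos by (simp add: ln_mult ln_realpow N_def of_nat_diff)
    finally show ?thesis .
  qed
  have "potential T v - potential 0 center = (\<Sum>t\<in>{1..T}. - ln (slack (int t) v)) +
      lam * (\<Sum>j<d. - ln (p $ j) - - ln (1 / real d)) +
      mu / 2 * (ln (det (gram (d - 1) (idx_plus d T) (hw v) dir)) - ln (det (gram (d - 1) (idx_plus d 0) (hw center) dir)))"
    unfolding potential_def sum_idx_plus
    by (simp add: wt_def slack_v slack_center sum_subtractf sum_negf sum_distrib_left[symmetric] algebra_simps del: of_nat_Suc)
  also have "\<dots> \<le> ((\<Sum>t\<in>{1..T}. - ln (x t \<bullet> u)) + real T * - ln (1 - e)) + lam * (N * - ln e) + mu / 2 * (N * ln K)"
  proof (intro add_mono mult_left_mono)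
    have "(\<Sum>t\<in>{1..T}. - ln (slack (int t) v)) \<le> (\<Sum>t\<in>{1..T}. - ln (x t \<bullet> u) + - ln (1 - e))"
      by (intro sum_mono observed)
    then show "(\<Sum>t\<in>{1..T}. - ln (slack (int t) v)) \<le> (\<Sum>t\<in>{1..T}. - ln (x t \<bullet> u)) + real T * - ln (1 - e)"
      by (simp only: sum.distrib sum_constant card_atLeastAtMost) simp
  qed (use barrier volume lam_pos mu_pos in auto)
  also have "\<dots> \<le> ((\<Sum>t\<in>{1..T}. - ln (x t \<bullet> u)) + lam * N) + lam * (N * (ln Y - 1)) + mu / 2 * (N * (3 * ln Y))"
    using const(3-5) N lam_pos mu_pos by (intro add_mono mult_left_mono order_refl) auto
  also have "\<dots> = (\<Sum>t\<in>{1..T}. - ln (x t \<bullet> u)) + lam * (N * ln Y) + 3 / 2 * mu * (N * ln Y)"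
    by (simp add: algebra_simps)
  also have "\<dots> \<le> (\<Sum>t\<in>{1..T}. - ln (x t \<bullet> u)) + (lam + 2 * mu) * (N * ln Y)"
  proof -
    have "0 \<le> mu * (N * ln Y)" using const(6) N mu_pos by simp
    then show ?thesis by (simp add: algebra_simps)
  qed
  finally show ?thesis using vi unfolding N_def Y_def by blast
qed

end

section \<open>The run and its regret\<close>

text \<open>
Comparators with a vanishing inner product have infinite loss, so only the others matter.
\<close>
lemma regret_le_of_losses:
  assumes play: "\<And>t. t \<in> {1..T} \<Longrightarrow> 0 < x t \<bullet> w t"
    and le: "\<And>u. u \<in> std_simplex d \<Longrightarrow> (\<And>t. t \<in> {1..T} \<Longrightarrow> 0 < x t \<bullet> u) \<Longrightarrow>
      (\<Sum>t\<in>{1..T}. - ln (x t \<bullet> w t)) \<le> (\<Sum>t\<in>{1..T}. - ln (x t \<bullet> u)) + B"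
  shows "regret d T x w \<le> ereal B"
proof -
  have finite_loss: "cum_loss T x w' = ereal (\<Sum>t\<in>{1..T}. - ln (x t \<bullet> w' t))"
    if "\<And>t. t \<in> {1..T} \<Longrightarrow> 0 < x t \<bullet> w' t" for w'
    unfolding cum_loss_def neg_log_def by (subst sum_ereal[symmetric]) (intro sum.cong refl, simp add: that)
  define L where "L = (\<Sum>t\<in>{1..T}. - ln (x t \<bullet> w t))"
  have "ereal (L - B) \<le> cum_loss T x (\<lambda>t. u)" if u: "u \<in> std_simplex d" for u
  proof (cases "\<forall>t\<in>{1..T}. 0 < x t \<bullet> u")
    case True
    then show ?thesis using finite_loss[of "\<lambda>t. u"] le[OF u] by (simp add: L_def)
  next
    case False
    then obtain t where "t \<in> {1..T}" "neg_log (x t \<bullet> u) = \<infinity>" by (auto simp: neg_log_def)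
    then have "cum_loss T x (\<lambda>t. u) = \<infinity>" unfolding cum_loss_def by (auto simp: sum_Pinfty)
    then show ?thesis by simp
  qed
  then have "ereal (L - B) \<le> (INF u\<in>std_simplex d. cum_loss T x (\<lambda>t. u))" by (rule INF_greatest)
  then have "ereal L - (INF u\<in>std_simplex d. cum_loss T x (\<lambda>t. u)) \<le> ereal L - ereal (L - B)"
    by (rule ereal_minus_mono[OF order_refl])
  moreover have "cum_loss T x w = ereal L" unfolding L_def by (rule finite_loss) (rule play)
  ultimately have "regret d T x w \<le> ereal L - ereal (L - B)" unfolding regret_def by simp
  then show ?thesis by simp
qed

context portfolio
begin

text \<open>
The run in the coordinates of the affine parametrisation.
\<close>
primrec iterate :: "nat \<Rightarrow> nat \<Rightarrow> real vec" where
  "iterate S 0 = center"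
| "iterate S (Suc n) = (qn_step d lam mu x n ^^ S) (iterate S n)"

text \<open>
The first assumption makes the final gap of a round small enough for the next round to start from it,
the second one keeps the sum of the errors of all rounds bounded.
\<close>
context
  fixes S :: nat
  assumes S_mu: "(1 + 3 * mu) * (3 / 4) ^ S \<le> 1 / 50" and S_T: "real T * (3 / 4) ^ S \<le> 1"
begin

lemma final_gap_small: "60 / 29 * (1 + 3 * mu) * ((3 / 4) ^ S / 500) \<le> 1 / 10000"
proof -
  have "60 / 29 * (1 + 3 * mu) * ((3 / 4) ^ S / 500) = 60 / 29 / 500 * ((1 + 3 * mu) * (3 / 4) ^ S)"
    by simp
  also have "\<dots> \<le> 60 / 29 / 500 * (1 / 50)" by (rule mult_left_mono[OF S_mu]) simp
  finally show ?thesis by simp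
qed

lemma iterate_near_min: "n \<le> T \<Longrightarrow> near_min n (iterate S n) (1 / 500)"
proof (induction n)
  case 0
  show ?case using near_min_center by (auto simp: near_min_def)
next
  case (Suc n)
  then have "near_min n (iterate S (Suc n)) ((3 / 4) ^ S / 500)"
    using newton_iterates[of n "iterate S n" "1 / 500" S] by simp
  then show ?case by (rule round_stability(1)[OF _ Suc.prems _ final_gap_small]) simp
qed

lemma iterate_near_min_played: "n < T \<Longrightarrow> near_min n (iterate S (Suc n)) ((3 / 4) ^ S / 500)"
  using newton_iterates[OF iterate_near_min[of n], of S] by simp

lemma iterate_interior: "n \<le> T \<Longrightarrow> iterate S n \<in> interior"
  using iterate_near_min by (simp add: near_min_def)

lemma vb_ftrl_qn_eq: "n \<le> T \<Longrightarrow> vb_ftrl_qn d lam mu S x n = qn_point d (iterate S n)"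
proof (induction n)
  case 0
  show ?case by (simp add: qn_point_center)
next
  case (Suc n)
  then have "iterate S n \<in> carrier_vec (d - 1)" using iterate_interior[of n] by (simp add: interior_def)
  then show ?case using Suc d2 by (simp add: qn_iter_from_point)
qed

lemma run_well_defined: "well_defined_run d lam mu S x T"
proof -
  have "invertible_mat (transpose_mat (A_mat d) * A_mat d)"
    by (rule inverse_of_det_nonzero(4)[OF _ A_gram_det_nonzero]) (rule mult_carrier_mat[OF transpose_carrier_mat[THEN iffD2, OF A_mat_carrier] A_mat_carrier])
  moreover have "qn_iter d lam mu x n (vb_ftrl_qn d lam mu S x n) s \<in> interior" if n: "n < T" for n s
  proof -
    have "iterate S n \<in> carrier_vec (d - 1)" using iterate_interior[of n] n by (simp add: interior_def)
    then have "qn_iter d lam mu x n (vb_ftrl_qn d lam mu S x n) s = (qn_step d lam mu x n ^^ s) (iterate S n)"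
      using n by (simp add: vb_ftrl_qn_eq qn_iter_from_point)
    then show ?thesis using newton_iterates[OF iterate_near_min[of n], of s] n by (simp add: near_min_def)
  qed
  ultimately show ?thesis
    unfolding well_defined_run_def Let_def using legitimate_step by (metis less_imp_le)
qed

lemma plays_in_simplex: "t \<in> {1..T} \<Longrightarrow> vb_ftrl_qn d lam mu S x t \<in> std_simplex d"
  by (simp add: vb_ftrl_qn_eq interior_std_simplex iterate_interior)

text \<open>
The loss of round \<open>n + 1\<close> is bounded by the increase of the potential from the point played to the next
point played, and after the last round to \<open>v\<close>, up to an error proportional to the final gap of a round.
The errors add up to at most \<open>lam + 2 * mu\<close>.
\<close>
lemma cumulative_loss_bound:
  assumes v: "v \<in> interior" and T1: "1 \<le> T"
  shows "(\<Sum>t\<in>{1..T}. - ln (x t \<bullet> vb_ftrl_qn d lam mu S x t)) \<le>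
    potential T v - potential 0 center + (lam + 2 * mu)"
proof -
  define err where "err = 4 * (1 + 3 * mu) * ((3 / 4) ^ S / 500)"
  \<comment> \<open>the point played next, and the comparison point \<open>v\<close> after the last round\<close>
  define r where "r n = (if n = T then v else iterate S (Suc n))" for n
  have r: "r n \<in> interior" if "n \<le> T" for n
    using v iterate_interior[of "Suc n"] that by (simp add: r_def)
  have "n \<le> T \<Longrightarrow> (\<Sum>t\<in>{1..n}. - ln (x t \<bullet> vb_ftrl_qn d lam mu S x t)) \<le>
    potential n (r n) - potential 0 (r 0) + real n * err" for n
  proof (induction n)
    case 0
    show ?case by simp
  next
    case (Suc n)
    have "- ln (x (Suc n) \<bullet> vb_ftrl_qn d lam mu S x (Suc n)) \<le>
        potential (Suc n) (r (Suc n)) - potential n (iterate S (Suc n)) + err"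
      unfolding vb_ftrl_qn_eq[OF Suc.prems] slack_observed[symmetric] err_def
      by (rule round_stability(2)[OF iterate_near_min_played Suc.prems _ final_gap_small]) (use Suc.prems r in auto)
    moreover have "r n = iterate S (Suc n)" using Suc.prems by (simp add: r_def)
    ultimately show ?case using Suc by (simp add: algebra_simps)
  qed
  from this[of T] have "(\<Sum>t\<in>{1..T}. - ln (x t \<bullet> vb_ftrl_qn d lam mu S x t)) \<le>
    potential T v - potential 0 (r 0) + real T * err" by (simp add: r_def)
  moreover have "potential 0 center \<le> potential 0 (r 0)"
    using near_min_center r[of 0] by (simp add: near_min_def)
  moreover have "real T * err \<le> lam + 2 * mu"
  proof -
    have "real T * err = (4 / 500 * (1 + 3 * mu)) * (real T * (3 / 4) ^ S)" by (simp add: err_def)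
    also have "\<dots> \<le> (4 / 500 * (1 + 3 * mu)) * 1" using mu_pos S_T by (intro mult_left_mono) auto
    also have "\<dots> \<le> lam + 2 * mu" using lam_ge mu_pos by simp
    finally show ?thesis .
  qed
  ultimately show ?thesis by linarith
qed

lemma regret_bound:
  assumes T1: "1 \<le> T"
  shows "regret d T x (vb_ftrl_qn d lam mu S x) \<le>
    ereal ((lam + 2 * mu) * ((real d - 1) * ln (real T + lam * real d) + 1))"
proof (rule regret_le_of_losses)
  fix t assume t: "t \<in> {1..T}"
  then obtain n where n: "t = Suc n" by (cases t) auto
  have tT: "t \<le> T" and "int t \<in> idx_plus d T" using t by (simp_all add: idx_plus_def)
  then have "0 < slack (int t) (iterate S t)" by (intro slack_pos[OF iterate_interior order_refl])
  then show "0 < x t \<bullet> vb_ftrl_qn d lam mu S x t"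
    unfolding vb_ftrl_qn_eq[OF tT] unfolding n slack_observed .
next
  fix u assume "u \<in> std_simplex d" "\<And>t. t \<in> {1..T} \<Longrightarrow> 0 < x t \<bullet> u"
  then obtain v where "v \<in> interior" "potential T v - potential 0 center \<le>
    (\<Sum>t\<in>{1..T}. - ln (x t \<bullet> u)) + (lam + 2 * mu) * ((real d - 1) * ln (real T + lam * real d))"
    using comparator_bound[OF _ T1] by blast
  then show "(\<Sum>t\<in>{1..T}. - ln (x t \<bullet> vb_ftrl_qn d lam mu S x t)) \<le> (\<Sum>t\<in>{1..T}. - ln (x t \<bullet> u)) +
      (lam + 2 * mu) * ((real d - 1) * ln (real T + lam * real d) + 1)"
    using cumulative_loss_bound[OF _ T1, of v] by (simp add: distrib_left)
qed

end

end

lemma one_asset_guarantee: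
  fixes x :: "nat \<Rightarrow> real vec"
  assumes x: "\<And>t. t \<in> {1..T} \<Longrightarrow> x t \<in> carrier_vec 1" "\<And>t i. t \<in> {1..T} \<Longrightarrow> i < 1 \<Longrightarrow> 0 \<le> x t $ i"
    "\<And>t. t \<in> {1..T} \<Longrightarrow> x t \<noteq> 0\<^sub>v 1" and B: "0 \<le> B"
  shows "well_defined_run 1 lam mu S x T \<and> (\<forall>t\<in>{1..T}. vb_ftrl_qn 1 lam mu S x t \<in> std_simplex 1) \<and>
    regret 1 T x (vb_ftrl_qn 1 lam mu S x) \<le> ereal B"
proof (intro conjI ballI)
  have play: "vb_ftrl_qn 1 lam mu S x t = vec 1 (\<lambda>_. 1)" if "t \<in> {1..T}" for t
    using that by (cases t) auto
  have simplex: "u = vec 1 (\<lambda>_. 1)" if "u \<in> std_simplex 1" for u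
    using that by (intro eq_vecI) (auto simp: std_simplex_def One_nat_def)
  show "well_defined_run 1 lam mu S x T" by (simp add: well_defined_run_def)
  show "vb_ftrl_qn 1 lam mu S x t \<in> std_simplex 1" if "t \<in> {1..T}" for t
    unfolding play[OF that] by (simp add: std_simplex_def One_nat_def)
  show "regret 1 T x (vb_ftrl_qn 1 lam mu S x) \<le> ereal B"
  proof (rule regret_le_of_losses)
    fix t assume t: "t \<in> {1..T}"
    have "x t $ 0 \<noteq> 0" using x(1,3)[OF t] by (auto simp: vec_eq_iff)
    then have "0 < x t $ 0" using x(2)[OF t, of 0] by simp
    then show "0 < x t \<bullet> vb_ftrl_qn 1 lam mu S x t"
      unfolding play[OF t] by (simp add: scalar_prod_def One_nat_def)
  next
    fix u assume "u \<in> std_simplex 1"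
    then have u: "u = vec 1 (\<lambda>_. 1)" by (rule simplex)
    have "(\<Sum>t\<in>{1..T}. - ln (x t \<bullet> vb_ftrl_qn 1 lam mu S x t)) = (\<Sum>t\<in>{1..T}. - ln (x t \<bullet> u))"
      unfolding u by (intro sum.cong refl) (simp only: play)
    then show "(\<Sum>t\<in>{1..T}. - ln (x t \<bullet> vb_ftrl_qn 1 lam mu S x t)) \<le> (\<Sum>t\<in>{1..T}. - ln (x t \<bullet> u)) + B"
      using B by simp
  qed
qed

lemma vb_ftrl_qn_guarantee:
  fixes x :: "nat \<Rightarrow> real vec"
  assumes d: "1 \<le> d" and T: "1 \<le> T"
    and x: "\<And>t. t \<in> {1..T} \<Longrightarrow> x t \<in> carrier_vec d" "\<And>t i. t \<in> {1..T} \<Longrightarrow> i < d \<Longrightarrow> 0 \<le> x t $ i"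
      "\<And>t. t \<in> {1..T} \<Longrightarrow> x t \<noteq> 0\<^sub>v d"
    and pos: "0 < lam" "0 < mu"
    and cond: "(1 + 2 * mu / lam)\<^sup>2 / lam \<le> 1 / 550" "(1 + 2 * mu / lam)\<^sup>2 \<le> 5 / 8 * mu"
    and S: "9 * ln (2 * max ((real T + real d + 1)\<^sup>2) (10 ^ 4 * sqrt (1 + 3 * mu))) \<le> real S"
  shows "well_defined_run d lam mu S x T \<and> (\<forall>t\<in>{1..T}. vb_ftrl_qn d lam mu S x t \<in> std_simplex d) \<and>
    regret d T x (vb_ftrl_qn d lam mu S x) \<le> ereal ((lam + 2 * mu) * ((real d - 1) * ln (real T + lam * real d) + 1))"
proof (cases "d = 1")
  case True
  show ?thesis unfolding True
    by (rule one_asset_guarantee[OF x[unfolded True]]) (use pos in simp_all)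
next
  case False
  interpret portfolio d T x lam mu
    using d False x pos cond by unfold_locales auto
  define X where "X = 2 * max ((real T + real d + 1)\<^sup>2) (10 ^ 4 * sqrt (1 + 3 * mu))"
  have X1: "2 * (real T + real d + 1)\<^sup>2 \<le> X" and X2: "2 * (10 ^ 4 * sqrt (1 + 3 * mu)) \<le> X"
    by (simp_all add: X_def)
  have sq: "real T \<le> (real T + real d + 1)\<^sup>2"
    using self_le_power[of "real T + real d + 1" 2] by simp
  then have X: "1 \<le> X" "real T \<le> X" using X1 T by auto
  have power: "(3 / 4) ^ S \<le> 1 / X\<^sup>2" by (rule three_quarters_power_le) (use X S in \<open>auto simp: X_def\<close>)
  have "X \<le> X\<^sup>2" using X by (intro self_le_power) auto
  then have "real T \<le> X\<^sup>2" using X by linarith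
  then have "real T * (1 / X\<^sup>2) \<le> 1" using X by (simp add: divide_le_eq)
  then have S_T: "real T * (3 / 4) ^ S \<le> 1"
    using mult_left_mono[OF power, of "real T"] by simp
  have "(2 * (10 ^ 4 * sqrt (1 + 3 * mu)))\<^sup>2 \<le> X\<^sup>2" using X2 pos by (intro power_mono) auto
  then have "50 * (1 + 3 * mu) \<le> X\<^sup>2" using pos by (simp add: power_mult_distrib)
  then have "(1 + 3 * mu) * (1 / X\<^sup>2) \<le> 1 / 50" using X by (simp add: field_simps)
  then have S_mu: "(1 + 3 * mu) * (3 / 4) ^ S \<le> 1 / 50"
    using mult_left_mono[OF power, of "1 + 3 * mu"] pos by linarith
  show ?thesis
    using run_well_defined[OF S_mu S_T] plays_in_simplex[OF S_mu S_T] regret_bound[OF S_mu S_T T] by blast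
qed

text \<open>
The number \<open>164\<close> makes the square of the argument of \<open>ln\<close> exceed \<open>10\<^sup>4 \<surd>7 < 165\<^sup>2\<close>, so that
\<open>18 ln\<close> covers both terms of the maximum; the \<open>7\<close> covers \<open>9 ln 2\<close>.
\<close>
lemma default_steps_suffice:
  assumes "1 \<le> d"
  shows "9 * ln (2 * max ((real T + real d + 1)\<^sup>2) (10 ^ 4 * sqrt (1 + 3 * 2)))
    \<le> real (18 * nat \<lceil>ln (real T + real d + 164)\<rceil> + 7)"
proof -
  define Z where "Z = real T + real d + 164"
  have Z: "1 \<le> Z" by (simp add: Z_def)
  have "(real T + real d + 1)\<^sup>2 \<le> Z\<^sup>2" unfolding Z_def by (intro power_mono) auto
  moreover have "10 ^ 4 * sqrt (1 + 3 * 2) \<le> Z\<^sup>2"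
  proof -
    have "sqrt (1 + 3 * 2) \<le> (269 / 100 :: real)" by (rule real_le_lsqrt) (simp_all add: power2_eq_square)
    then have "10 ^ 4 * sqrt (1 + 3 * 2) \<le> (165 :: real)\<^sup>2" by simp
    also have "\<dots> \<le> Z\<^sup>2" unfolding Z_def using assms by (intro power_mono) auto
    finally show ?thesis .
  qed
  moreover have "0 < max ((real T + real d + 1)\<^sup>2) (10 ^ 4 * sqrt (1 + 3 * 2))" by (simp add: less_max_iff_disj)
  ultimately have "ln (2 * max ((real T + real d + 1)\<^sup>2) (10 ^ 4 * sqrt (1 + 3 * 2))) \<le> ln (2 * Z\<^sup>2)"
    by (intro ln_mono) auto
  also have "\<dots> = ln 2 + 2 * ln Z" using Z by (simp add: ln_mult ln_realpow)
  finally have "9 * ln (2 * max ((real T + real d + 1)\<^sup>2) (10 ^ 4 * sqrt (1 + 3 * 2))) \<le> 9 * ln 2 + 18 * ln Z"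
    by simp
  also have "9 * ln 2 \<le> (7 :: real)"
  proof -
    have "(2 :: real) \<le> 1 + 7 / 9 + (7 / 9)\<^sup>2 / 2" by (simp add: power2_eq_square)
    also have "\<dots> \<le> exp (7 / 9)" by (rule exp_lower_Taylor_quadratic) simp
    finally have "ln 2 \<le> ln (exp (7 / 9 :: real))" by (intro ln_mono) auto
    then show ?thesis by simp
  qed
  also have "18 * ln Z \<le> 18 * real (nat \<lceil>ln Z\<rceil>)" by (intro mult_left_mono) (linarith, simp)
  finally show ?thesis by (simp add: Z_def)
qed

theorem theorem4p1:
  fixes d T :: nat and x :: "nat \<Rightarrow> real vec"
  assumes "d \<ge> 1" and "T \<ge> 1"
    and "\<And>t. t \<in> {1..T} \<Longrightarrow> x t \<in> carrier_vec d"
    and "\<And>t i. t \<in> {1..T} \<Longrightarrow> i < d \<Longrightarrow> 0 \<le> x t $ i"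
    and "\<And>t. t \<in> {1..T} \<Longrightarrow> x t \<noteq> 0\<^sub>v d"
  shows
    "(\<forall>(lam::real) (mu::real) (S::nat).
        lam > 0 \<longrightarrow> mu > 0 \<longrightarrow> lam \<ge> 2 * exp 1 \<longrightarrow>
        1 / lam * (1 + 2 * mu / lam)\<^sup>2 \<le> min (1 / 556) (5 * mu / (8 * (1 + lam))) \<longrightarrow>
        real S \<ge> 9 * ln (2 * max ((real T + real d + 1)\<^sup>2) (10 ^ 4 * sqrt (1 + 3 * mu))) \<longrightarrow>
        well_defined_run d lam mu S x T \<and>
        (\<forall>t\<in>{1..T}. vb_ftrl_qn d lam mu S x t \<in> std_simplex d) \<and>
        regret d T x (vb_ftrl_qn d lam mu S x)
          \<le> ereal ((lam + 2 * mu) * ((real d - 1) * ln (real T + lam * real d) + 1)))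
     \<and>
     (let S = 18 * nat \<lceil>ln (real T + real d + 164)\<rceil> + 7 in
        well_defined_run d 560 2 S x T \<and>
        (\<forall>t\<in>{1..T}. vb_ftrl_qn d 560 2 S x t \<in> std_simplex d) \<and>
        regret d T x (vb_ftrl_qn d 560 2 S x)
          \<le> ereal (564 * real d * ln (real T + 560 * real d)))"
proof (intro conjI allI impI)
  fix lam mu :: real and S :: nat
  assume pos: "lam > 0" "mu > 0"
    and cond: "1 / lam * (1 + 2 * mu / lam)\<^sup>2 \<le> min (1 / 556) (5 * mu / (8 * (1 + lam)))"
    and S: "real S \<ge> 9 * ln (2 * max ((real T + real d + 1)\<^sup>2) (10 ^ 4 * sqrt (1 + 3 * mu)))"
  have "(1 + 2 * mu / lam)\<^sup>2 / lam \<le> 1 / 550" using cond by simp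
  moreover have "(1 + 2 * mu / lam)\<^sup>2 \<le> 5 / 8 * mu"
  proof -
    have "lam * (1 / lam * (1 + 2 * mu / lam)\<^sup>2) \<le> lam * (5 * mu / (8 * (1 + lam)))"
      using cond pos by (intro mult_left_mono) auto
    also have "\<dots> \<le> 5 / 8 * mu" using pos by (simp add: field_simps)
    finally show ?thesis using pos by simp
  qed
  ultimately have "well_defined_run d lam mu S x T \<and> (\<forall>t\<in>{1..T}. vb_ftrl_qn d lam mu S x t \<in> std_simplex d) \<and>
    regret d T x (vb_ftrl_qn d lam mu S x) \<le> ereal ((lam + 2 * mu) * ((real d - 1) * ln (real T + lam * real d) + 1))"
    using assms pos S by (intro vb_ftrl_qn_guarantee) auto
  then show "well_defined_run d lam mu S x T"
    "\<forall>t\<in>{1..T}. vb_ftrl_qn d lam mu S x t \<in> std_simplex d"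
    "regret d T x (vb_ftrl_qn d lam mu S x)
       \<le> ereal ((lam + 2 * mu) * ((real d - 1) * ln (real T + lam * real d) + 1))"
    by blast+
next
  define S where "S = 18 * nat \<lceil>ln (real T + real d + 164)\<rceil> + 7"
  have run: "well_defined_run d 560 2 S x T \<and> (\<forall>t\<in>{1..T}. vb_ftrl_qn d 560 2 S x t \<in> std_simplex d) \<and>
    regret d T x (vb_ftrl_qn d 560 2 S x) \<le> ereal ((560 + 2 * 2) * ((real d - 1) * ln (real T + 560 * real d) + 1))"
    unfolding S_def using assms default_steps_suffice[OF assms(1), of T]
    by (intro vb_ftrl_qn_guarantee) (auto simp: power2_eq_square)
  have "(560 + 2 * 2) * ((real d - 1) * ln (real T + 560 * real d) + 1) \<le> 564 * real d * ln (real T + 560 * real d)"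
  proof -
    have "exp 1 \<le> real T + 560 * real d" using exp_le assms(1) by simp
    then have "ln (exp 1) \<le> ln (real T + 560 * real d)" by (intro ln_mono) auto
    then show ?thesis by (simp add: algebra_simps)
  qed
  with run have "regret d T x (vb_ftrl_qn d 560 2 S x) \<le> ereal (564 * real d * ln (real T + 560 * real d))"
    by (meson ereal_less_eq(3) order_trans)
  with run show "let S = 18 * nat \<lceil>ln (real T + real d + 164)\<rceil> + 7 in
        well_defined_run d 560 2 S x T \<and>
        (\<forall>t\<in>{1..T}. vb_ftrl_qn d 560 2 S x t \<in> std_simplex d) \<and>
        regret d T x (vb_ftrl_qn d 560 2 S x)
          \<le> ereal (564 * real d * ln (real T + 560 * real d))"
    unfolding S_def[symmetric] Let_def by blast
qed

end
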